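(* Let $G=(V,E)$ be an $n$-vertex hypergraph of rank $r$ with hyperedge-cost function $c\colon E\to\mathbb{R}_+$, vertex-weight functions $w_1,\dots,w_t\colon V\to\mathbb{R}_+$, and budget-vector $b\in\mathbb{R}^t_+$. Let $F$ be an arbitrary node-budgeted $b$-multiobjective min-cut of $G$. Then the algorithm $\mathcal{N}$ described in the context returns $F$ with probability at least $\frac{1}{2^{r+1}\binom{n}{2}}$. Moreover, $\mathcal{N}$ can be implemented to run in polynomial time.
   Context: $\delta(U)$ is the set of hyperedges meeting both $U$ and $V\setminus U$; $c(F)=\sum_{e\in F}c(e)$; $w_i(U)=\sum_{u\in U}w_i(u)$. A vertex $v$ is feasible if $w_i(v)\le b_i$ for all $i$, else infeasible; a set $U$ is feasible if $w_i(U)\le b_i$ for all $i$. $F\subseteq E$ is a node-budgeted $b$-multiobjective min-cut if $F=\delta(X)$ for some feasible $X$ with $\emptyset\ne X\subsetneq V$ and $c(F)$ is minimum among all such. Contraction of $U\subseteq V$: replace $U$ by a new vertex $u$ with $w_i(u)=\sum_{v\in U}w_i(v)$; each hyperedge $e\not\subseteq U$ becomes $e$ if disjoint from $U$ and $(e\setminus U)\cup\{u\}$ otherwise (same cost); hyperedges inside $U$ are deleted; hyperedges are identified with their originals. Algorithm $\mathcal{N}(G,r,t,w,c,b)$: contract all infeasible vertices of $G$ into a single vertex; if the resulting hypergraph has at most $r+1$ vertices, return $\delta(X)$ for a uniformly random subset $X$ of its vertex set; otherwise choose a hyperedge $e$ with probability $c(e)/c(E)$, contract $e$ (with weight summation),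 and return $\mathcal{N}$ applied to the result.
   Formalization: Hyperedge costs are taken strictly positive (with all costs zero the choice probability c(e)/c(E) is undefined), and the algorithm also stops, returning the empty set, when no hyperedges remain though more than r+1 vertices do; time is counted in exact real arithmetic with biased coins. *)

theory Defs
  imports "HOL-Probability.Probability" "HOL-Computational_Algebra.Polynomial"
begin

section \<open>Hypergraphs, cuts and budgets\<close>

text \<open>Hyperedges are identifiers with a set of end vertices. Contraction changes the ends but not
  the identifiers, so hyperedges stay identified with their originals even when they become
  parallel, and a cut is a set of identifiers.\<close>

record ('v, 'e) hypergraph =
  verts :: "'v set"
  hedges :: "'e set"
  ends :: "'e \<Rightarrow> 'v set"

definition wf_hypergraph :: "('v, 'e) hypergraph \<Rightarrow> bool" where
  "wf_hypergraph G \<longleftrightarrow> finite (verts G) \<and> finite (hedges G) \<and>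
     (\<forall>e \<in> hedges G. ends G e \<noteq> {} \<and> ends G e \<subseteq> verts G)"

definition rank :: "('v, 'e) hypergraph \<Rightarrow> nat" where
  "rank G = Max (insert 0 ((\<lambda>e. card (ends G e)) ` hedges G))"

definition cut :: "('v, 'e) hypergraph \<Rightarrow> 'v set \<Rightarrow> 'e set" where
  "cut G U = {e \<in> hedges G. ends G e \<inter> U \<noteq> {} \<and> ends G e \<inter> (verts G - U) \<noteq> {}}"

definition feasible :: "nat \<Rightarrow> (nat \<Rightarrow> 'v \<Rightarrow> real) \<Rightarrow> (nat \<Rightarrow> real) \<Rightarrow> 'v set \<Rightarrow> bool" where
  "feasible t w b U \<longleftrightarrow> (\<forall>i \<in> {1..t}. sum (w i) U \<le> b i)"

definition infeasible_verts ::
    "('v, 'e) hypergraph \<Rightarrow> nat \<Rightarrow> (nat \<Rightarrow> 'v \<Rightarrow> real) \<Rightarrow> (nat \<Rightarrow> real) \<Rightarrow> 'v set" where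
  "infeasible_verts G t w b = {v \<in> verts G. \<not> (\<forall>i \<in> {1..t}. w i v \<le> b i)}"

definition budgeted_side ::
    "('v, 'e) hypergraph \<Rightarrow> nat \<Rightarrow> (nat \<Rightarrow> 'v \<Rightarrow> real) \<Rightarrow> (nat \<Rightarrow> real) \<Rightarrow> 'v set \<Rightarrow> bool" where
  "budgeted_side G t w b X \<longleftrightarrow> X \<noteq> {} \<and> X \<subset> verts G \<and> feasible t w b X"

definition node_budgeted_min_cut ::
    "('v, 'e) hypergraph \<Rightarrow> nat \<Rightarrow> (nat \<Rightarrow> 'v \<Rightarrow> real) \<Rightarrow> ('e \<Rightarrow> real) \<Rightarrow> (nat \<Rightarrow> real) \<Rightarrow>
     'e set \<Rightarrow> bool" where
  "node_budgeted_min_cut G t w c b F \<longleftrightarrow>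
     (\<exists>X. budgeted_side G t w b X \<and> F = cut G X) \<and>
     (\<forall>Y. budgeted_side G t w b Y \<longrightarrow> sum c F \<le> sum c (cut G Y))"

text \<open>Costs have to be strictly positive: if all hyperedges of a long path had cost zero, then
  each of its exponentially many cuts would be minimum, and no algorithm could return
  every one of them with inverse polynomial probability. Weights and budgets may vanish.\<close>

definition valid_instance ::
    "('v, 'e) hypergraph \<Rightarrow> nat \<Rightarrow> nat \<Rightarrow> (nat \<Rightarrow> 'v \<Rightarrow> real) \<Rightarrow> ('e \<Rightarrow> real) \<Rightarrow> (nat \<Rightarrow> real) \<Rightarrow>
     bool" where
  "valid_instance G r t w c b \<longleftrightarrow> wf_hypergraph G \<and> rank G = r \<and>
     (\<forall>e \<in> hedges G. 0 < c e) \<and>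
     (\<forall>i \<in> {1..t}. \<forall>v \<in> verts G. 0 \<le> w i v) \<and>
     (\<forall>i \<in> {1..t}. 0 \<le> b i)"


section \<open>The contraction algorithm\<close>

text \<open>The vertex that replaces \<open>U\<close> carries the name of a member of \<open>U\<close>, which is no longer in use
  after the contraction; contracting the empty set changes nothing.\<close>

definition merged :: "'v set \<Rightarrow> 'v" where
  "merged U = (SOME u. u \<in> U)"

definition contract :: "'v set \<Rightarrow> ('v, 'e) hypergraph \<Rightarrow> ('v, 'e) hypergraph" where
  "contract U G = (if U = {} then G else
     \<lparr>verts = insert (merged U) (verts G - U),
      hedges = {e \<in> hedges G. \<not> ends G e \<subseteq> U},
      ends = (\<lambda>e. if ends G e \<inter> U = {} then ends G e else insert (merged U) (ends G e - U))\<rparr>)"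

definition contract_weights :: "'v set \<Rightarrow> (nat \<Rightarrow> 'v \<Rightarrow> real) \<Rightarrow> nat \<Rightarrow> 'v \<Rightarrow> real" where
  "contract_weights U w = (if U = {} then w else (\<lambda>i. (w i)(merged U := sum (w i) U)))"

definition random_hedge :: "('v, 'e) hypergraph \<Rightarrow> ('e \<Rightarrow> real) \<Rightarrow> 'e spmf" where
  "random_hedge G c = embed_spmf (\<lambda>e. if e \<in> hedges G then c e / sum c (hedges G) else 0)"

text \<open>If no hyperedge is left, there is nothing to choose from, and the algorithm also stops;
  the set it returns is then empty whatever the random subset is.\<close>

partial_function (spmf) alg_N ::
    "('v, 'e) hypergraph \<Rightarrow> nat \<Rightarrow> nat \<Rightarrow> (nat \<Rightarrow> 'v \<Rightarrow> real) \<Rightarrow> ('e \<Rightarrow> real) \<Rightarrow> (nat \<Rightarrow> real) \<Rightarrow>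
     'e set spmf" where
  "alg_N G r t w c b =
     (let U = infeasible_verts G t w b; H = contract U G; w' = contract_weights U w in
      if card (verts H) \<le> r + 1 \<or> hedges H = {}
      then map_spmf (cut H) (spmf_of_set (Pow (verts H)))
      else bind_spmf (random_hedge H c)
             (\<lambda>e. alg_N (contract (ends H e) H) r t (contract_weights (ends H e) w') c b))"


section \<open>A randomized real RAM\<close>

text \<open>Programs are while programs over two-dimensional arrays of natural numbers and of real
  numbers; an array name is a natural number, and a scalar is one fixed cell of an array. Every
  step has unit cost. Natural numbers, which also serve as addresses, can only be added
  and subtracted, so that values of superpolynomial length cannot be produced in polynomial time.
  Real numbers have exact field operations and comparisons, but no rounding and no constants other
  than natural numbers. The source of randomness is a coin whose bias is a computed real number.\<close>

datatype nexp =
    NConst nat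
  | NCell nat nexp nexp
  | NPlus nexp nexp
  | NMinus nexp nexp

datatype rexp =
    RConst nat
  | RCell nat nexp nexp
  | RPlus rexp rexp
  | RMinus rexp rexp
  | RTimes rexp rexp
  | RDivide rexp rexp

datatype bexp =
    NLe nexp nexp
  | RLe rexp rexp
  | Neg bexp
  | Conj bexp bexp

datatype com =
    Skip
  | NAssign nat nexp nexp nexp
  | RAssign nat nexp nexp rexp
  | Seq com com
  | Cond bexp com com
  | While bexp com
  | Coin rexp com com

record state =
  nmem :: "nat \<Rightarrow> nat \<Rightarrow> nat \<Rightarrow> nat"
  rmem :: "nat \<Rightarrow> nat \<Rightarrow> nat \<Rightarrow> real"

primrec nval :: "nexp \<Rightarrow> state \<Rightarrow> nat" where
  "nval (NConst k) s = k"
| "nval (NCell a i j) s = nmem s a (nval i s) (nval j s)"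
| "nval (NPlus x y) s = nval x s + nval y s"
| "nval (NMinus x y) s = nval x s - nval y s"

primrec rval :: "rexp \<Rightarrow> state \<Rightarrow> real" where
  "rval (RConst k) s = real k"
| "rval (RCell a i j) s = rmem s a (nval i s) (nval j s)"
| "rval (RPlus x y) s = rval x s + rval y s"
| "rval (RMinus x y) s = rval x s - rval y s"
| "rval (RTimes x y) s = rval x s * rval y s"
| "rval (RDivide x y) s = rval x s / rval y s"

primrec bval :: "bexp \<Rightarrow> state \<Rightarrow> bool" where
  "bval (NLe x y) s \<longleftrightarrow> nval x s \<le> nval y s"
| "bval (RLe x y) s \<longleftrightarrow> rval x s \<le> rval y s"
| "bval (Neg p) s \<longleftrightarrow> \<not> bval p s"
| "bval (Conj p q) s \<longleftrightarrow> bval p s \<and> bval q s"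

definition upd_cell ::
    "(nat \<Rightarrow> nat \<Rightarrow> nat \<Rightarrow> 'x) \<Rightarrow> nat \<Rightarrow> nat \<Rightarrow> nat \<Rightarrow> 'x \<Rightarrow> (nat \<Rightarrow> nat \<Rightarrow> nat \<Rightarrow> 'x)" where
  "upd_cell m a i j x = m(a := (m a)(i := (m a i)(j := x)))"

text \<open>\<open>bernoulli_pmf\<close> truncates its argument to the unit interval. \<open>Skip\<close> is the halted program.\<close>

primrec step :: "com \<Rightarrow> state \<Rightarrow> (com \<times> state) pmf" where
  "step Skip s = return_pmf (Skip, s)"
| "step (NAssign a i j x) s =
     return_pmf (Skip, s\<lparr>nmem := upd_cell (nmem s) a (nval i s) (nval j s) (nval x s)\<rparr>)"
| "step (RAssign a i j x) s =
     return_pmf (Skip, s\<lparr>rmem := upd_cell (rmem s) a (nval i s) (nval j s) (rval x s)\<rparr>)"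
| "step (Seq p q) s =
     (if p = Skip then return_pmf (q, s)
      else map_pmf (\<lambda>(p', s'). (Seq p' q, s')) (step p s))"
| "step (Cond g p q) s = return_pmf (if bval g s then p else q, s)"
| "step (While g p) s = return_pmf (if bval g s then Seq p (While g p) else Skip, s)"
| "step (Coin x p q) s =
     map_pmf (\<lambda>h. (if h then p else q, s)) (bernoulli_pmf (rval x s))"

primrec run :: "nat \<Rightarrow> com \<Rightarrow> state \<Rightarrow> (com \<times> state) pmf" where
  "run 0 p s = return_pmf (p, s)"
| "run (Suc k) p s = bind_pmf (step p s) (\<lambda>(p', s'). run k p' s')"

definition halts_within :: "nat \<Rightarrow> com \<Rightarrow> state \<Rightarrow> bool" where
  "halts_within T p s \<longleftrightarrow> (\<forall>(p', s') \<in> set_pmf (run T p s). p' = Skip)"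


section \<open>Input and output of programs\<close>

text \<open>An input hypergraph has vertices \<open>0, \<dots>, n - 1\<close> and hyperedges \<open>0, \<dots>, m - 1\<close>.
  Natural number array 0 holds \<open>n, m, r, t\<close> in its row 0, and array 1 is the incidence matrix;
  real arrays 0, 1 and 2 hold the costs, the weights and the budgets. All other cells are zero.\<close>

definition labelled :: "(nat, nat) hypergraph \<Rightarrow> bool" where
  "labelled G \<longleftrightarrow> verts G = {..<card (verts G)} \<and> hedges G = {..<card (hedges G)}"

definition input_state ::
    "(nat, nat) hypergraph \<Rightarrow> nat \<Rightarrow> nat \<Rightarrow> (nat \<Rightarrow> nat \<Rightarrow> real) \<Rightarrow> (nat \<Rightarrow> real) \<Rightarrow> (nat \<Rightarrow> real) \<Rightarrow>
     state" where
  "input_state G r t w c b =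
     \<lparr>nmem = (\<lambda>a i j.
        if a = 0 \<and> i = 0 \<and> j < 4 then [card (verts G), card (hedges G), r, t] ! j
        else if a = 1 \<and> i \<in> hedges G \<and> j \<in> ends G i then 1
        else 0),
      rmem = (\<lambda>a i j.
        if a = 0 \<and> i \<in> hedges G \<and> j = 0 then c i
        else if a = 1 \<and> i \<in> {1..t} \<and> j \<in> verts G then w i j
        else if a = 2 \<and> i \<in> {1..t} \<and> j = 0 then b i
        else 0)\<rparr>"

text \<open>The result is read off column 0 of natural number array 2.\<close>

definition output_cut :: "(nat, nat) hypergraph \<Rightarrow> state \<Rightarrow> nat set" where
  "output_cut G s = {e \<in> hedges G. nmem s 2 e 0 = 1}"

definition input_size :: "(nat, nat) hypergraph \<Rightarrow> nat \<Rightarrow> nat" where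
  "input_size G t = card (verts G) + card (hedges G) + t"

end

theory Submission
  imports Defs
begin

text \<open>
  A set \<open>F = \<delta>(X)\<close> survives the contraction of a hyperedge \<open>e \<notin> F\<close>, because \<open>e\<close> lies on one side
  of \<open>X\<close>. After the first contraction at most one vertex is infeasible, so in a hypergraph with
  \<open>k\<close> vertices at least \<open>k - 1\<close> single vertices are sides of budgeted cuts, and summing their degrees
  gives \<open>(k - 1 - r) c(F) \<le> \<Sum>\<^sub>e c(e) |e|\<close>, the sum taken over the hyperedges \<open>e \<notin> F\<close> with \<open>|e| \<ge> 2\<close>.
  By induction \<open>F\<close> is returned with probability at least \<open>1 / (2\<^sup>r\<^sup>+\<^sup>1 (k - r + 1 choose 2))\<close>
  if \<open>k > r\<close>, and at least \<open>1 / 2\<^sup>k\<close> if \<open>k \<le> r + 1\<close>: relative to this bound, the contraction of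
  \<open>e\<close> gains a factor of at least \<open>1 + |e| / (k - 1 - r)\<close>, which pays for the failures \<open>e \<in> F\<close>.

  The program never renames vertices. It labels each original vertex with a number, vertices with
  equal labels being merged, and every contraction uses up a fresh label, so that the choice made by
  \<open>merged\<close> is irrelevant. As \<open>spmf\<close> is \<open>pmf\<close> over the option type, the distribution of \<open>alg_N\<close>
  itself serves as the specification of the main loop.
\<close>

section \<open>Identifying vertices\<close>

text \<open>Contracting a hyperedge with \<open>s\<close> ends removes \<open>s - 1\<close> vertices
  at once and may jump past the threshold at which the algorithm stops. The bound therefore has to
  fit together on both sides of \<open>k = r + 1\<close>, and a jump below the threshold is paid for
  by a power of two, through Bernoulli's inequality. Contraction may also lower the rank while the
  algorithm keeps \<open>r\<close>, so the induction assumes an upper bound on the sizes of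
  hyperedges rather than the exact rank.

  Both halves of the proof compare a contracted hypergraph with an earlier one: cuts and budgets are
  pulled back in the first half, and in the second the program sees the original vertices only.
  Contraction is therefore treated as a quotient by a map on the vertices. The labels kept by the
  program have the same fibres as this map. Couplings relate single program states to single results
  of \<open>alg_N\<close>, so that no distribution over program states has to be described.\<close>

text \<open>The set \<open>A\<close> is a separate parameter because \<open>f\<close> does not
  determine it: contracting a hyperedge with a single end deletes that hyperedge but leaves
  \<open>f\<close> unchanged. Weights are prescribed on the vertices of \<open>H\<close> only, since
  \<open>contract_weights\<close> leaves old values at names that are no longer in use.\<close>

definition vertex_quotient ::
    "('v, 'e) hypergraph \<Rightarrow> nat \<Rightarrow> (nat \<Rightarrow> 'v \<Rightarrow> real) \<Rightarrow> ('v \<Rightarrow> 'v) \<Rightarrow> 'e set \<Rightarrow>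
     ('v, 'e) hypergraph \<Rightarrow> (nat \<Rightarrow> 'v \<Rightarrow> real) \<Rightarrow> bool" where
  "vertex_quotient G t w f A H w' \<longleftrightarrow>
     verts H = f ` verts G \<and> hedges H = A \<and> A \<subseteq> hedges G \<and> (\<forall>e\<in>A. ends H e = f ` ends G e) \<and>
     (\<forall>i\<in>{1..t}. \<forall>v\<in>verts H. w' i v = sum (w i) {u \<in> verts G. f u = v})"

lemma merged_in: "U \<noteq> {} \<Longrightarrow> merged U \<in> U"
  unfolding merged_def by (rule some_in_eq[THEN iffD2])

text \<open>This expresses infeasibility in a contracted hypergraph through the original weights of
  fibres, which is the form in which the program tests it.\<close>

lemma vertex_quotient_infeasible:
  assumes "vertex_quotient G t w f A H w'"
  shows "infeasible_verts H t w' b =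
    f ` {v \<in> verts G. \<exists>i\<in>{1..t}. b i < sum (w i) {u \<in> verts G. f u = f v}}"
proof -
  have "\<not> (\<forall>i\<in>{1..t}. w' i (f v) \<le> b i) \<longleftrightarrow>
      (\<exists>i\<in>{1..t}. b i < sum (w i) {u \<in> verts G. f u = f v})" if "v \<in> verts G" for v
    using assms that by (auto simp: vertex_quotient_def not_le)
  then have "{v \<in> verts G. \<not> (\<forall>i\<in>{1..t}. w' i (f v) \<le> b i)} =
      {v \<in> verts G. \<exists>i\<in>{1..t}. b i < sum (w i) {u \<in> verts G. f u = f v}}"
    by (intro Collect_cong conj_cong refl)
  moreover have "verts H = f ` verts G"
    using assms by (simp add: vertex_quotient_def)
  ultimately show ?thesis
    unfolding infeasible_verts_def by (simp only: Compr_image_eq)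
qed

text \<open>By \<open>sat\<close>, \<open>M\<close> is a union of fibres of \<open>f\<close>, so
  membership in \<open>M\<close> can be tested on images and \<open>f\<close> commutes with the set
  operations in \<open>contract\<close>. The fibre over the merged vertex becomes \<open>M\<close>,
  whose weight is the sum over the old fibres inside it.\<close>

lemma vertex_quotient_contract:
  assumes G: "wf_hypergraph G" and q: "vertex_quotient G t w f A H w'" and M: "M \<subseteq> verts G"
    and sat: "\<And>x y. x \<in> M \<Longrightarrow> y \<in> verts G \<Longrightarrow> f x = f y \<Longrightarrow> y \<in> M"
  shows "vertex_quotient G t w (\<lambda>v. if v \<in> M then merged (f ` M) else f v) {e \<in> A. \<not> ends G e \<subseteq> M}
    (contract (f ` M) H) (contract_weights (f ` M) w')"
proof (cases "M = {}")
  case True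
  \<comment> \<open>Well-formedness excludes hyperedges without ends, so contracting nothing deletes
    nothing.\<close>
  have "{e \<in> A. \<not> ends G e \<subseteq> {}} = A"
    using G q by (auto simp: wf_hypergraph_def vertex_quotient_def)
  with True q show ?thesis by (simp add: contract_def contract_weights_def)
next
  case False
  define m where "m = merged (f ` M)"
  have m: "m \<in> f ` M" using False by (simp add: m_def merged_in)
  have mem: "f u \<in> f ` M \<longleftrightarrow> u \<in> M" if "u \<in> verts G" for u
    using sat that by (metis imageE imageI)
  have fin: "finite (verts G)" using G by (simp add: wf_hypergraph_def)
  have endsG: "ends G e \<subseteq> verts G" if "e \<in> A" for e
    using G q that by (auto simp: wf_hypergraph_def vertex_quotient_def)
  have vertsH: "verts H = f ` verts G" and hedgesH: "hedges H = A"
    and endsH: "\<And>e. e \<in> A \<Longrightarrow> ends H e = f ` ends G e"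
    and w': "\<And>i v. i \<in> {1..t} \<Longrightarrow> v \<in> f ` verts G \<Longrightarrow> w' i v = sum (w i) {u \<in> verts G. f u = v}"
    and "A \<subseteq> hedges G"
    using q by (auto simp: vertex_quotient_def)
  let ?f = "\<lambda>v. if v \<in> M then m else f v"
  have diff: "f ` (E - M) = f ` E - f ` M" if "E \<subseteq> verts G" for E
  proof
    show "f ` (E - M) \<subseteq> f ` E - f ` M"
      using mem that by fastforce
  qed auto
  have img: "?f ` E = (if E \<inter> M = {} then f ` E else insert m (f ` E - f ` M))"
    if E: "E \<subseteq> verts G" for E
  proof (cases "E \<inter> M = {}")
    case True
    then have "?f ` E = f ` E" by (intro image_cong) auto
    with True show ?thesis by simp
  next
    case False
    have "?f ` E = ?f ` (E \<inter> M) \<union> ?f ` (E - M)" by auto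
    also have "?f ` (E \<inter> M) = {m}" using False by auto
    also have "?f ` (E - M) = f ` E - f ` M"
      unfolding diff[OF E, symmetric] by (intro image_cong) auto
    finally show ?thesis using False by simp
  qed
  have disj: "f ` E \<inter> f ` M = {} \<longleftrightarrow> E \<inter> M = {}"
    and sub: "f ` E \<subseteq> f ` M \<longleftrightarrow> E \<subseteq> M" if E: "E \<subseteq> verts G" for E
  proof -
    have *: "f u \<in> f ` M \<longleftrightarrow> u \<in> M" if "u \<in> E" for u
      using E that mem by auto
    have "f ` E \<inter> f ` M = {} \<longleftrightarrow> (\<forall>u\<in>E. f u \<notin> f ` M)" by auto
    also have "\<dots> \<longleftrightarrow> (\<forall>u\<in>E. u \<notin> M)" using * by simp
    finally show "f ` E \<inter> f ` M = {} \<longleftrightarrow> E \<inter> M = {}" by auto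
    have "f ` E \<subseteq> f ` M \<longleftrightarrow> (\<forall>u\<in>E. f u \<in> f ` M)" by auto
    also have "\<dots> \<longleftrightarrow> (\<forall>u\<in>E. u \<in> M)" using * by simp
    finally show "f ` E \<subseteq> f ` M \<longleftrightarrow> E \<subseteq> M" by auto
  qed
  have verts: "insert m (f ` verts G - f ` M) = ?f ` verts G"
    using img[of "verts G"] M False by (auto simp: Int_absorb1)
  have weights: "contract_weights (f ` M) w' i v = sum (w i) {u \<in> verts G. ?f u = v}"
    if i: "i \<in> {1..t}" and v: "v \<in> ?f ` verts G" for i v
  proof (cases "v = m")
    case True
    have "{u \<in> verts G. ?f u = m} = M"
      using M mem m by auto
    moreover have "sum (w' i) (f ` M) = (\<Sum>v\<in>f ` M. sum (w i) {u \<in> M. f u = v})"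
    proof (rule sum.cong[OF refl])
      fix v assume v: "v \<in> f ` M"
      then have "{u \<in> verts G. f u = v} = {u \<in> M. f u = v}"
        using M mem by auto
      with v show "w' i v = sum (w i) {u \<in> M. f u = v}"
        using w'[OF i] M by auto
    qed
    moreover have "\<dots> = sum (w i) M"
      using fin M by (intro sum.image_gen[symmetric]) (rule finite_subset)
    ultimately show ?thesis
      using True False by (simp add: contract_weights_def m_def)
  next
    case neq: False
    from v obtain u where u: "u \<in> verts G" "v = ?f u" by blast
    with neq have "u \<notin> M" by auto
    with u mem[OF u(1)] have v': "v \<in> f ` verts G" "v \<notin> f ` M" by simp_all
    \<comment> \<open>A member of \<open>M\<close> satisfies neither equation, because
      \<open>v\<close> is neither \<open>m\<close> nor in the image of \<open>M\<close>.\<close>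
    have "?f u = v \<longleftrightarrow> f u = v" for u
      using neq v'(2) by (cases "u \<in> M") auto
    then have "{u \<in> verts G. ?f u = v} = {u \<in> verts G. f u = v}"
      by simp
    then show ?thesis
      using neq w'[OF i v'(1)] False by (simp add: contract_weights_def m_def)
  qed
  have contr: "contract (f ` M) H = \<lparr>verts = insert m (verts H - f ` M),
      hedges = {e \<in> hedges H. \<not> ends H e \<subseteq> f ` M},
      ends = (\<lambda>e. if ends H e \<inter> f ` M = {} then ends H e else insert m (ends H e - f ` M))\<rparr>"
    using False unfolding m_def contract_def by simp
  have hedges: "{e \<in> A. \<not> ends H e \<subseteq> f ` M} = {e \<in> A. \<not> ends G e \<subseteq> M}"
    using endsH sub[OF endsG] by (intro Collect_cong conj_cong refl) simp
  have ends: "(if ends H e \<inter> f ` M = {} then ends H e else insert m (ends H e - f ` M)) = ?f ` ends G e"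
    if "e \<in> A" for e
    using that by (simp only: endsH img[OF endsG] disj[OF endsG])
  show ?thesis
    unfolding vertex_quotient_def m_def[symmetric] contr hypergraph.simps vertsH hedgesH verts hedges
  proof (intro conjI ballI refl)
    show "{e \<in> A. \<not> ends G e \<subseteq> M} \<subseteq> hedges G"
      using \<open>A \<subseteq> hedges G\<close> by auto
  qed (use ends weights in auto)
qed

section \<open>The success probability\<close>

text \<open>Positive costs divided by their total sum to one, which is what
  \<open>embed_spmf\<close> requires of a density. The second claim lets the program rely on a
  hyperedge being chosen.\<close>

lemma spmf_random_hedge:
  assumes "finite (hedges H)" "hedges H \<noteq> {}" "\<And>e. e \<in> hedges H \<Longrightarrow> 0 < c e"
  shows "spmf (random_hedge H c) e = (if e \<in> hedges H then c e / sum c (hedges H) else 0)"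
    and "lossless_spmf (random_hedge H c)"
proof -
  let ?f = "\<lambda>e. if e \<in> hedges H then c e / sum c (hedges H) else 0"
  have pos: "0 < sum c (hedges H)" using assms by (intro sum_pos) auto
  have nn: "0 \<le> ?f e" for e using assms(3)[of e] pos by auto
  have "(\<integral>\<^sup>+ e. ennreal (?f e) \<partial>count_space UNIV) =
      (\<integral>\<^sup>+ e. ennreal (?f e) * indicator (hedges H) e \<partial>count_space UNIV)"
    by (intro nn_integral_cong) (auto simp: indicator_def)
  also have "\<dots> = (\<Sum>e\<in>hedges H. ennreal (?f e))"
    using assms(1) by (subst nn_integral_count_space_indicator[symmetric])
      (auto simp: nn_integral_count_space_finite)
  also have "\<dots> = ennreal (\<Sum>e\<in>hedges H. ?f e)"
    using nn by (intro sum_ennreal)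
  also have "(\<Sum>e\<in>hedges H. ?f e) = 1"
    using pos by (simp add: sum_divide_distrib[symmetric])
  finally have total: "(\<integral>\<^sup>+ e. ennreal (?f e) \<partial>count_space UNIV) = 1" by simp
  show spmf: "spmf (random_hedge H c) e = ?f e" for e
    unfolding random_hedge_def using nn total by (subst spmf_embed_spmf) auto
  show "lossless_spmf (random_hedge H c)"
  proof -
    have "ennreal (weight_spmf (random_hedge H c)) = 1"
      unfolding weight_spmf_eq_nn_integral_spmf spmf by (rule total)
    then show ?thesis by (simp add: lossless_spmf_def)
  qed
qed

section \<open>Minimum cuts under contraction\<close>

text \<open>The part of \<open>valid_instance\<close> that contraction preserves: sizes of
  hyperedges stay bounded by \<open>r\<close>, while the rank itself may drop.\<close>

definition nonneg_instance ::
    "('v, 'e) hypergraph \<Rightarrow> nat \<Rightarrow> nat \<Rightarrow> (nat \<Rightarrow> 'v \<Rightarrow> real) \<Rightarrow> ('e \<Rightarrow> real) \<Rightarrow> bool" where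
  "nonneg_instance G r t w c \<longleftrightarrow> wf_hypergraph G \<and> (\<forall>e\<in>hedges G. card (ends G e) \<le> r \<and> 0 < c e) \<and>
     (\<forall>i\<in>{1..t}. \<forall>v\<in>verts G. 0 \<le> w i v)"

lemma vertex_quotient_nonneg:
  assumes G: "nonneg_instance G r t w c" and q: "vertex_quotient G t w f A H w'"
  shows "nonneg_instance H r t w' c"
proof -
  have fin: "finite (verts G)" "finite (hedges G)" and
    E: "\<And>e. e \<in> hedges G \<Longrightarrow> ends G e \<noteq> {} \<and> ends G e \<subseteq> verts G \<and> card (ends G e) \<le> r \<and> 0 < c e"
    using G by (auto simp: nonneg_instance_def wf_hypergraph_def)
  have H: "verts H = f ` verts G" "hedges H = A" "A \<subseteq> hedges G" "\<And>e. e \<in> A \<Longrightarrow> ends H e = f ` ends G e"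
    using q by (auto simp: vertex_quotient_def)
  have "card (f ` ends G e) \<le> r" if "e \<in> A" for e
  proof -
    have "finite (ends G e)" using E fin(1) H(3) that by (meson finite_subset subsetD)
    then have "card (f ` ends G e) \<le> card (ends G e)" by (rule card_image_le)
    with E H(3) that show ?thesis by fastforce
  qed
  moreover have "finite A" using H(3) fin(2) by (rule finite_subset)
  moreover have "0 \<le> w' i v" if "i \<in> {1..t}" "v \<in> verts H" for i v
  proof -
    have "w' i v = sum (w i) {u \<in> verts G. f u = v}"
      using q that by (auto simp: vertex_quotient_def)
    also have "\<dots> \<ge> 0"
      using G that(1) by (intro sum_nonneg) (auto simp: nonneg_instance_def)
    finally show ?thesis .
  qed
  moreover have "ends H e \<noteq> {}" "ends H e \<subseteq> verts H" "0 < c e" if "e \<in> A" for e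
    using E[of e] that H(3) unfolding H(1) H(4)[OF that] by auto
  ultimately show ?thesis
    using fin(1) unfolding nonneg_instance_def wf_hypergraph_def H(2) by (auto simp: H(1,4))
qed

text \<open>Taking preimages under \<open>f\<close> matches the sides of \<open>H\<close> with those
  sides of \<open>G\<close> that are unions of fibres. By \<open>del\<close>, a deleted hyperedge
  lies in one fibre and hence crosses no such side, so even the cuts agree as sets of
  identifiers.\<close>

lemma vertex_quotient_side:
  assumes G: "wf_hypergraph G" and q: "vertex_quotient G t w f A H w'"
    and del: "\<forall>e\<in>hedges G - A. \<forall>u\<in>ends G e. \<forall>v\<in>ends G e. f u = f v"
    and Y: "Y \<subseteq> verts H" and X: "X = {v \<in> verts G. f v \<in> Y}"
  shows "budgeted_side H t w' b Y \<longleftrightarrow> budgeted_side G t w b X" and "cut H Y = cut G X"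
proof -
  have fin: "finite (verts G)" and E: "\<And>e. e \<in> hedges G \<Longrightarrow> ends G e \<subseteq> verts G"
    using G by (auto simp: wf_hypergraph_def)
  have H: "verts H = f ` verts G" "hedges H = A" "A \<subseteq> hedges G" "\<And>e. e \<in> A \<Longrightarrow> ends H e = f ` ends G e"
    using q by (auto simp: vertex_quotient_def)
  have fX: "f ` X = Y" using Y unfolding X H(1) by auto
  have "sum (w' i) Y = sum (w i) X" if i: "i \<in> {1..t}" for i
  proof -
    have "sum (w' i) Y = (\<Sum>v\<in>f ` X. sum (w i) {u \<in> X. f u = v})"
      unfolding fX
    proof (rule sum.cong[OF refl])
      fix v assume v: "v \<in> Y"
      then have "{u \<in> X. f u = v} = {u \<in> verts G. f u = v}" by (auto simp: X)
      with q i v Y show "w' i v = sum (w i) {u \<in> X. f u = v}"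
        by (auto simp: vertex_quotient_def)
    qed
    also have "\<dots> = sum (w i) X"
      using fin by (intro sum.image_gen[symmetric]) (simp add: X)
    finally show ?thesis .
  qed
  then have "feasible t w' b Y \<longleftrightarrow> feasible t w b X"
    by (simp add: feasible_def)
  moreover have "Y = {} \<longleftrightarrow> X = {}" using fX by auto
  moreover have "Y = verts H \<longleftrightarrow> X = verts G"
    using fX by (auto simp: X H(1))
  moreover have "X \<subseteq> verts G" by (auto simp: X)
  ultimately show "budgeted_side H t w' b Y \<longleftrightarrow> budgeted_side G t w b X"
    using Y by (auto simp: budgeted_side_def psubset_eq)
  have "e \<in> cut H Y \<longleftrightarrow> e \<in> cut G X" for e
  proof (cases "e \<in> A")
    case True
    then have sub: "ends G e \<subseteq> verts G" using E H(3) by auto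
    have "f ` ends G e \<inter> Y \<noteq> {} \<longleftrightarrow> ends G e \<inter> X \<noteq> {}"
      using sub by (auto simp: X)
    moreover have "f ` ends G e \<inter> (f ` verts G - Y) \<noteq> {} \<longleftrightarrow> ends G e \<inter> (verts G - X) \<noteq> {}"
      using sub by (auto simp: X)
    ultimately show ?thesis
      using True H(3) by (auto simp: cut_def H(1,2,4))
  next
    case False
    have "\<not> (ends G e \<inter> X \<noteq> {} \<and> ends G e \<inter> (verts G - X) \<noteq> {})" if e: "e \<in> hedges G"
    proof
      assume "ends G e \<inter> X \<noteq> {} \<and> ends G e \<inter> (verts G - X) \<noteq> {}"
      then obtain u v where uv: "u \<in> ends G e" "u \<in> X" "v \<in> ends G e" "v \<in> verts G" "v \<notin> X" by auto
      then have "f u = f v" using del e False by blast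
      with uv show False by (auto simp: X)
    qed
    with False show ?thesis by (auto simp: cut_def H(2))
  qed
  then show "cut H Y = cut G X" by blast
qed

text \<open>The case of the identity map, through which the facts about quotients apply to a single
  contraction.\<close>

lemma contract_vertex_quotient:
  assumes "wf_hypergraph G" "U \<subseteq> verts G"
  shows "vertex_quotient G t w (\<lambda>v. if v \<in> U then merged U else v) {e \<in> hedges G. \<not> ends G e \<subseteq> U}
    (contract U G) (contract_weights U w)"
proof -
  have "{u \<in> verts G. u = v} = {v}" if "v \<in> verts G" for v using that by auto
  then have "vertex_quotient G t w (\<lambda>v. v) (hedges G) G w"
    by (simp add: vertex_quotient_def)
  from vertex_quotient_contract[OF assms(1) this assms(2), unfolded image_ident] show ?thesis by simp
qed

text \<open>Every side of the contraction pulls back to a side of \<open>G\<close> with the same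
  cut, so the minimum cannot decrease; and \<open>X\<close>, not being split by \<open>U\<close>, is
  itself such a pullback, so \<open>F\<close> is still attained.\<close>

lemma min_cut_contract:
  assumes G: "wf_hypergraph G" and U: "U \<subseteq> verts G"
    and X: "budgeted_side G t w b X" "U \<subseteq> X \<or> U \<inter> X = {}"
    and F: "node_budgeted_min_cut G t w c b F" "F = cut G X"
  shows "node_budgeted_min_cut (contract U G) t (contract_weights U w) c b F"
proof -
  let ?f = "\<lambda>v. if v \<in> U then merged U else v"
  let ?H = "contract U G" and ?w = "contract_weights U w"
  note q = contract_vertex_quotient[OF G U]
  have del: "\<forall>e\<in>hedges G - {e \<in> hedges G. \<not> ends G e \<subseteq> U}. \<forall>u\<in>ends G e. \<forall>v\<in>ends G e. ?f u = ?f v"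
    by auto
  have verts: "verts ?H = ?f ` verts G" using q[of t w] by (simp add: vertex_quotient_def)
  note side = vertex_quotient_side[OF G q del]
  have "X \<subseteq> verts G" using X(1) by (auto simp: budgeted_side_def)
  have pre: "X = {v \<in> verts G. ?f v \<in> ?f ` X}"
  proof (intro equalityI subsetI)
    fix v assume "v \<in> {v \<in> verts G. ?f v \<in> ?f ` X}"
    then obtain u where v: "v \<in> verts G" "u \<in> X" "?f v = ?f u" by auto
    \<comment> \<open>The merged vertex bears the name of a member of \<open>U\<close>, so a vertex
      outside \<open>U\<close> never shares its image with one inside.\<close>
    show "v \<in> X"
    proof (cases "v \<in> U \<or> u \<in> U")
      case True
      then have "U \<noteq> {}" by auto
      then have "merged U \<in> U" by (rule merged_in)
      with v True X(2) show ?thesis by (auto split: if_splits)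
    qed (use v in auto)
  qed (use \<open>X \<subseteq> verts G\<close> in auto)
  have "?f ` X \<subseteq> verts ?H" using \<open>X \<subseteq> verts G\<close> unfolding verts by blast
  note side[OF this pre]
  with X(1) F(2) have "budgeted_side ?H t ?w b (?f ` X)" "cut ?H (?f ` X) = F"
    by auto
  moreover have "sum c F \<le> sum c (cut ?H Y)" if Y: "budgeted_side ?H t ?w b Y" for Y
  proof -
    have "Y \<subseteq> verts ?H" using Y by (auto simp: budgeted_side_def)
    note side[OF this refl]
    with Y F(1) show ?thesis by (simp add: node_budgeted_min_cut_def)
  qed
  ultimately show ?thesis unfolding node_budgeted_min_cut_def by blast
qed

text \<open>Weights are nonnegative, so a single infeasible member would already exceed a budget.
  Hence contracting the infeasible vertices splits no budgeted side.\<close>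

lemma budgeted_side_feasible:
  assumes "nonneg_instance G r t w c" "budgeted_side G t w b X"
  shows "infeasible_verts G t w b \<inter> X = {}"
proof -
  have "w i v \<le> b i" if "v \<in> X" "i \<in> {1..t}" for v i
  proof -
    have "X \<subseteq> verts G" using assms(2) by (auto simp: budgeted_side_def)
    moreover from this have "finite X"
      using assms(1) by (auto simp: nonneg_instance_def wf_hypergraph_def intro: finite_subset)
    ultimately have "w i v \<le> sum (w i) X"
      using assms(1) that by (intro member_le_sum) (auto simp: nonneg_instance_def)
    also have "\<dots> \<le> b i" using assms(2) that(2) by (auto simp: budgeted_side_def feasible_def)
    finally show ?thesis .
  qed
  then show ?thesis by (auto simp: infeasible_verts_def)
qed

text \<open>If nothing is infeasible, \<open>merged {}\<close> is an unspecified element, and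
  excluding it does no harm because all vertices are feasible.\<close>

lemma infeasible_verts_contract:
  assumes "v \<in> verts (contract (infeasible_verts G t w b) G)" "v \<noteq> merged (infeasible_verts G t w b)"
    and "i \<in> {1..t}"
  shows "contract_weights (infeasible_verts G t w b) w i v \<le> b i"
  using assms
  by (auto simp: contract_def contract_weights_def infeasible_verts_def split: if_splits)

text \<open>A vertex other than \<open>z\<close> is the side of a budgeted cut, and a hyperedge \<open>e\<close> lies in the cuts
  of at most \<open>card (ends G e)\<close> single vertices, and in none if it has only one end.\<close>

lemma min_cut_degree_bound:
  assumes G: "nonneg_instance G r t w c" and F: "node_budgeted_min_cut G t w c b F"
    and feas: "\<forall>i\<in>{1..t}. \<forall>v\<in>verts G - {z}. w i v \<le> b i"
    and card: "2 \<le> card (verts G)"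
  shows "(real (card (verts G)) - 1 - real r) * sum c F \<le>
    (\<Sum>e\<in>hedges G - F. c e * (if 2 \<le> card (ends G e) then real (card (ends G e)) else 0))"
proof -
  let ?V = "verts G" and ?E = "hedges G"
  let ?s = "\<lambda>e. if 2 \<le> card (ends G e) then real (card (ends G e)) else 0"
  have fin: "finite ?V" "finite ?E"
    and E: "\<And>e. e \<in> ?E \<Longrightarrow> ends G e \<noteq> {} \<and> ends G e \<subseteq> ?V \<and> card (ends G e) \<le> r \<and> 0 < c e"
    using G by (auto simp: nonneg_instance_def wf_hypergraph_def)
  have "F \<subseteq> ?E" using F by (auto simp: node_budgeted_min_cut_def cut_def)
  then have cF: "0 \<le> sum c F" using E by (intro sum_nonneg) (auto simp: less_imp_le)
  have deg: "sum c F \<le> sum c (cut G {v})" if v: "v \<in> ?V - {z}" for v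
  proof -
    have "{v} \<noteq> ?V" using card by (metis card_1_singleton_iff One_nat_def Suc_1 not_less_eq_eq order_refl)
    then have "budgeted_side G t w b {v}"
      using v feas by (auto simp: budgeted_side_def feasible_def)
    with F show ?thesis by (auto simp: node_budgeted_min_cut_def)
  qed
  \<comment> \<open>Only an inequality, as \<open>z\<close> may fail to be a vertex.\<close>
  have "(real (card ?V) - 1) * sum c F \<le> real (card (?V - {z})) * sum c F"
    using cF fin(1) by (intro mult_right_mono) (auto simp: card_Diff_singleton_if)
  also have "\<dots> = (\<Sum>v\<in>?V - {z}. sum c F)" by simp
  also have "\<dots> \<le> (\<Sum>v\<in>?V - {z}. sum c (cut G {v}))" by (intro sum_mono deg)
  also have "\<dots> \<le> (\<Sum>v\<in>?V. sum c (cut G {v}))"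
    using fin(1) E by (intro sum_mono2 sum_nonneg) (auto simp: cut_def less_imp_le)
  also have "\<dots> = (\<Sum>v\<in>?V. \<Sum>e\<in>?E. if e \<in> cut G {v} then c e else 0)"
  proof (rule sum.cong[OF refl])
    fix v
    have "cut G {v} = {e \<in> ?E. e \<in> cut G {v}}" by (auto simp: cut_def)
    with sum.inter_filter[OF fin(2), of c "\<lambda>e. e \<in> cut G {v}"]
    show "sum c (cut G {v}) = (\<Sum>e\<in>?E. if e \<in> cut G {v} then c e else 0)" by simp
  qed
  also have "\<dots> = (\<Sum>e\<in>?E. \<Sum>v\<in>?V. if e \<in> cut G {v} then c e else 0)"
    by (rule sum.swap)
  also have "\<dots> = (\<Sum>e\<in>?E. c e * real (card {v \<in> ?V. e \<in> cut G {v}}))"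
    using fin(1) by (intro sum.cong refl) (simp add: sum.inter_filter[symmetric])
  also have "\<dots> \<le> (\<Sum>e\<in>?E. c e * ?s e)"
  proof (intro sum_mono mult_left_mono)
    fix e assume e: "e \<in> ?E"
    have sub: "finite (ends G e)" using E[OF e] fin(1) by (auto intro: finite_subset)
    show "real (card {v \<in> ?V. e \<in> cut G {v}}) \<le> ?s e"
    proof (cases "2 \<le> card (ends G e)")
      case True
      have "card {v \<in> ?V. e \<in> cut G {v}} \<le> card (ends G e)"
        using sub by (intro card_mono) (auto simp: cut_def)
      with True show ?thesis by simp
    next
      case False
      then have "card (ends G e) = 1"
        using E[OF e] sub by (metis One_nat_def Suc_1 card_0_eq le_Suc_eq not_less_eq_eq le0 not_le less_one less_2_cases)
      then obtain u where "ends G e = {u}" by (rule card_1_singletonE)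
      then have none: "{v \<in> ?V. e \<in> cut G {v}} = {}" by (auto simp: cut_def)
      show ?thesis unfolding none by simp
    qed
    show "0 \<le> c e" using E[OF e] by simp
  qed
  also have "\<dots> = (\<Sum>e\<in>?E - F. c e * ?s e) + (\<Sum>e\<in>F. c e * ?s e)"
    using \<open>F \<subseteq> ?E\<close> fin(2) by (rule sum.subset_diff)
  \<comment> \<open>Only hyperedges of \<open>F\<close> are charged the full \<open>r\<close>. Those
    outside \<open>F\<close> keep their own size, to be matched against what contracting them
    gains.\<close>
  also have "(\<Sum>e\<in>F. c e * ?s e) \<le> (\<Sum>e\<in>F. c e * real r)"
    using E \<open>F \<subseteq> ?E\<close> by (intro sum_mono mult_left_mono) (auto simp: less_imp_le subset_iff)
  also have "\<dots> = real r * sum c F" by (simp add: sum_distrib_left mult.commute)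
  finally show ?thesis by (simp add: algebra_simps)
qed

section \<open>The lower bound as a function of the number of vertices\<close>

text \<open>At \<open>k = r + 1\<close> the last factor is one, so the second expression continues
  \<open>(1 / 2) ^ k\<close> by one more value. The binomial coefficient is written out over the
  reals to avoid truncated subtraction.\<close>

definition success :: "nat \<Rightarrow> nat \<Rightarrow> real" where
  "success r k = (if k \<le> r then (1 / 2) ^ k
     else (1 / 2) ^ (r + 1) * (2 / ((real k - real r + 1) * (real k - real r))))"

lemma success_nonneg: "0 \<le> success r k"
  by (auto simp: success_def)

lemma success_small: "k \<le> r + 1 \<Longrightarrow> success r k = (1 / 2) ^ k"
  by (auto simp: success_def le_Suc_eq)

lemma success_large:
  "1 \<le> j \<Longrightarrow> success r (r + j) = (1 / 2) ^ (r + 1) * (2 / ((real j + 1) * real j))"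
  by (simp add: success_def)

text \<open>Contracting the infeasible vertices may lower the number of vertices before any random
  choice; this shows that it costs nothing. The junction of the two regimes falls under
  \<open>success_small\<close>.\<close>

lemma success_antimono: "k \<le> l \<Longrightarrow> success r l \<le> success r k"
proof (rule lift_Suc_antimono_le[of "success r"])
  fix k
  show "success r (Suc k) \<le> success r k"
  proof (cases "k \<le> r")
    case True
    then show ?thesis by (simp add: success_small)
  next
    case False
    define j where "j = k - r"
    have j: "1 \<le> j" "k = r + j" "Suc k = r + Suc j" using False by (simp_all add: j_def)
    have "2 / ((real (Suc j) + 1) * real (Suc j)) \<le> 2 / ((real j + 1) * real j)"
      using j(1) by (intro divide_left_mono mult_mono) auto
    then show ?thesis
      unfolding j(3) unfolding j(2) using j(1)
      by (simp only: success_large le_SucI mult_left_mono zero_le_power divide_nonneg_pos zero_le_one zero_less_numeral)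
  qed
qed

lemma success_le_1: "success r k \<le> 1"
  using success_antimono[of 0 k r] by (simp add: success_small)

text \<open>For \<open>s = 2\<close> both sides agree; this is what determines the form of \<open>success\<close>.\<close>

lemma success_gain:
  assumes k: "r + 2 \<le> k" and s: "2 \<le> s" "s \<le> r"
  shows "success r k * (1 + real s / (real k - 1 - real r)) \<le> success r (k - s + 1)"
proof -
  define a where "a = k - r"
  have a: "2 \<le> a" "k = r + a" using k by (auto simp: a_def)
  let ?p = "(real a + 1) * real a * (real a - 1)"
  have p: "0 < ?p" using a(1) by simp
  have "1 + real s / (real k - 1 - real r) = (real a - 1 + real s) / (real a - 1)"
    using a by (simp add: add_divide_distrib)
  then have lhs: "success r k * (1 + real s / (real k - 1 - real r)) =
      (1 / 2) ^ (r + 1) * (2 * (real a - 1 + real s) / ?p)"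
    using a(1) unfolding a(2) by (simp only: success_large mult.assoc times_divide_times_eq)
  show ?thesis
  proof (cases "s \<le> a")
    case True
    \<comment> \<open>After the contraction the excess over \<open>r\<close> is
      \<open>d + 1\<close>. In terms of \<open>d\<close> and \<open>x\<close>, the polynomial
      inequality \<open>pq\<close> holds coefficient by coefficient, with equality at
      \<open>x = 0\<close>.\<close>
    define d x where "d = a - s" and "x = s - 2"
    have dx: "a = d + 2 + x" "s = x + 2" using True s(1) by (auto simp: d_def x_def)
    have pq: "(real d + 2) * (real d + 1) * (real a - 1 + real s) \<le> ?p"
      by (simp add: dx algebra_simps)
    have frac: "2 * x / P \<le> 2 / Q" if "Q * x \<le> P" "0 < P" "0 < Q" for x P Q :: real
      using that by (simp add: field_simps)
    have le: "2 * (real a - 1 + real s) / ?p \<le> 2 / ((real d + 2) * (real d + 1))"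
      by (rule frac[OF pq p]) simp
    have "k - s + 1 = r + (d + 1)" using a dx by simp
    then have eq: "success r (k - s + 1) = (1 / 2) ^ (r + 1) * (2 / ((real d + 2) * (real d + 1)))"
      by (simp add: success_def add.commute)
    show ?thesis
      unfolding lhs eq by (rule mult_left_mono[OF le]) simp
  next
    case False
    \<comment> \<open>Here the contraction leaves \<open>r + 1 - y\<close> vertices, at most
      \<open>r\<close>, and the bound there is \<open>2 ^ y\<close> times
      \<open>(1 / 2) ^ (r + 1)\<close>. A crude estimate by \<open>1 + y\<close> is enough, because
      Bernoulli's inequality gives \<open>1 + y \<le> 2 ^ y\<close>.\<close>
    define y where "y = s - a"
    have y: "s = a + y" "1 \<le> y" using False by (auto simp: y_def)
    define u where "u = a - 2"
    have u: "a = u + 2" using a(1) by (simp add: u_def)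
    have "2 * (real a - 1 + real s) \<le> (1 + real y) * ?p"
      by (simp add: u y(1) algebra_simps)
    then have "2 * (real a - 1 + real s) / ?p \<le> 1 + real y"
      using p by (simp add: divide_le_eq)
    also have "\<dots> \<le> 2 ^ y"
      using Bernoulli_inequality[of 1 y] by (simp add: add.commute)
    finally have "(1 / 2) ^ (r + 1) * (2 * (real a - 1 + real s) / ?p) \<le> (1 / 2) ^ (r + 1) * (2 ^ y :: real)"
      by (intro mult_left_mono) auto
    also have "r + 1 = (k - s + 1) + y" using a y s by simp
    then have "(1 / 2) ^ (r + 1) * (2 ^ y :: real) = (1 / 2) ^ (k - s + 1)"
      by (simp only: power_add) (simp add: power_one_over)
    also have "\<dots> = success r (k - s + 1)"
      using a y s by (intro success_small[symmetric]) simp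
    finally show ?thesis unfolding lhs .
  qed
qed

text \<open>For \<open>n > r\<close> it suffices that \<open>n - r + 1 \<le> n\<close>, which is
  where \<open>r \<ge> 1\<close> enters; for \<open>n \<le> r\<close> the power of two alone
  suffices.\<close>

lemma success_bound:
  assumes "1 \<le> r" "2 \<le> n"
  shows "1 / (2 ^ (r + 1) * real (n choose 2)) \<le> success r n"
proof (cases "n \<le> r")
  case True
  have "1 \<le> n choose 2" using assms(2) by (simp add: Suc_le_eq zero_less_binomial)
  then have "1 / (2 ^ (r + 1) * real (n choose 2)) \<le> 1 / (2 ^ (r + 1) * 1)"
    using assms(2) by (intro divide_left_mono mult_left_mono mult_pos_pos) auto
  also have "\<dots> \<le> (1 / 2) ^ n"
    using True power_decreasing[of n "r + 1" "1 / 2 :: real"] by (simp add: power_one_over)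
  finally show ?thesis using True by (simp add: success_def)
next
  case False
  have ch: "real (n choose 2) = real n * (real n - 1) / 2"
    using assms(2) by (simp add: choose_two real_of_nat_div of_nat_diff)
  have "(real n - real r + 1) * (real n - real r) \<le> real n * (real n - 1)"
    using assms False by (intro mult_mono) auto
  then have "2 / (real n * (real n - 1)) \<le> 2 / ((real n - real r + 1) * (real n - real r))"
    using False assms by (intro divide_left_mono) auto
  then have "(1 / 2) ^ (r + 1) * (2 / (real n * (real n - 1))) \<le>
      (1 / 2) ^ (r + 1) * (2 / ((real n - real r + 1) * (real n - real r)))"
    by (intro mult_left_mono) auto
  also have "\<dots> = success r n" using False by (simp add: success_def)
  finally show ?thesis by (simp add: ch power_one_over)
qed

section \<open>Induction over the random contractions\<close>

text \<open>This settles rank zero, which \<open>success_bound\<close> excludes: without hyperedges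
  every subset has an empty cut.\<close>

lemma alg_N_no_hedges:
  assumes "wf_hypergraph G" "hedges G = {}"
  shows "spmf (alg_N G r t w c b) {} = 1"
proof -
  let ?H = "contract (infeasible_verts G t w b) G"
  have "hedges ?H = {}" using assms(2) by (simp add: contract_def)
  then have "cut ?H = (\<lambda>_. {})" by (simp add: cut_def fun_eq_iff)
  moreover have "finite (verts ?H)"
    using assms(1) by (simp add: contract_def wf_hypergraph_def)
  ultimately have "map_spmf (cut ?H) (spmf_of_set (Pow (verts ?H))) = return_spmf {}"
    by (simp only: map_const_spmf_of_set finite_Pow_iff Pow_not_empty not_False_eq_True)
  then show ?thesis
    using \<open>hedges ?H = {}\<close> by (subst alg_N.simps) (simp add: Let_def)
qed

text \<open>The law of total probability over the chosen hyperedge. The support is finite, so the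
  integral is a sum, and \<open>None\<close> contributes nothing because its continuation
  fails.\<close>

lemma spmf_bind_random_hedge:
  assumes "finite (hedges H)" "hedges H \<noteq> {}" "\<And>e. e \<in> hedges H \<Longrightarrow> 0 < c e"
  shows "spmf (bind_spmf (random_hedge H c) f) F =
    (\<Sum>e\<in>hedges H. c e * spmf (f e) F) / sum c (hedges H)"
proof -
  let ?p = "random_hedge H c"
  have set: "set_pmf ?p \<subseteq> insert None (Some ` hedges H)"
  proof
    fix z assume z: "z \<in> set_pmf ?p"
    show "z \<in> insert None (Some ` hedges H)"
    proof (cases z)
      case (Some e)
      with z have "spmf ?p e \<noteq> 0" by (simp add: set_pmf_iff)
      with spmf_random_hedge(1)[of H c e] assms Some show ?thesis by (auto split: if_splits)
    qed simp
  qed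
  have "spmf (bind_spmf ?p f) F =
      (\<Sum>z\<in>insert None (Some ` hedges H). pmf (case z of None \<Rightarrow> return_pmf None | Some e \<Rightarrow> f e) (Some F) * pmf ?p z)"
    unfolding bind_spmf_def pmf_bind using set assms(1)
    by (intro integral_measure_pmf_real) auto
  also have "\<dots> = (\<Sum>e\<in>hedges H. spmf (f e) F * spmf ?p e)"
    using assms(1) by (subst sum.insert) (auto simp: sum.reindex)
  also have "\<dots> = (\<Sum>e\<in>hedges H. c e * spmf (f e) F / sum c (hedges H))"
    using spmf_random_hedge(1)[of H c] assms by (intro sum.cong refl) simp
  finally show ?thesis by (simp add: sum_divide_distrib)
qed

text \<open>The induction is on the number of hyperedges, as a contraction deletes at least the
  chosen one. The number of vertices would not do: it stays the same when a hyperedge with a single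
  end is contracted.\<close>

lemma alg_N_success:
  assumes "nonneg_instance G r t w c" "node_budgeted_min_cut G t w c b F"
  shows "success r (card (verts G)) \<le> spmf (alg_N G r t w c b) F"
  using assms
proof (induction "card (hedges G)" arbitrary: G w rule: less_induct)
  case less
  note G = less.prems(1) and F = less.prems(2)
  have wf: "wf_hypergraph G" using G by (simp add: nonneg_instance_def)
  define U where "U = infeasible_verts G t w b"
  define H where "H = contract U G"
  define w' where "w' = contract_weights U w"
  have U: "U \<subseteq> verts G" by (auto simp: U_def infeasible_verts_def)
  from F obtain X where X: "budgeted_side G t w b X" "F = cut G X"
    by (auto simp: node_budgeted_min_cut_def)
  have FH: "node_budgeted_min_cut H t w' c b F"
    unfolding H_def w'_def using budgeted_side_feasible[OF G X(1)]
    by (intro min_cut_contract[OF wf U X(1) _ F X(2)]) (simp add: U_def)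
  have H: "nonneg_instance H r t w' c"
    unfolding H_def w'_def by (rule vertex_quotient_nonneg[OF G contract_vertex_quotient[OF wf U]])
  then have wfH: "wf_hypergraph H" and finH: "finite (verts H)" "finite (hedges H)"
    and E: "\<And>e. e \<in> hedges H \<Longrightarrow> ends H e \<noteq> {} \<and> ends H e \<subseteq> verts H \<and> card (ends H e) \<le> r \<and> 0 < c e"
    by (auto simp: nonneg_instance_def wf_hypergraph_def)
  have "card (verts H) \<le> card (verts G)"
  proof -
    have "verts H = (\<lambda>v. if v \<in> U then merged U else v) ` verts G"
      using contract_vertex_quotient[OF wf U, of t w] by (simp add: vertex_quotient_def H_def)
    with wf show ?thesis by (simp only: card_image_le wf_hypergraph_def)
  qed
  then have mono: "success r (card (verts G)) \<le> success r (card (verts H))"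
    by (rule success_antimono)
  have alg: "alg_N G r t w c b =
     (if card (verts H) \<le> r + 1 \<or> hedges H = {}
      then map_spmf (cut H) (spmf_of_set (Pow (verts H)))
      else bind_spmf (random_hedge H c)
             (\<lambda>e. alg_N (contract (ends H e) H) r t (contract_weights (ends H e) w') c b))"
    by (subst alg_N.simps) (simp add: U_def H_def w'_def Let_def)
  from FH obtain Y where Y: "budgeted_side H t w' b Y" "F = cut H Y"
    by (auto simp: node_budgeted_min_cut_def)
  have YH: "Y \<subset> verts H" "Y \<noteq> {}" using Y(1) by (auto simp: budgeted_side_def)
  consider "hedges H = {}" | "hedges H \<noteq> {}" "card (verts H) \<le> r + 1"
    | "hedges H \<noteq> {}" "r + 2 \<le> card (verts H)" by fastforce
  then show ?case
  proof cases
    case 1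
    then have "cut H = (\<lambda>_. {})" by (simp add: cut_def fun_eq_iff)
    then have "map_spmf (cut H) (spmf_of_set (Pow (verts H))) = return_spmf {}"
      using finH(1) by (simp only: map_const_spmf_of_set finite_Pow_iff Pow_not_empty not_False_eq_True)
    with 1 Y(2) have "spmf (alg_N G r t w c b) F = 1"
      by (simp add: alg \<open>cut H = (\<lambda>_. {})\<close>)
    then show ?thesis using success_le_1 by simp
  next
    case 2
    have "success r (card (verts H)) = (1 / 2) ^ card (verts H)"
      using 2(2) by (rule success_small)
    also have "\<dots> = spmf (spmf_of_set (Pow (verts H))) Y"
      using YH finH(1) by (auto simp: spmf_of_set card_Pow power_one_over indicator_def)
    \<comment> \<open>Other subsets, such as the complement of \<open>Y\<close>, may have the same
      cut, hence an inequality.\<close>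
    also have "\<dots> \<le> spmf (map_spmf (cut H) (spmf_of_set (Pow (verts H)))) F"
      unfolding spmf_map unfolding spmf_conv_measure_spmf
      by (intro measure_spmf.finite_measure_mono) (auto simp: Y(2))
    finally show ?thesis using mono 2(2) by (simp add: alg)
  next
    case 3
    define k where "k = card (verts H)"
    let ?C = "sum c (hedges H)"
    let ?s = "\<lambda>e. if 2 \<le> card (ends H e) then real (card (ends H e)) else 0"
    let ?N = "\<lambda>e. alg_N (contract (ends H e) H) r t (contract_weights (ends H e) w') c b"
    let ?q = "1 / (real k - 1 - real r)"
    have C: "0 < ?C" using E 3(1) finH(2) by (intro sum_pos) auto
    have k: "r + 2 \<le> k" using 3(2) by (simp add: k_def)
    have FE: "F \<subseteq> hedges H" by (auto simp: Y(2) cut_def)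
    \<comment> \<open>A hyperedge with one end leaves \<open>k\<close> unchanged and gains nothing.
      This matches the degree bound, where such a hyperedge lies in no cut and has
      \<open>?s e = 0\<close>.\<close>
    have branch: "success r k * (1 + ?s e * ?q) \<le> spmf (?N e) F" if e: "e \<in> hedges H - F" for e
    proof -
      let ?H = "contract (ends H e) H" and ?w = "contract_weights (ends H e) w'"
      have eH: "e \<in> hedges H" using e by simp
      note Ee = E[OF eH]
      then have sub: "ends H e \<subseteq> verts H" and fe: "finite (ends H e)"
        using finH(1) by (auto intro: finite_subset)
      have card1: "1 \<le> card (ends H e)" using Ee fe by (simp add: Suc_le_eq card_gt_0_iff)
      note q = contract_vertex_quotient[OF wfH sub, of t w']
      have side: "ends H e \<subseteq> Y \<or> ends H e \<inter> Y = {}"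
        using e sub by (auto simp: Y(2) cut_def)
      have "hedges ?H = {e' \<in> hedges H. \<not> ends H e' \<subseteq> ends H e}"
        using q by (simp add: vertex_quotient_def)
      with eH have "hedges ?H \<subset> hedges H" by blast
      then have "card (hedges ?H) < card (hedges H)"
        by (rule psubset_card_mono[OF finH(2)])
      also have "hedges H \<subseteq> hedges G"
        by (simp add: H_def contract_def subset_iff)
      then have "card (hedges H) \<le> card (hedges G)"
        using wf by (intro card_mono) (simp_all add: wf_hypergraph_def)
      finally have "card (hedges ?H) < card (hedges G)" .
      then have IH: "success r (card (verts ?H)) \<le> spmf (?N e) F"
        by (rule less.hyps[OF _ vertex_quotient_nonneg[OF H q] min_cut_contract[OF wfH sub Y(1) side FH Y(2)]])
      have "card (verts ?H) = Suc (card (verts H - ends H e))"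
        using Ee finH(1) merged_in[of "ends H e"] by (simp add: contract_def)
      also have "card (verts H - ends H e) = k - card (ends H e)"
        using sub fe by (simp add: card_Diff_subset k_def)
      finally have card: "card (verts ?H) = k - card (ends H e) + 1" by simp
      show ?thesis
      proof (cases "2 \<le> card (ends H e)")
        case True
        then show ?thesis
          using IH success_gain[OF k, of "card (ends H e)"] Ee by (simp add: card)
      next
        case False
        then have "card (ends H e) = 1" using card1 by simp
        then show ?thesis using IH k by (simp add: card)
      qed
    qed
    \<comment> \<open>The merged infeasible vertex is the exceptional vertex \<open>z\<close> of the
      degree bound.\<close>
    have feas: "\<forall>i\<in>{1..t}. \<forall>v\<in>verts H - {merged U}. w' i v \<le> b i"
      unfolding w'_def H_def U_def by (intro ballI infeasible_verts_contract) auto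
    have "(real k - 1 - real r) * sum c F \<le> (\<Sum>e\<in>hedges H - F. c e * ?s e)"
      using min_cut_degree_bound[OF H FH feas] k unfolding k_def by simp
    then have "sum c F \<le> (\<Sum>e\<in>hedges H - F. c e * ?s e) * ?q"
      using k by (simp add: pos_le_divide_eq mult.commute)
    also have "\<dots> = (\<Sum>e\<in>hedges H - F. c e * (?s e * ?q))"
      by (simp only: sum_distrib_right mult.assoc)
    \<comment> \<open>The gains outside \<open>F\<close> make up for the cost of \<open>F\<close>:
      weighted with the gain factors, the hyperedges that spare \<open>F\<close> still account for
      the whole cost.\<close>
    finally have "?C \<le> (\<Sum>e\<in>hedges H - F. c e) + (\<Sum>e\<in>hedges H - F. c e * (?s e * ?q))"
      using sum.subset_diff[OF FE finH(2), of c] by simp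
    also have "\<dots> = (\<Sum>e\<in>hedges H - F. c e * (1 + ?s e * ?q))"
      by (simp only: sum.distrib[symmetric] distrib_left mult_1_right)
    finally have "success r k * ?C \<le> success r k * (\<Sum>e\<in>hedges H - F. c e * (1 + ?s e * ?q))"
      by (intro mult_left_mono success_nonneg)
    also have "\<dots> = (\<Sum>e\<in>hedges H - F. c e * (success r k * (1 + ?s e * ?q)))"
      by (simp only: sum_distrib_left mult.left_commute)
    also have "\<dots> \<le> (\<Sum>e\<in>hedges H - F. c e * spmf (?N e) F)"
      using branch E by (intro sum_mono mult_left_mono) (auto simp: less_imp_le)
    also have "\<dots> \<le> (\<Sum>e\<in>hedges H. c e * spmf (?N e) F)"
      using finH(2) E by (intro sum_mono2) (auto simp: less_imp_le)
    finally have "success r k \<le> (\<Sum>e\<in>hedges H. c e * spmf (?N e) F) / ?C"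
      using C by (simp add: pos_le_divide_eq)
    also have "\<dots> = spmf (alg_N G r t w c b) F"
      using 3 E finH(2) by (simp add: alg spmf_bind_random_hedge)
    finally show ?thesis using mono by (simp add: k_def)
  qed
qed

lemma alg_N_success_probability:
  assumes I: "valid_instance G r t w c b" and F: "node_budgeted_min_cut G t w c b F"
  shows "1 / (2 ^ (r + 1) * real (card (verts G) choose 2)) \<le> spmf (alg_N G r t w c b) F"
proof -
  have wf: "wf_hypergraph G" and r: "rank G = r" using I by (auto simp: valid_instance_def)
  have rank: "card (ends G e) \<le> r" if "e \<in> hedges G" for e
    using wf that unfolding r[symmetric] rank_def by (intro Max_ge) (auto simp: wf_hypergraph_def)
  from F obtain X where X: "X \<noteq> {}" "X \<subset> verts G" "F = cut G X"
    unfolding node_budgeted_min_cut_def budgeted_side_def by blast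
  have fin: "finite (verts G)" using wf by (simp add: wf_hypergraph_def)
  then have "finite X" using X(2) finite_subset by blast
  then have "0 < card X" using X(1) by (simp add: card_gt_0_iff)
  moreover have "card X < card (verts G)" using fin X(2) by (rule psubset_card_mono)
  \<comment> \<open>A nonempty proper side forces two vertices, so the binomial coefficient is
    positive.\<close>
  ultimately have n: "2 \<le> card (verts G)" by simp
  show ?thesis
  proof (cases "r = 0")
    case True
    have "hedges G = {}"
    proof (rule ccontr)
      assume "hedges G \<noteq> {}"
      then obtain e where e: "e \<in> hedges G" by blast
      then have "finite (ends G e)" "ends G e \<noteq> {}"
        using wf fin by (auto simp: wf_hypergraph_def intro: finite_subset)
      with rank[OF e] True show False by simp
    qed
    then have "F = {}" by (simp add: X(3) cut_def)
    then have "spmf (alg_N G r t w c b) F = 1"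
      using alg_N_no_hedges[OF wf \<open>hedges G = {}\<close>] by simp
    moreover have "1 \<le> real (card (verts G) choose 2)"
      using n by (simp add: Suc_le_eq zero_less_binomial)
    then have "1 * 1 \<le> 2 ^ (r + 1) * real (card (verts G) choose 2)"
      by (intro mult_mono one_le_power) auto
    ultimately show ?thesis by (simp add: divide_le_eq_1)
  next
    case False
    have "nonneg_instance G r t w c"
      using I rank by (auto simp: valid_instance_def nonneg_instance_def)
    from alg_N_success[OF this F] success_bound[of r "card (verts G)"] n False
    show ?thesis by simp
  qed
qed

section \<open>Running times and distributions of programs\<close>

lemma run_Skip [simp]: "run T Skip s = return_pmf (Skip, s)"
  by (induction T) (auto simp: bind_return_pmf)

lemma run_add: "run (j + k) p s = bind_pmf (run j p s) (\<lambda>(p', s'). run k p' s')"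
  by (induction j arbitrary: p s)
     (auto simp: bind_return_pmf bind_assoc_pmf case_prod_unfold)

lemma run_halted:
  assumes "halts_within T p s" "T \<le> T'"
  shows "run T' p s = run T p s"
proof -
  have "run T' p s = bind_pmf (run T p s) (\<lambda>(p', s'). run (T' - T) p' s')"
    using run_add[of T "T' - T" p s] assms(2) by simp
  also have "\<dots> = bind_pmf (run T p s) return_pmf"
    using assms(1) by (intro bind_pmf_cong refl) (auto simp: halts_within_def)
  finally show ?thesis by (simp add: bind_return_pmf')
qed

lemma halts_within_mono: "halts_within T p s \<Longrightarrow> T \<le> T' \<Longrightarrow> halts_within T' p s"
  using run_halted[of T p s T'] by (simp add: halts_within_def)

text \<open>The extra step discards the \<open>Skip\<close> left by \<open>p\<close>. Runs in which
  \<open>p\<close> halts early leave spare steps to \<open>q\<close>, and these change nothing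
  because \<open>q\<close> has halted within \<open>k\<close> steps.\<close>

lemma run_Seq:
  assumes "halts_within j p s"
    and "\<And>p' s'. (p', s') \<in> set_pmf (run j p s) \<Longrightarrow> halts_within k q s'"
  shows "run (Suc (j + k)) (Seq p q) s = bind_pmf (run j p s) (\<lambda>(p', s'). run k q s')"
  using assms
proof (induction j arbitrary: p s)
  case 0
  then show ?case by (simp add: halts_within_def bind_return_pmf)
next
  case (Suc j)
  show ?case
  proof (cases "p = Skip")
    case True
    then have "halts_within k q s" using Suc.prems(2) by simp
    then have "run (Suc (j + k)) q s = run k q s"
      by (rule run_halted) simp
    then show ?thesis using True by (simp add: bind_return_pmf)
  next
    case False
    have "run (Suc (Suc j + k)) (Seq p q) s
        = bind_pmf (step p s) (\<lambda>(p', s'). run (Suc (j + k)) (Seq p' q) s')"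
      using False by (simp add: bind_map_pmf case_prod_unfold del: run.simps(2) add: run.simps(2)[of "Suc (j + k)"])
    also have "\<dots> = bind_pmf (step p s) (\<lambda>(p', s'). bind_pmf (run j p' s') (\<lambda>(p', s'). run k q s'))"
    proof (intro bind_pmf_cong refl)
      fix x assume x: "x \<in> set_pmf (step p s)"
      obtain p' s' where x': "x = (p', s')" by force
      have "run (Suc (j + k)) (Seq p' q) s' = bind_pmf (run j p' s') (\<lambda>(p', s'). run k q s')"
      proof (rule Suc.IH)
        show "halts_within j p' s'"
          using Suc.prems(1) x x' by (fastforce simp: halts_within_def)
        show "halts_within k q s''" if "(p'', s'') \<in> set_pmf (run j p' s')" for p'' s''
          using Suc.prems(2) x x' that by fastforce
      qed
      then show "(case x of (p', s') \<Rightarrow> run (Suc (j + k)) (Seq p' q) s') =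
          (case x of (p', s') \<Rightarrow> bind_pmf (run j p' s') (\<lambda>(p', s'). run k q s'))"
        by (simp add: x')
    qed
    also have "\<dots> = bind_pmf (run (Suc j) p s) (\<lambda>(p', s'). run k q s')"
      by (simp add: bind_assoc_pmf case_prod_unfold)
    finally show ?thesis .
  qed
qed

text \<open>A bound on the running time, provided that every loop is left after at most \<open>B\<close> iterations.\<close>

primrec cost :: "nat \<Rightarrow> com \<Rightarrow> nat" where
  "cost B Skip = 0"
| "cost B (NAssign a i j x) = 1"
| "cost B (RAssign a i j x) = 1"
| "cost B (Seq p q) = Suc (cost B p + cost B q)"
| "cost B (Cond g p q) = Suc (cost B p + cost B q)"
| "cost B (While g p) = Suc (B * (cost B p + 2))"
| "cost B (Coin x p q) = Suc (cost B p + cost B q)"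

text \<open>Each loop contributes one factor \<open>B\<close>, so the degree is at most the nesting
  depth of loops.\<close>

lemma cost_poly: "\<exists>P. \<forall>B. cost B p = poly P B"
proof (induction p)
  case Skip
  show ?case by (rule exI[of _ 0]) simp
next
  case (NAssign a i j x)
  show ?case by (rule exI[of _ 1]) simp
next
  case (RAssign a i j x)
  show ?case by (rule exI[of _ 1]) simp
next
  case (Seq p q)
  then obtain P Q where "\<forall>B. cost B p = poly P B" "\<forall>B. cost B q = poly Q B" by blast
  then show ?case by (intro exI[of _ "P + Q + 1"]) simp
next
  case (Cond g p q)
  then obtain P Q where "\<forall>B. cost B p = poly P B" "\<forall>B. cost B q = poly Q B" by blast
  then show ?case by (intro exI[of _ "P + Q + 1"]) simp
next
  case (While g p)
  then obtain P where "\<forall>B. cost B p = poly P B" by blast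
  then show ?case by (intro exI[of _ "[:0, 1:] * (P + [:2:]) + 1"]) simp
next
  case (Coin x p q)
  then obtain P Q where "\<forall>B. cost B p = poly P B" "\<forall>B. cost B q = poly Q B" by blast
  then show ?case by (intro exI[of _ "P + Q + 1"]) simp
qed

text \<open>The final state is coupled with a ghost result of distribution \<open>\<mu>\<close>; this turns equalities of
  output distributions into assertions \<open>Q\<close> about pairs of a state and a ghost result.\<close>

definition implements_in ::
    "nat \<Rightarrow> com \<Rightarrow> state \<Rightarrow> 'a pmf \<Rightarrow> (state \<Rightarrow> 'a \<Rightarrow> bool) \<Rightarrow> bool" where
  "implements_in T p s \<mu> Q \<longleftrightarrow> halts_within T p s \<and> rel_pmf Q (map_pmf snd (run T p s)) \<mu>"

lemma implements_in_mono:
  assumes "implements_in T p s \<mu> Q" "T \<le> T'" shows "implements_in T' p s \<mu> Q"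
  using assms halts_within_mono run_halted unfolding implements_in_def by metis

lemma implements_in_conseq:
  assumes "implements_in T p s \<mu> Q"
    and "\<And>s' a. (\<exists>p'. (p', s') \<in> set_pmf (run T p s)) \<Longrightarrow> a \<in> set_pmf \<mu> \<Longrightarrow> Q s' a \<Longrightarrow> Q' s' a"
  shows "implements_in T p s \<mu> Q'"
  using assms unfolding implements_in_def by (fastforce elim!: pmf.rel_mono_strong)

lemma implements_in_step:
  assumes "\<And>p' s'. (p', s') \<in> set_pmf (step p s) \<Longrightarrow> halts_within T p' s'"
    and "rel_pmf Q (bind_pmf (step p s) (\<lambda>(p', s'). map_pmf snd (run T p' s'))) \<mu>"
  shows "implements_in (Suc T) p s \<mu> Q"
  using assms
  by (fastforce simp: implements_in_def halts_within_def map_bind_pmf case_prod_unfold)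

text \<open>Couplings compose: a coupling of the first stage, extended for every coupled pair by a
  coupling of the second stages, couples the two binds. That \<open>q\<close> halts is read off the
  coupling too, since every reachable state has a partner.\<close>

lemma implements_in_Seq:
  assumes "implements_in j p s \<mu> (\<lambda>s' a. implements_in k q s' (\<nu> a) Q)"
  shows "implements_in (Suc (j + k)) (Seq p q) s (bind_pmf \<mu> \<nu>) Q"
proof -
  have hp: "halts_within j p s"
    and rel: "rel_pmf (\<lambda>s' a. implements_in k q s' (\<nu> a) Q) (map_pmf snd (run j p s)) \<mu>"
    using assms by (auto simp: implements_in_def)
  have hq: "halts_within k q s'" if "(p', s') \<in> set_pmf (run j p s)" for p' s'
  proof -
    have "s' \<in> set_pmf (map_pmf snd (run j p s))" using that by force
    with rel obtain a where "implements_in k q s' (\<nu> a) Q"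
      using rel_pmf_imp_rel_set by (fast dest: rel_setD1)
    then show ?thesis by (simp add: implements_in_def)
  qed
  have run: "run (Suc (j + k)) (Seq p q) s = bind_pmf (map_pmf snd (run j p s)) (run k q)"
    by (subst run_Seq[OF hp hq]) (auto simp: bind_map_pmf case_prod_unfold)
  have "halts_within (Suc (j + k)) (Seq p q) s"
    unfolding halts_within_def run using hq by (fastforce simp: halts_within_def)
  moreover have "rel_pmf Q (map_pmf snd (run (Suc (j + k)) (Seq p q) s)) (bind_pmf \<mu> \<nu>)"
    unfolding run map_bind_pmf
    by (rule rel_pmf_bindI[OF rel]) (simp add: implements_in_def)
  ultimately show ?thesis by (simp add: implements_in_def)
qed

text \<open>The time bound is tied to the program text, so the rules below need no step
  counts.\<close>

definition implements ::
    "nat \<Rightarrow> com \<Rightarrow> state \<Rightarrow> 'a pmf \<Rightarrow> (state \<Rightarrow> 'a \<Rightarrow> bool) \<Rightarrow> bool" where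
  "implements B p = implements_in (cost B p) p"

lemma implements_conseq:
  assumes "implements B p s \<mu> Q" and "\<And>s' a. a \<in> set_pmf \<mu> \<Longrightarrow> Q s' a \<Longrightarrow> Q' s' a"
  shows "implements B p s \<mu> Q'"
  using implements_in_conseq[OF assms(1)[unfolded implements_def]] assms(2)
  unfolding implements_def by simp

lemma implements_Skip [intro]: "Q s a \<Longrightarrow> implements B Skip s (return_pmf a) Q"
  by (simp add: implements_def implements_in_def halts_within_def)

lemma implements_NAssign:
  "Q (s\<lparr>nmem := upd_cell (nmem s) a (nval i s) (nval j s) (nval x s)\<rparr>) y \<Longrightarrow>
   implements B (NAssign a i j x) s (return_pmf y) Q"
  by (simp add: implements_def implements_in_def halts_within_def bind_return_pmf)

lemma implements_RAssign:
  "Q (s\<lparr>rmem := upd_cell (rmem s) a (nval i s) (nval j s) (rval x s)\<rparr>) y \<Longrightarrow>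
   implements B (RAssign a i j x) s (return_pmf y) Q"
  by (simp add: implements_def implements_in_def halts_within_def bind_return_pmf)

lemma implements_Seq:
  "implements B p s \<mu> (\<lambda>s' a. implements B q s' (\<nu> a) Q) \<Longrightarrow> implements B (Seq p q) s (bind_pmf \<mu> \<nu>) Q"
  unfolding implements_def cost.simps by (rule implements_in_Seq)

lemma implements_Cond:
  assumes "bval g s \<Longrightarrow> implements B p s \<mu> Q" "\<not> bval g s \<Longrightarrow> implements B q s \<mu> Q"
  shows "implements B (Cond g p q) s \<mu> Q"
proof -
  have "implements_in (cost B p + cost B q) (if bval g s then p else q) s \<mu> Q"
    using assms by (auto simp: implements_def intro: implements_in_mono)
  then show ?thesis
    unfolding implements_def cost.simps
    by (intro implements_in_step) (auto simp: implements_in_def bind_return_pmf)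
qed

lemma implements_Coin:
  assumes "0 \<le> rval x s" "rval x s \<le> 1"
    and "implements B p s (\<nu> True) Q" "implements B q s (\<nu> False) Q"
  shows "implements B (Coin x p q) s (bind_pmf (bernoulli_pmf (rval x s)) \<nu>) Q"
proof -
  let ?T = "cost B p + cost B q"
  have *: "implements_in ?T (if h then p else q) s (\<nu> h) Q" for h
    using assms by (auto simp: implements_def intro: implements_in_mono)
  show ?thesis
    unfolding implements_def cost.simps
  proof (rule implements_in_step)
    show "halts_within ?T p' s'" if "(p', s') \<in> set_pmf (step (Coin x p q) s)" for p' s'
      using that * by (auto simp: implements_in_def split: if_splits)
    show "rel_pmf Q (bind_pmf (step (Coin x p q) s) (\<lambda>(p', s'). map_pmf snd (run ?T p' s')))
        (bind_pmf (bernoulli_pmf (rval x s)) \<nu>)"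
      unfolding step.simps bind_map_pmf prod.case
      using * by (intro rel_pmf_bindI[of "(=)"]) (auto simp: implements_in_def pmf.rel_eq)
  qed
qed

text \<open>The number \<open>k\<close> of remaining iterations is kept apart from the bound
  \<open>B\<close> for inner loops, so that one can induct on it. An iteration spends two steps
  besides its body, on the test and on discarding \<open>Skip\<close>; the final failing test adds
  one.\<close>

definition implements_while ::
    "nat \<Rightarrow> nat \<Rightarrow> bexp \<Rightarrow> com \<Rightarrow> state \<Rightarrow> 'a pmf \<Rightarrow> (state \<Rightarrow> 'a \<Rightarrow> bool) \<Rightarrow> bool" where
  "implements_while B k g p = implements_in (Suc (k * (cost B p + 2))) (While g p)"

lemma implements_While:
  "implements_while B k g p s \<mu> Q \<Longrightarrow> k \<le> B \<Longrightarrow> implements B (While g p) s \<mu> Q"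
  unfolding implements_def implements_while_def cost.simps
  by (erule implements_in_mono) (simp add: add_mono mult_le_mono)

lemma implements_while_exit:
  "\<not> bval g s \<Longrightarrow> Q s a \<Longrightarrow> implements_while B k g p s (return_pmf a) Q"
  unfolding implements_while_def
  by (rule implements_in_step) (auto simp: halts_within_def bind_return_pmf)

lemma implements_while_iterate:
  assumes "bval g s" "implements B p s \<mu> (\<lambda>s' a. implements_while B k g p s' (\<nu> a) Q)"
  shows "implements_while B (Suc k) g p s (bind_pmf \<mu> \<nu>) Q"
proof -
  have *: "Suc (Suc k * (cost B p + 2)) = Suc (Suc (cost B p + Suc (k * (cost B p + 2))))"
    by simp
  have "implements_in (Suc (cost B p + Suc (k * (cost B p + 2)))) (Seq p (While g p)) s (bind_pmf \<mu> \<nu>) Q"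
    using assms(2) unfolding implements_def implements_while_def by (rule implements_in_Seq)
  then show ?thesis
    unfolding implements_while_def * using assms(1)
    by (intro implements_in_step) (auto simp: implements_in_def bind_return_pmf simp del: run.simps)
qed

section \<open>Frame conditions\<close>

primrec nmods :: "com \<Rightarrow> nat set" where
  "nmods Skip = {}"
| "nmods (NAssign a i j x) = {a}"
| "nmods (RAssign a i j x) = {}"
| "nmods (Seq p q) = nmods p \<union> nmods q"
| "nmods (Cond g p q) = nmods p \<union> nmods q"
| "nmods (While g p) = nmods p"
| "nmods (Coin x p q) = nmods p \<union> nmods q"

primrec rmods :: "com \<Rightarrow> nat set" where
  "rmods Skip = {}"
| "rmods (NAssign a i j x) = {}"
| "rmods (RAssign a i j x) = {a}"
| "rmods (Seq p q) = rmods p \<union> rmods q"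
| "rmods (Cond g p q) = rmods p \<union> rmods q"
| "rmods (While g p) = rmods p"
| "rmods (Coin x p q) = rmods p \<union> rmods q"

text \<open>Changes are tracked for whole arrays only. Every scalar that the program writes has an
  array of its own, so nothing is lost for scalars.\<close>

definition agree_off :: "nat set \<Rightarrow> nat set \<Rightarrow> state \<Rightarrow> state \<Rightarrow> bool" where
  "agree_off M R s s' \<longleftrightarrow>
     (\<forall>a. a \<notin> M \<longrightarrow> nmem s' a = nmem s a) \<and> (\<forall>a. a \<notin> R \<longrightarrow> rmem s' a = rmem s a)"

lemma agree_off_refl [simp]: "agree_off M R s s"
  by (simp add: agree_off_def)

lemma agree_off_mono:
  assumes "agree_off M R s s'" "M \<subseteq> N" "R \<subseteq> S"
  shows "agree_off N S s s'"
proof -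
  have "a \<notin> M" if "a \<notin> N" for a using that assms(2) by auto
  moreover have "a \<notin> R" if "a \<notin> S" for a using that assms(3) by auto
  ultimately show ?thesis using assms(1) by (simp add: agree_off_def)
qed

lemma agree_off_trans:
  "agree_off M R s s' \<Longrightarrow> agree_off M R s' s'' \<Longrightarrow> agree_off M R s s''"
  by (simp add: agree_off_def)

lemma step_agree:
  "(p', s') \<in> set_pmf (step p s) \<Longrightarrow>
   nmods p' \<subseteq> nmods p \<and> rmods p' \<subseteq> rmods p \<and> agree_off (nmods p) (rmods p) s s'"
proof (induction p arbitrary: p' s')
  case (Seq p q)
  show ?case
  proof (cases "p = Skip")
    case False
    with Seq.prems obtain p'' where p'': "(p'', s') \<in> set_pmf (step p s)" "p' = Seq p'' q"
      by auto
    then have "nmods p'' \<subseteq> nmods p" "rmods p'' \<subseteq> rmods p" "agree_off (nmods p) (rmods p) s s'"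
      using Seq.IH(1) by blast+
    then show ?thesis using p''(2) by (auto intro: agree_off_mono)
  qed (use Seq.prems in auto)
qed (auto simp: agree_off_def upd_cell_def split: if_splits)

lemma run_agree:
  "(p', s') \<in> set_pmf (run T p s) \<Longrightarrow> agree_off (nmods p) (rmods p) s s'"
proof (induction T arbitrary: p s)
  case (Suc T)
  then obtain q u where q: "(q, u) \<in> set_pmf (step p s)" "(p', s') \<in> set_pmf (run T q u)"
    by auto
  have "agree_off (nmods p) (rmods p) s u" "nmods q \<subseteq> nmods p" "rmods q \<subseteq> rmods p"
    using step_agree[OF q(1)] by auto
  then show ?case
    using agree_off_trans[OF _ agree_off_mono[OF Suc.IH[OF q(2)]]] by simp
qed simp

text \<open>Any postcondition can thus be strengthened by the frame condition read off the program
  text.\<close>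

lemma implements_agree:
  assumes "implements B p s \<mu> Q"
  shows "implements B p s \<mu> (\<lambda>s' a. Q s' a \<and> agree_off (nmods p) (rmods p) s s')"
  using assms unfolding implements_def
  by (rule implements_in_conseq) (auto dest: run_agree)

section \<open>Deterministic programs and bounded loops\<close>

definition computes :: "nat \<Rightarrow> com \<Rightarrow> state \<Rightarrow> (state \<Rightarrow> bool) \<Rightarrow> bool" where
  "computes B p s Q = implements B p s (return_pmf ()) (\<lambda>s' _. Q s')"

lemma implements_return:
  "implements B p s (return_pmf y) Q \<longleftrightarrow> computes B p s (\<lambda>s'. Q s' y)"
  by (simp add: computes_def implements_def implements_in_def rel_pmf_return_pmf2)

lemma computes_Skip: "Q s \<Longrightarrow> computes B Skip s Q"
  by (simp add: computes_def implements_Skip)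

lemma computes_NAssign:
  "Q (s\<lparr>nmem := upd_cell (nmem s) a (nval i s) (nval j s) (nval x s)\<rparr>) \<Longrightarrow>
   computes B (NAssign a i j x) s Q"
  by (simp add: computes_def implements_NAssign)

lemma computes_RAssign:
  "Q (s\<lparr>rmem := upd_cell (rmem s) a (nval i s) (nval j s) (rval x s)\<rparr>) \<Longrightarrow>
   computes B (RAssign a i j x) s Q"
  by (simp add: computes_def implements_RAssign)

lemma computes_conseq:
  "computes B p s Q \<Longrightarrow> (\<And>s'. Q s' \<Longrightarrow> Q' s') \<Longrightarrow> computes B p s Q'"
  unfolding computes_def by (erule implements_conseq)

lemma computes_agree:
  "computes B p s Q \<Longrightarrow> computes B p s (\<lambda>s'. Q s' \<and> agree_off (nmods p) (rmods p) s s')"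
  unfolding computes_def by (rule implements_agree)

lemma implements_computes_Seq:
  assumes "computes B p s P"
    and "\<And>s'. P s' \<Longrightarrow> agree_off (nmods p) (rmods p) s s' \<Longrightarrow> implements B q s' \<mu> Q"
  shows "implements B (Seq p q) s \<mu> Q"
proof -
  have "implements B p s (return_pmf ()) (\<lambda>s' _. implements B q s' \<mu> Q)"
    using computes_agree[OF assms(1)] assms(2) unfolding computes_def
    by (auto elim: implements_conseq)
  then have "implements B (Seq p q) s (bind_pmf (return_pmf ()) (\<lambda>_. \<mu>)) Q"
    by (rule implements_Seq)
  then show ?thesis by (simp add: bind_return_pmf)
qed

lemma computes_Seq:
  "computes B p s P \<Longrightarrow>
   (\<And>s'. P s' \<Longrightarrow> agree_off (nmods p) (rmods p) s s' \<Longrightarrow> computes B q s' Q) \<Longrightarrow>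
   computes B (Seq p q) s Q"
  unfolding computes_def[of _ q] computes_def[of _ "Seq p q"] by (rule implements_computes_Seq)

lemma computes_Cond:
  "(bval g s \<Longrightarrow> computes B p s Q) \<Longrightarrow> (\<not> bval g s \<Longrightarrow> computes B q s Q) \<Longrightarrow>
   computes B (Cond g p q) s Q"
  unfolding computes_def by (rule implements_Cond)

text \<open>The ghost counterpart of a counting loop: \<open>K k\<close> is the kernel of the pass
  with index \<open>k\<close>.\<close>

primrec iterate :: "(nat \<Rightarrow> 'a \<Rightarrow> 'a pmf) \<Rightarrow> nat \<Rightarrow> nat \<Rightarrow> 'a \<Rightarrow> 'a pmf" where
  "iterate K k 0 a = return_pmf a"
| "iterate K k (Suc j) a = bind_pmf (K k a) (iterate K (Suc k) j)"

text \<open>\<open>iterate\<close> recurses at the front, as execution does; computing its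
  distribution by induction needs the last pass split off.\<close>

lemma iterate_Suc: "iterate K k (Suc j) a = bind_pmf (iterate K k j a) (K (k + j))"
proof (induction j arbitrary: k a)
  case 0
  have "iterate K (Suc k) 0 = return_pmf" by (simp add: fun_eq_iff)
  then show ?case by (simp add: bind_return_pmf bind_return_pmf')
next
  case (Suc j)
  have "iterate K k (Suc (Suc j)) a = bind_pmf (K k a) (iterate K (Suc k) (Suc j))"
    by (rule iterate.simps(2))
  also have "\<dots> = bind_pmf (K k a) (\<lambda>a. bind_pmf (iterate K (Suc k) j a) (K (Suc k + j)))"
    by (subst Suc.IH[abs_def]) simp
  finally show ?case by (simp add: bind_assoc_pmf)
qed

lemma iterate_return: "iterate (\<lambda>_ a. return_pmf a) k j a = return_pmf a"
  by (induction j arbitrary: k) (auto simp: bind_return_pmf)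

definition set_cell :: "nat \<Rightarrow> nat \<Rightarrow> nat \<Rightarrow> state \<Rightarrow> state" where
  "set_cell a i v s = s\<lparr>nmem := upd_cell (nmem s) a i 0 v\<rparr>"

lemma nmem_set_cell:
  "nmem (set_cell a i v s) a' i' j' = (if a' = a \<and> i' = i \<and> j' = 0 then v else nmem s a' i' j')"
  by (simp add: set_cell_def upd_cell_def)

lemma nmem_set_cell_other [simp]: "a' \<noteq> a \<Longrightarrow> nmem (set_cell a i v s) a' = nmem s a'"
  by (simp add: set_cell_def upd_cell_def)

lemma rmem_set_cell [simp]: "rmem (set_cell a i v s) = rmem s"
  by (simp add: set_cell_def)

definition var :: "nat \<Rightarrow> nexp" where "var a = NCell a (NConst 0) (NConst 0)"
definition cell :: "nat \<Rightarrow> nexp \<Rightarrow> nexp" where "cell a i = NCell a i (NConst 0)"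
definition store :: "nat \<Rightarrow> nexp \<Rightarrow> nexp \<Rightarrow> com" where "store a i x = NAssign a i (NConst 0) x"
definition assign :: "nat \<Rightarrow> nexp \<Rightarrow> com" where "assign a x = store a (NConst 0) x"
definition NEq :: "nexp \<Rightarrow> nexp \<Rightarrow> bexp" where "NEq x y = Conj (NLe x y) (NLe y x)"

lemma nval_var [simp]: "nval (var a) s = nmem s a 0 0"
  by (simp add: var_def)

lemma nval_cell [simp]: "nval (cell a i) s = nmem s a (nval i s) 0"
  by (simp add: cell_def)

lemma bval_NEq [simp]: "bval (NEq x y) s \<longleftrightarrow> nval x s = nval y s"
  by (auto simp: NEq_def)

lemma mods_store [simp]: "nmods (store a i x) = {a}" "rmods (store a i x) = {}"
  by (simp_all add: store_def)

lemma mods_assign [simp]: "nmods (assign a x) = {a}" "rmods (assign a x) = {}"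
  by (simp_all add: assign_def)

lemma computes_store: "Q (set_cell a (nval i s) (nval x s) s) \<Longrightarrow> computes B (store a i x) s Q"
  unfolding store_def set_cell_def by (rule computes_NAssign) simp

lemma computes_assign: "Q (set_cell a 0 (nval x s) s) \<Longrightarrow> computes B (assign a x) s Q"
  unfolding assign_def by (rule computes_store) simp

definition For :: "nat \<Rightarrow> nexp \<Rightarrow> com \<Rightarrow> com" where
  "For x N p = Seq (assign x (NConst 0))
     (While (Neg (NLe N (var x))) (Seq p (assign x (NPlus (var x) (NConst 1)))))"

lemma mods_For [simp]:
  "nmods (For x N p) = insert x (nmods p)" "rmods (For x N p) = rmods p"
  by (auto simp: For_def)

text \<open>The invariant describes the state just after the index has been set, hence
  \<open>set_cell\<close> in \<open>base\<close> and \<open>body\<close>. The bound \<open>N\<close>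
  is evaluated anew before each pass and must not depend on anything the loop modifies.\<close>

lemma implements_For:
  fixes I :: "nat \<Rightarrow> state \<Rightarrow> 'a \<Rightarrow> bool"
  assumes n: "n \<le> B" and x: "x \<notin> nmods p"
    and N: "\<And>s. agree_off (insert x (nmods p)) (rmods p) s0 s \<Longrightarrow> nval N s = n"
    and base: "I 0 (set_cell x 0 0 s0) a0"
    and body: "\<And>k s a. k < n \<Longrightarrow> nmem s x 0 0 = k \<Longrightarrow>
      agree_off (insert x (nmods p)) (rmods p) s0 s \<Longrightarrow> I k s a \<Longrightarrow>
      implements B p s (K k a) (\<lambda>s' a'. I (Suc k) (set_cell x 0 (Suc k) s') a')"
  shows "implements B (For x N p) s0 (iterate K 0 n a0) (I n)"
proof -
  let ?p = "Seq p (assign x (NPlus (var x) (NConst 1)))" and ?g = "Neg (NLe N (var x))"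
  let ?agree = "agree_off (insert x (nmods p)) (rmods p) s0"
  have loop: "implements_while B j ?g ?p s (iterate K k j a) (I n)"
    if "k + j = n" "nmem s x 0 0 = k" "?agree s" "I k s a" for j k s a
    using that
  proof (induction j arbitrary: k s a)
    case 0
    then show ?case using N[of s] by (auto intro!: implements_while_exit)
  next
    case (Suc j)
    let ?W = "\<lambda>s' a'. implements_while B j ?g ?p s' (iterate K (Suc k) j a') (I n)"
    have "implements B p s (K k a)
        (\<lambda>s' a'. I (Suc k) (set_cell x 0 (Suc k) s') a' \<and> agree_off (nmods p) (rmods p) s s')"
      using Suc.prems by (intro implements_agree body) auto
    then have "implements B p s (K k a)
        (\<lambda>s' a'. implements B (assign x (NPlus (var x) (NConst 1))) s' (return_pmf a') ?W)"
    proof (rule implements_conseq)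
      fix s' a'
      assume s': "I (Suc k) (set_cell x 0 (Suc k) s') a' \<and> agree_off (nmods p) (rmods p) s s'"
      then have k: "nmem s' x 0 0 = k"
        using x Suc.prems(2) by (simp add: agree_off_def)
      have "?agree s'"
        using s' Suc.prems(3) by (meson agree_off_mono agree_off_trans order_refl subset_insertI)
      then have "?agree (set_cell x 0 (Suc k) s')"
        by (simp add: agree_off_def)
      with s' Suc.prems(1) k have "?W (set_cell x 0 (Suc k) s') a'"
        by (intro Suc.IH) (auto simp: nmem_set_cell)
      with k show "implements B (assign x (NPlus (var x) (NConst 1))) s' (return_pmf a') ?W"
        unfolding assign_def store_def set_cell_def by (intro implements_NAssign) simp
    qed
    then have "implements B ?p s (bind_pmf (K k a) return_pmf) ?W"
      by (rule implements_Seq)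
    then have p: "implements B ?p s (K k a) ?W"
      by (simp add: bind_return_pmf')
    have "bval ?g s"
      using N[OF Suc.prems(3)] Suc.prems(1,2) by simp
    from implements_while_iterate[OF this p] show ?case
      by simp
  qed
  show ?thesis
    unfolding For_def
  proof (rule implements_computes_Seq)
    show "computes B (assign x (NConst 0)) s0 (\<lambda>s. s = set_cell x 0 0 s0)"
      by (rule computes_assign) simp
    show "implements B (While ?g ?p) s (iterate K 0 n a0) (I n)" if "s = set_cell x 0 0 s0" for s
      unfolding that using base n
      by (intro implements_While[OF loop]) (auto simp: nmem_set_cell agree_off_def)
  qed
qed

lemma computes_For:
  assumes "n \<le> B" "x \<notin> nmods p"
    and "\<And>s. agree_off (insert x (nmods p)) (rmods p) s0 s \<Longrightarrow> nval N s = n"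
    and "I 0 (set_cell x 0 0 s0)"
    and "\<And>k s. k < n \<Longrightarrow> nmem s x 0 0 = k \<Longrightarrow>
      agree_off (insert x (nmods p)) (rmods p) s0 s \<Longrightarrow> I k s \<Longrightarrow>
      computes B p s (\<lambda>s'. I (Suc k) (set_cell x 0 (Suc k) s'))"
  shows "computes B (For x N p) s0 (I n)"
  using implements_For[of n B x p s0 N "\<lambda>k s _. I k s" "()" "\<lambda>_ a. return_pmf a"] assms
  by (simp add: computes_def iterate_return)

text \<open>The program \<open>p\<close> prepares what the test \<open>g\<close> reads. There is no
  early exit: the flag can only rise from 0 to 1, so a bounded existential is the invariant.\<close>

definition search :: "nat \<Rightarrow> nat \<Rightarrow> nexp \<Rightarrow> com \<Rightarrow> bexp \<Rightarrow> com" where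
  "search k x N p g =
     Seq (assign k (NConst 0)) (For x N (Seq p (Cond g (assign k (NConst 1)) Skip)))"

lemma mods_search [simp]:
  "nmods (search k x N p g) = insert k (insert x (nmods p))" "rmods (search k x N p g) = rmods p"
  by (auto simp: search_def)

lemma computes_search:
  assumes n: "n \<le> B" and k: "k \<noteq> x" "k \<notin> nmods p" and x: "x \<notin> nmods p"
    and N: "\<And>s. agree_off (insert k (insert x (nmods p))) (rmods p) s0 s \<Longrightarrow> nval N s = n"
    and p: "\<And>j s. j < n \<Longrightarrow> nmem s x 0 0 = j \<Longrightarrow>
      agree_off (insert k (insert x (nmods p))) (rmods p) s0 s \<Longrightarrow>
      computes B p s (\<lambda>s'. bval g s' \<longleftrightarrow> P j)"
  shows "computes B (search k x N p g) s0 (\<lambda>s. nmem s k 0 0 = of_bool (\<exists>j<n. P j))"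
  unfolding search_def
proof (rule computes_Seq)
  show "computes B (assign k (NConst 0)) s0 (\<lambda>s. nmem s k 0 0 = 0)"
    by (rule computes_assign) (simp add: nmem_set_cell)
  fix s1
  assume s1: "nmem s1 k 0 0 = 0"
    "agree_off (nmods (assign k (NConst 0))) (rmods (assign k (NConst 0))) s0 s1"
  let ?q = "Seq p (Cond g (assign k (NConst 1)) Skip)"
  have agree: "agree_off (insert k (insert x (nmods p))) (rmods p) s0 s"
    if "agree_off (insert x (nmods ?q)) (rmods ?q) s1 s" for s
    using s1(2) that by (auto simp: agree_off_def)
  show "computes B (For x N ?q) s1 (\<lambda>s. nmem s k 0 0 = of_bool (\<exists>j<n. P j))"
  proof (rule computes_For[where I = "\<lambda>j s. nmem s k 0 0 = of_bool (\<exists>i<j. P i)"])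
    fix j s
    assume j: "j < n" "nmem s x 0 0 = j" "agree_off (insert x (nmods ?q)) (rmods ?q) s1 s"
      "nmem s k 0 0 = of_bool (\<exists>i<j. P i)"
    show "computes B ?q s (\<lambda>s'. nmem (set_cell x 0 (Suc j) s') k 0 0 = of_bool (\<exists>i<Suc j. P i))"
    proof (rule computes_Seq[OF p[OF j(1,2) agree[OF j(3)]]])
      fix s' assume s': "bval g s' \<longleftrightarrow> P j" "agree_off (nmods p) (rmods p) s s'"
      then have "nmem s' k 0 0 = of_bool (\<exists>i<j. P i)"
        using j(4) k by (simp add: agree_off_def)
      with s' k show "computes B (Cond g (assign k (NConst 1)) Skip) s'
          (\<lambda>s'. nmem (set_cell x 0 (Suc j) s') k 0 0 = of_bool (\<exists>i<Suc j. P i))"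
        by (intro computes_Cond computes_assign computes_Skip)
           (auto simp: nmem_set_cell less_Suc_eq)
    qed
  qed (use n k x s1 N agree in \<open>auto simp: nmem_set_cell\<close>)
qed

definition tally :: "nat \<Rightarrow> nat \<Rightarrow> nexp \<Rightarrow> com \<Rightarrow> bexp \<Rightarrow> com" where
  "tally k x N p g =
     Seq (assign k (NConst 0)) (For x N (Seq p (Cond g (assign k (NPlus (var k) (NConst 1))) Skip)))"

lemma mods_tally [simp]:
  "nmods (tally k x N p g) = insert k (insert x (nmods p))" "rmods (tally k x N p g) = rmods p"
  by (auto simp: tally_def)

lemma Collect_less_Suc_conj:
  "{i. i < Suc j \<and> P i} = (if P j then insert j {i. i < j \<and> P i} else {i. i < j \<and> P i})"
  by (auto simp: less_Suc_eq)

lemma computes_tally: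
  assumes n: "n \<le> B" and k: "k \<noteq> x" "k \<notin> nmods p" and x: "x \<notin> nmods p"
    and N: "\<And>s. agree_off (insert k (insert x (nmods p))) (rmods p) s0 s \<Longrightarrow> nval N s = n"
    and p: "\<And>j s. j < n \<Longrightarrow> nmem s x 0 0 = j \<Longrightarrow>
      agree_off (insert k (insert x (nmods p))) (rmods p) s0 s \<Longrightarrow>
      computes B p s (\<lambda>s'. bval g s' \<longleftrightarrow> P j)"
  shows "computes B (tally k x N p g) s0 (\<lambda>s. nmem s k 0 0 = card {j. j < n \<and> P j})"
  unfolding tally_def
proof (rule computes_Seq)
  show "computes B (assign k (NConst 0)) s0 (\<lambda>s. nmem s k 0 0 = 0)"
    by (rule computes_assign) (simp add: nmem_set_cell)
  fix s1
  assume s1: "nmem s1 k 0 0 = 0"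
    "agree_off (nmods (assign k (NConst 0))) (rmods (assign k (NConst 0))) s0 s1"
  let ?q = "Seq p (Cond g (assign k (NPlus (var k) (NConst 1))) Skip)"
  have agree: "agree_off (insert k (insert x (nmods p))) (rmods p) s0 s"
    if "agree_off (insert x (nmods ?q)) (rmods ?q) s1 s" for s
    using s1(2) that by (auto simp: agree_off_def)
  show "computes B (For x N ?q) s1 (\<lambda>s. nmem s k 0 0 = card {j. j < n \<and> P j})"
  proof (rule computes_For[where I = "\<lambda>j s. nmem s k 0 0 = card {i. i < j \<and> P i}"])
    fix j s
    assume j: "j < n" "nmem s x 0 0 = j" "agree_off (insert x (nmods ?q)) (rmods ?q) s1 s"
      "nmem s k 0 0 = card {i. i < j \<and> P i}"
    show "computes B ?q s (\<lambda>s'. nmem (set_cell x 0 (Suc j) s') k 0 0 = card {i. i < Suc j \<and> P i})"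
    proof (rule computes_Seq[OF p[OF j(1,2) agree[OF j(3)]]])
      fix s' assume s': "bval g s' \<longleftrightarrow> P j" "agree_off (nmods p) (rmods p) s s'"
      then have "nmem s' k 0 0 = card {i. i < j \<and> P i}"
        using j(4) k by (simp add: agree_off_def)
      with s' k show "computes B (Cond g (assign k (NPlus (var k) (NConst 1))) Skip) s'
          (\<lambda>s'. nmem (set_cell x 0 (Suc j) s') k 0 0 = card {i. i < Suc j \<and> P i})"
        by (intro computes_Cond computes_assign computes_Skip)
           (auto simp: nmem_set_cell Collect_less_Suc_conj)
    qed
  qed (use n k x s1 N agree in \<open>auto simp: nmem_set_cell\<close>)
qed

definition rvar :: "nat \<Rightarrow> rexp" where "rvar a = RCell a (NConst 0) (NConst 0)"
definition rassign :: "nat \<Rightarrow> rexp \<Rightarrow> com" where "rassign a x = RAssign a (NConst 0) (NConst 0) x"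

lemma rval_rvar [simp]: "rval (rvar a) s = rmem s a 0 0"
  by (simp add: rvar_def)

lemma mods_rassign [simp]: "nmods (rassign a x) = {}" "rmods (rassign a x) = {a}"
  by (simp_all add: rassign_def)

lemma computes_rassign:
  "(\<And>s'. nmem s' = nmem s \<Longrightarrow> rmem s' a 0 0 = rval x s \<Longrightarrow>
     (\<And>b. b \<noteq> a \<Longrightarrow> rmem s' b = rmem s b) \<Longrightarrow> Q s') \<Longrightarrow> computes B (rassign a x) s Q"
  unfolding rassign_def by (rule computes_RAssign) (simp add: upd_cell_def)

definition rsum :: "nat \<Rightarrow> nat \<Rightarrow> nexp \<Rightarrow> bexp \<Rightarrow> rexp \<Rightarrow> com" where
  "rsum k x N g e =
     Seq (rassign k (RConst 0)) (For x N (Cond g (rassign k (RPlus (rvar k) e)) Skip))"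

lemma mods_rsum [simp]: "nmods (rsum k x N g e) = {x}" "rmods (rsum k x N g e) = {k}"
  by (auto simp: rsum_def)

lemma computes_rsum:
  assumes n: "n \<le> B"
    and N: "\<And>s. agree_off {x} {k} s0 s \<Longrightarrow> nval N s = n"
    and g: "\<And>j s. j < n \<Longrightarrow> nmem s x 0 0 = j \<Longrightarrow> agree_off {x} {k} s0 s \<Longrightarrow> bval g s \<longleftrightarrow> P j"
    and e: "\<And>j s. j < n \<Longrightarrow> nmem s x 0 0 = j \<Longrightarrow> agree_off {x} {k} s0 s \<Longrightarrow> rval e s = f j"
  shows "computes B (rsum k x N g e) s0 (\<lambda>s. rmem s k 0 0 = sum f {j. j < n \<and> P j})"
  unfolding rsum_def
proof (rule computes_Seq)
  show "computes B (rassign k (RConst 0)) s0 (\<lambda>s. rmem s k 0 0 = 0)"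
    by (rule computes_rassign) simp
  fix s1
  assume s1: "rmem s1 k 0 0 = 0"
    "agree_off (nmods (rassign k (RConst 0))) (rmods (rassign k (RConst 0))) s0 s1"
  let ?q = "Cond g (rassign k (RPlus (rvar k) e)) Skip"
  have agree: "agree_off {x} {k} s0 s"
    if "agree_off (insert x (nmods ?q)) (rmods ?q) s1 s" for s
    using s1(2) that by (auto simp: agree_off_def)
  show "computes B (For x N ?q) s1 (\<lambda>s. rmem s k 0 0 = sum f {j. j < n \<and> P j})"
  proof (rule computes_For[where I = "\<lambda>j s. rmem s k 0 0 = sum f {i. i < j \<and> P i}"])
    fix j s
    assume j: "j < n" "nmem s x 0 0 = j" "agree_off (insert x (nmods ?q)) (rmods ?q) s1 s"
      "rmem s k 0 0 = sum f {i. i < j \<and> P i}"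
    then show "computes B ?q s
        (\<lambda>s'. rmem (set_cell x 0 (Suc j) s') k 0 0 = sum f {i. i < Suc j \<and> P i})"
      using g[OF j(1,2) agree[OF j(3)]] e[OF j(1,2) agree[OF j(3)]]
      by (intro computes_Cond computes_rassign computes_Skip) (auto simp: Collect_less_Suc_conj)
  qed (use n s1 N agree in auto)
qed

text \<open>A pass writes only its own entry of array \<open>k\<close>, so that entry still has its
  initial value when its pass begins. This permits updates that depend on the old contents.\<close>

lemma computes_fill:
  assumes n: "n \<le> B" and k: "k \<noteq> x" and x: "x \<notin> nmods p"
    and N: "\<And>s. agree_off (insert x (nmods p)) (rmods p) s0 s \<Longrightarrow> nval N s = n"
    and p: "\<And>j s. j < n \<Longrightarrow> nmem s x 0 0 = j \<Longrightarrow> agree_off (insert x (nmods p)) (rmods p) s0 s \<Longrightarrow>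
      nmem s k j 0 = nmem s0 k j 0 \<Longrightarrow>
      computes B p s (\<lambda>s'. nmem s' k j 0 = h j \<and> (\<forall>i. i \<noteq> j \<longrightarrow> nmem s' k i 0 = nmem s k i 0))"
  shows "computes B (For x N p) s0 (\<lambda>s. \<forall>j<n. nmem s k j 0 = h j)"
proof -
  let ?I = "\<lambda>j (s :: state). \<forall>i. nmem s k i 0 = (if i < j then h i else nmem s0 k i 0)"
  have "computes B (For x N p) s0 (?I n)"
  proof (rule computes_For[where I = "?I"])
    fix j s
    assume j: "j < n" "nmem s x 0 0 = j" "agree_off (insert x (nmods p)) (rmods p) s0 s" "?I j s"
    have "computes B p s (\<lambda>s'. nmem s' k j 0 = h j \<and> (\<forall>i. i \<noteq> j \<longrightarrow> nmem s' k i 0 = nmem s k i 0))"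
      using j by (intro p) auto
    then show "computes B p s (\<lambda>s'. ?I (Suc j) (set_cell x 0 (Suc j) s'))"
    proof (rule computes_conseq)
      fix s' :: state assume s': "nmem s' k j 0 = h j \<and> (\<forall>i. i \<noteq> j \<longrightarrow> nmem s' k i 0 = nmem s k i 0)"
      show "?I (Suc j) (set_cell x 0 (Suc j) s')"
      proof
        fix i
        show "nmem (set_cell x 0 (Suc j) s') k i 0 = (if i < Suc j then h i else nmem s0 k i 0)"
          using s' j(4) k by (cases "i = j") (auto simp: less_Suc_eq)
      qed
    qed
  qed (use n k x N in auto)
  then show ?thesis by (rule computes_conseq) simp
qed

section \<open>Random subsets and random hyperedges from coins\<close>

lemma pair_pmf_of_set:
  assumes "finite X" "X \<noteq> {}" "finite Y" "Y \<noteq> {}"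
  shows "pair_pmf (pmf_of_set X) (pmf_of_set Y) = pmf_of_set (X \<times> Y)"
proof (rule pmf_eqI)
  fix z
  show "pmf (pair_pmf (pmf_of_set X) (pmf_of_set Y)) z = pmf (pmf_of_set (X \<times> Y)) z"
    using assms by (cases z) (simp add: pmf_pair indicator_def card_cartesian_product)
qed

text \<open>Splitting a subset into its parts inside and outside \<open>L\<close> makes its trace on
  \<open>L\<close> uniform, and an injection preserves this. The program tosses a coin for every
  label ever issued; \<open>L\<close> will be the labels still in use.\<close>

lemma map_pmf_of_set_Pow:
  assumes "finite X" "L \<subseteq> X" "inj_on h L"
  shows "map_pmf (\<lambda>S. h ` (S \<inter> L)) (pmf_of_set (Pow X)) = pmf_of_set (Pow (h ` L))"
proof -
  define P where "P = Pow L \<times> Pow (X - L)"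
  let ?u = "\<lambda>z. fst z \<union> snd z"
  have fin: "finite L" "finite (X - L)" using assms by (auto intro: finite_subset)
  then have P: "finite P" "P \<noteq> {}" by (auto simp: P_def)
  have u: "?u z \<inter> L = fst z" "?u z - L = snd z" if "z \<in> P" for z
    using that by (auto simp: P_def)
  have "inj_on ?u P"
    by (rule inj_onI) (metis u prod_eqI)
  moreover have "?u ` P = Pow X"
  proof
    show "?u ` P \<subseteq> Pow X" using assms(2) by (auto simp: P_def)
    show "Pow X \<subseteq> ?u ` P"
    proof
      fix S assume "S \<in> Pow X"
      then have "(S \<inter> L, S - L) \<in> P" by (auto simp: P_def)
      then show "S \<in> ?u ` P"
        by (rule rev_image_eqI) auto
    qed
  qed
  ultimately have "pmf_of_set (Pow X) = map_pmf ?u (pmf_of_set P)"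
    using map_pmf_of_set_inj[of ?u P] P by simp
  then have "map_pmf (\<lambda>S. h ` (S \<inter> L)) (pmf_of_set (Pow X)) =
      map_pmf (\<lambda>z. h ` (?u z \<inter> L)) (pmf_of_set P)"
    by (simp add: pmf.map_comp o_def)
  also have "\<dots> = map_pmf (\<lambda>z. h ` fst z) (pmf_of_set P)"
    using P u by (intro map_pmf_cong refl) simp
  also have "\<dots> = map_pmf (\<lambda>S. h ` S) (map_pmf fst (pmf_of_set P))"
    by (simp add: pmf.map_comp o_def)
  also have "map_pmf fst (pmf_of_set P) = pmf_of_set (Pow L)"
    unfolding P_def using fin by (subst pair_pmf_of_set[symmetric]) (auto simp: map_fst_pair_pmf)
  also have "map_pmf (\<lambda>S. h ` S) (pmf_of_set (Pow L)) = pmf_of_set ((\<lambda>S. h ` S) ` Pow L)"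
    using fin assms(3) by (intro map_pmf_of_set_inj inj_on_image_Pow) auto
  also have "(\<lambda>S. h ` S) ` Pow L = Pow (h ` L)"
    by (rule image_Pow_surj) simp
  finally show ?thesis .
qed

definition subset_kernel :: "nat \<Rightarrow> nat set \<Rightarrow> nat set pmf" where
  "subset_kernel k S =
     bind_pmf (bernoulli_pmf (1 / 2)) (\<lambda>h. return_pmf (if h then insert k S else S))"

text \<open>A subset of \<open>{..<k}\<close> and a further fair bit correspond bijectively to a
  subset of \<open>{..<Suc k}\<close>, and bijections preserve uniformity.\<close>

lemma iterate_subset_kernel: "iterate subset_kernel 0 k {} = pmf_of_set (Pow {..<k})"
proof (induction k)
  case 0
  show ?case by (simp add: pmf_of_set_singleton)
next
  case (Suc k)
  have b: "bernoulli_pmf (1 / 2) = pmf_of_set (UNIV :: bool set)"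
    by (rule bernoulli_pmf_half_conv_pmf_of_set)
  let ?u = "\<lambda>(S, h). if h then insert k S else (S :: nat set)"
  have "iterate subset_kernel 0 (Suc k) {} =
      map_pmf ?u (pair_pmf (pmf_of_set (Pow {..<k})) (pmf_of_set UNIV))"
    unfolding iterate_Suc Suc.IH
    by (simp add: pair_pmf_def map_bind_pmf bind_return_pmf bind_assoc_pmf subset_kernel_def[abs_def] b)
  also have "\<dots> = map_pmf ?u (pmf_of_set (Pow {..<k} \<times> UNIV))"
    by (subst pair_pmf_of_set) auto
  also have "\<dots> = pmf_of_set (?u ` (Pow {..<k} \<times> UNIV))"
  proof (rule map_pmf_of_set_inj)
    show "inj_on ?u (Pow {..<k} \<times> UNIV)"
    proof (rule inj_onI)
      fix z z' assume z: "z \<in> Pow {..<k} \<times> UNIV" "z' \<in> Pow {..<k} \<times> UNIV" "?u z = ?u z'"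
      have u: "?u y - {k} = fst y" "k \<in> ?u y \<longleftrightarrow> snd y" if "y \<in> Pow {..<k} \<times> UNIV" for y
        using that by (auto split: if_splits)
      from z(3) have "fst z = fst z'" "snd z \<longleftrightarrow> snd z'"
        using u(1)[OF z(1)] u(1)[OF z(2)] u(2)[OF z(1)] u(2)[OF z(2)] by simp_all
      then show "z = z'" by (rule prod_eqI)
    qed
  qed auto
  also have "?u ` (Pow {..<k} \<times> UNIV) = Pow {..<Suc k}"
  proof (intro equalityI subsetI)
    fix T assume "T \<in> ?u ` (Pow {..<k} \<times> UNIV)"
    then obtain S h where "S \<subseteq> {..<k}" "T = (if h then insert k S else S)" by auto
    then have "T \<subseteq> insert k {..<k}" by (simp split: if_splits) blast+
    then show "T \<in> Pow {..<Suc k}" by (simp add: lessThan_Suc)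
  next
    fix T assume "T \<in> Pow {..<Suc k}"
    then have "(T - {k}, k \<in> T) \<in> Pow {..<k} \<times> UNIV" by (auto simp: less_Suc_eq)
    moreover have "T = ?u (T - {k}, k \<in> T)" by auto
    ultimately show "T \<in> ?u ` (Pow {..<k} \<times> UNIV)" by (rule rev_image_eqI)
  qed
  finally show ?case .
qed

text \<open>\<open>None\<close> means that nothing has been chosen yet. The bias is the conditional
  probability of \<open>k\<close> given that all smaller hyperedges of \<open>A\<close> were passed
  over, which turns a weighted choice into a sequence of coins.\<close>

definition choice_kernel :: "('e :: linorder \<Rightarrow> real) \<Rightarrow> 'e set \<Rightarrow> 'e \<Rightarrow> 'e option \<Rightarrow> 'e option pmf" where
  "choice_kernel c A k z =
     (if z = None \<and> k \<in> A
      then bind_pmf (bernoulli_pmf (c k / sum c {e \<in> A. k \<le> e}))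
        (\<lambda>h. return_pmf (if h then Some k else None))
      else return_pmf z)"

text \<open>The conditional probabilities telescope: everything below \<open>k\<close> is passed
  over with probability \<open>?S k / sum c A\<close>, and multiplying by the bias
  \<open>c k / ?S k\<close> leaves \<open>c k / sum c A\<close>.\<close>

lemma iterate_choice_kernel:
  fixes c :: "nat \<Rightarrow> real"
  assumes A: "A \<subseteq> {..<m}" "A \<noteq> {}" and c: "\<And>e. e \<in> A \<Longrightarrow> 0 < c e" and H: "hedges H = A"
  shows "iterate (choice_kernel c A) 0 m None = random_hedge H c"
proof -
  have fin: "finite A" using A(1) by (rule finite_subset) simp
  have pos: "0 < sum c A" using A(2) c fin by (intro sum_pos) auto
  let ?K = "choice_kernel c A" and ?S = "\<lambda>k. sum c {e \<in> A. k \<le> e}"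
  have step: "?S k = (if k \<in> A then c k else 0) + ?S (Suc k)" for k
  proof (cases "k \<in> A")
    case True
    then have "{e \<in> A. k \<le> e} = insert k {e \<in> A. Suc k \<le> e}" by auto
    then show ?thesis using True fin by simp
  next
    case False
    then have "{e \<in> A. k \<le> e} = {e \<in> A. Suc k \<le> e}" by (auto simp: Suc_le_eq le_less)
    then show ?thesis using False by simp
  qed
  have S: "0 \<le> ?S k" for k using c by (intro sum_nonneg) (auto simp: less_imp_le)
  have main: "pmf (iterate ?K 0 k None) None = ?S k / sum c A \<and>
     (\<forall>e. pmf (iterate ?K 0 k None) (Some e) = (if e \<in> A \<and> e < k then c e / sum c A else 0))" for k
  proof (induction k)
    case 0
    then show ?case using pos by simp
  next
    case (Suc k)
    let ?P = "iterate ?K 0 k None"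
    \<comment> \<open>A choice once made is kept, so besides the mass still undecided only the old
      mass of \<open>z\<close> itself contributes.\<close>
    have dec: "pmf (bind_pmf ?P (?K k)) z = pmf ?P None * pmf (?K k None) z +
        (case z of None \<Rightarrow> 0 | Some e \<Rightarrow> pmf ?P (Some e))" for z
    proof -
      have sup: "set_pmf ?P \<subseteq> insert None (Some ` A)"
        using Suc.IH by (auto simp: set_pmf_iff split: if_splits) (metis image_eqI not_None_eq)
      have K: "?K k (Some e) = return_pmf (Some e)" for e
        by (simp add: choice_kernel_def)
      have "pmf (bind_pmf ?P (?K k)) z = (\<Sum>y\<in>insert None (Some ` A). pmf (?K k y) z * pmf ?P y)"
        unfolding pmf_bind using sup fin by (subst integral_measure_pmf_real[where A = "insert None (Some ` A)"]) auto
      also have "\<dots> = pmf (?K k None) z * pmf ?P None + (\<Sum>e\<in>A. pmf (?K k (Some e)) z * pmf ?P (Some e))"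
        using fin by (subst sum.insert) (auto simp: sum.reindex)
      also have "(\<Sum>e\<in>A. pmf (?K k (Some e)) z * pmf ?P (Some e)) =
          (case z of None \<Rightarrow> 0 | Some e \<Rightarrow> pmf ?P (Some e))"
        unfolding K using fin Suc.IH
        by (cases z) (auto simp: indicator_def if_distrib[of "\<lambda>x. x * _"] sum.delta cong: if_cong)
      finally show ?thesis by simp
    qed
    show ?case
    proof (cases "k \<in> A")
      case True
      define x where "x = c k / ?S k"
      have Sk: "0 < ?S k" using step[of k] True c[of k] S[of "Suc k"] by simp
      have x: "0 \<le> x" "x \<le> 1" "1 - x = ?S (Suc k) / ?S k"
        using True c[of k] S[of "Suc k"] Sk step[of k] by (auto simp: x_def field_simps)
      have K: "?K k None = bind_pmf (bernoulli_pmf x) (\<lambda>h. return_pmf (if h then Some k else None))"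
        using True by (simp add: choice_kernel_def x_def)
      have KN: "pmf (?K k None) None = 1 - x"
        unfolding K using x by (simp add: pmf_bind)
      have KS: "pmf (?K k None) (Some e) = (if e = k then x else 0)" for e
        unfolding K using x by (auto simp: pmf_bind)
      show ?thesis
        unfolding iterate_Suc add_0_left dec KN KS using Suc.IH Sk x True
        by (auto simp: x_def less_Suc_eq)
    next
      case False
      then have K: "?K k None = return_pmf None" by (simp add: choice_kernel_def)
      show ?thesis
        unfolding iterate_Suc add_0_left dec K using Suc.IH step[of k] False
        by (auto simp: less_Suc_eq)
    qed
  qed
  show ?thesis
  \<comment> \<open>Only proper results need to be compared; the mass of \<open>None\<close> is then
    determined.\<close>
  proof (rule spmf_eqI)
    fix e show "spmf (iterate ?K 0 m None) e = spmf (random_hedge H c) e"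
      using main[of m] A c fin by (subst spmf_random_hedge) (auto simp: H)
  qed
qed

section \<open>A program for the contraction algorithm\<close>

text \<open>Arrays of natural numbers: 3 holds the labels of the vertices, 4 flags the hyperedges that
  still exist, 5 marks the vertices to be merged, 7 is the random side as a set of labels.
  Scalars: 8 is the next fresh label, 9 tells whether to stop, 11 is the number of labels in use,
  13 is the chosen hyperedge, 10 and 12 are flags, and 14, 15 and 16 are loop indices. Real scalars:
  3 accumulates sums, 4 is the cost of the hyperedges that have not been passed over yet.\<close>

definition N_vertices :: nexp where "N_vertices = NCell 0 (NConst 0) (NConst 0)"
definition N_hedges :: nexp where "N_hedges = NCell 0 (NConst 0) (NConst 1)"
definition N_rank :: nexp where "N_rank = NCell 0 (NConst 0) (NConst 2)"
definition N_weights :: nexp where "N_weights = NCell 0 (NConst 0) (NConst 3)"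

text \<open>Stored weights are never updated: the weight of a merged vertex is recomputed as a sum
  of input weights over a label class. Index 15 starts at 0 but weights and budgets are numbered
  from 1.\<close>

definition mark_infeasible :: com where
  "mark_infeasible =
     For 14 N_vertices (Seq
       (search 10 15 N_weights
         (rsum 3 16 N_vertices (NEq (cell 3 (var 16)) (cell 3 (var 14)))
           (RCell 1 (NPlus (var 15) (NConst 1)) (var 16)))
         (Neg (RLe (rvar 3) (RCell 2 (NPlus (var 15) (NConst 1)) (NConst 0)))))
       (store 5 (var 14) (var 10)))"

text \<open>A hyperedge dies when no unmarked end is found. The label counter advances even if
  nothing is marked, which makes the number of labels issued easy to bound.\<close>

definition merge_marked :: com where
  "merge_marked = Seq
     (For 14 N_hedges (Seq
       (search 10 15 N_vertices Skip
         (Conj (NEq (NCell 1 (var 14) (var 15)) (NConst 1)) (NEq (cell 5 (var 15)) (NConst 0))))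
       (Cond (NEq (var 10) (NConst 0)) (store 4 (var 14) (NConst 0)) Skip)))
     (Seq (For 14 N_vertices
       (Cond (NEq (cell 5 (var 14)) (NConst 1)) (store 3 (var 14) (var 8)) Skip))
     (assign 8 (NPlus (var 8) (NConst 1))))"

text \<open>Labels are never reused, so the vertices of the current hypergraph are counted by the
  issued labels that some original vertex still carries.\<close>

definition count_labels :: com where
  "count_labels =
     tally 11 14 (var 8) (search 10 15 N_vertices Skip (NEq (cell 3 (var 15)) (var 14)))
       (NEq (var 10) (NConst 1))"

definition sum_costs :: com where
  "sum_costs = rsum 3 14 N_hedges (NEq (cell 4 (var 14)) (NConst 1)) (RCell 0 (var 14) (NConst 0))"

definition choose_hedge :: com where
  "choose_hedge = Seq (assign 12 (NConst 0)) (Seq (rassign 4 (rvar 3))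
     (For 14 N_hedges (Cond (Conj (NEq (cell 4 (var 14)) (NConst 1)) (NEq (var 12) (NConst 0)))
       (Coin (RDivide (RCell 0 (var 14) (NConst 0)) (rvar 4))
         (Seq (assign 12 (NConst 1)) (assign 13 (var 14)))
         (rassign 4 (RMinus (rvar 4) (RCell 0 (var 14) (NConst 0)))))
       Skip)))"

text \<open>Comparing labels marks every original vertex whose class meets the chosen hyperedge, so
  that the marked set is a union of classes.\<close>

definition mark_chosen :: com where
  "mark_chosen =
     For 14 N_vertices (Seq
       (search 10 15 N_vertices Skip
         (Conj (NEq (NCell 1 (var 13) (var 15)) (NConst 1)) (NEq (cell 3 (var 15)) (cell 3 (var 14)))))
       (store 5 (var 14) (var 10)))"

definition choose_side :: com where
  "choose_side = For 14 (var 8)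
     (Coin (RDivide (RConst 1) (RConst 2))
       (store 7 (var 14) (NConst 1)) (store 7 (var 14) (NConst 0)))"

definition write_cut :: com where
  "write_cut = For 14 N_hedges (Seq
     (search 10 15 N_vertices Skip
       (Conj (NEq (NCell 1 (var 14) (var 15)) (NConst 1)) (NEq (cell 7 (cell 3 (var 15))) (NConst 1))))
     (Seq (search 12 15 N_vertices Skip
       (Conj (NEq (NCell 1 (var 14) (var 15)) (NConst 1)) (NEq (cell 7 (cell 3 (var 15))) (NConst 0))))
     (Cond (Conj (NEq (cell 4 (var 14)) (NConst 1)) (Conj (NEq (var 10) (NConst 1)) (NEq (var 12) (NConst 1))))
       (store 2 (var 14) (NConst 1)) (store 2 (var 14) (NConst 0)))))"

text \<open>Costs are positive, so a total cost of at most 0 signals that no hyperedge is left. The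
  same total is the initial remaining cost in \<open>choose_hedge\<close>.\<close>

definition round :: com where
  "round = Seq (Seq mark_infeasible merge_marked) (Seq count_labels (Seq sum_costs
     (Cond (Conj (Neg (NLe (var 11) (NPlus N_rank (NConst 1)))) (Neg (RLe (rvar 3) (RConst 0))))
       (Seq choose_hedge (Seq mark_chosen merge_marked))
       (Seq choose_side (Seq write_cut (assign 9 (NConst 1)))))))"

definition contraction_program :: com where
  "contraction_program =
     Seq (For 14 N_vertices (store 3 (var 14) (var 14)))
     (Seq (For 14 N_hedges (store 4 (var 14) (NConst 1)))
     (Seq (assign 8 N_vertices)
     (While (NEq (var 9) (NConst 0)) round)))"

lemmas N_defs = N_vertices_def N_hedges_def N_rank_def N_weights_def

lemma mods_phases [simp]:
  "nmods mark_infeasible = {5, 10, 14, 15, 16}" "rmods mark_infeasible = {3}"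
  "nmods merge_marked = {3, 4, 8, 10, 14, 15}" "rmods merge_marked = {}"
  "nmods count_labels = {10, 11, 14, 15}" "rmods count_labels = {}"
  "nmods sum_costs = {14}" "rmods sum_costs = {3}"
  "nmods choose_hedge = {12, 13, 14}" "rmods choose_hedge = {4}"
  "nmods mark_chosen = {5, 10, 14, 15}" "rmods mark_chosen = {}"
  "nmods choose_side = {7, 14}" "rmods choose_side = {}"
  "nmods write_cut = {2, 10, 12, 14, 15}" "rmods write_cut = {}"
  by (auto simp: mark_infeasible_def merge_marked_def count_labels_def sum_costs_def
      choose_hedge_def mark_chosen_def choose_side_def write_cut_def)

lemma of_bool_eq_Suc_0 [simp]: "of_bool P = Suc 0 \<longleftrightarrow> P"
  by simp

section \<open>Correctness of the phases on a fixed instance\<close>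

text \<open>One bound \<open>B\<close> serves all loops. There are at most \<open>m + 1\<close>
  rounds, each but the last issues two labels and the last one issues one, so at most
  \<open>n + 2 m + 1\<close> labels arise.\<close>

locale instance_bound =
  fixes G :: "(nat, nat) hypergraph" and r t :: nat and w :: "nat \<Rightarrow> nat \<Rightarrow> real"
    and c b :: "nat \<Rightarrow> real" and B n m :: nat and s0 :: state
  assumes valid: "valid_instance G r t w c b" and labelled: "labelled G"
    and n: "n = card (verts G)" and m: "m = card (hedges G)"
    and B: "B = 2 * input_size G t + 2" and s0: "s0 = input_state G r t w c b"
begin

lemma G: "wf_hypergraph G" "verts G = {..<n}" "hedges G = {..<m}"
  and cpos: "e < m \<Longrightarrow> 0 < c e"
  and ends_sub: "e < m \<Longrightarrow> ends G e \<subseteq> {..<n}"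
  using valid labelled by (auto simp: valid_instance_def labelled_def n m wf_hypergraph_def)

lemma le_B: "n \<le> B" "m \<le> B" "t \<le> B"
  by (auto simp: B input_size_def n m)

text \<open>Natural number arrays below 2 and real arrays below 3 hold the input and are never
  written.\<close>

definition on_input :: "state \<Rightarrow> bool" where
  "on_input s \<longleftrightarrow> agree_off {2..} {3..} s0 s"

lemma on_input:
  assumes "on_input s"
  shows "nval N_vertices s = n" "nval N_hedges s = m" "nval N_rank s = r" "nval N_weights s = t"
    "e < m \<Longrightarrow> nmem s 1 e v = of_bool (v \<in> ends G e)"
    "e < m \<Longrightarrow> rmem s 0 e 0 = c e"
    "i < t \<Longrightarrow> v < n \<Longrightarrow> rmem s 1 (Suc i) v = w (Suc i) v"
    "i < t \<Longrightarrow> rmem s 2 (Suc i) 0 = b (Suc i)"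
proof -
  have "nmem s a = nmem s0 a" if "a < 2" for a using assms that by (simp add: on_input_def agree_off_def)
  moreover have "rmem s a = rmem s0 a" if "a < 3" for a using assms that by (simp add: on_input_def agree_off_def)
  ultimately show "nval N_vertices s = n" "nval N_hedges s = m" "nval N_rank s = r" "nval N_weights s = t"
    "e < m \<Longrightarrow> nmem s 1 e v = of_bool (v \<in> ends G e)"
    "e < m \<Longrightarrow> rmem s 0 e 0 = c e"
    "i < t \<Longrightarrow> v < n \<Longrightarrow> rmem s 1 (Suc i) v = w (Suc i) v"
    "i < t \<Longrightarrow> rmem s 2 (Suc i) 0 = b (Suc i)"
    by (simp_all add: s0 input_state_def N_defs G(2,3) numeral_eq_Suc)
qed

lemma on_input_agree: "on_input s \<Longrightarrow> agree_off M R s s' \<Longrightarrow> M \<subseteq> {2..} \<Longrightarrow> R \<subseteq> {3..} \<Longrightarrow> on_input s'"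
  unfolding on_input_def by (rule agree_off_trans) (auto elim: agree_off_mono)

definition frame :: "nat set \<Rightarrow> nat set \<Rightarrow> state \<Rightarrow> state \<Rightarrow> bool" where
  "frame M R s s' \<longleftrightarrow> on_input s \<and> on_input s' \<and> agree_off M R s s'"

lemma frameI:
  "on_input s \<Longrightarrow> agree_off M' R' s s' \<Longrightarrow> M' \<subseteq> M \<Longrightarrow> R' \<subseteq> R \<Longrightarrow> M \<subseteq> {2..} \<Longrightarrow> R \<subseteq> {3..} \<Longrightarrow> frame M R s s'"
  using agree_off_mono[of M' R' s s' M R] on_input_agree[of s M R s'] by (simp add: frame_def)

lemma frame_on_input: "frame M R s s' \<Longrightarrow> on_input s'"
  by (simp add: frame_def)

lemma frame_nmem: "frame M R s s' \<Longrightarrow> a \<notin> M \<Longrightarrow> nmem s' a = nmem s a"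
  and frame_rmem: "frame M R s s' \<Longrightarrow> a \<notin> R \<Longrightarrow> rmem s' a = rmem s a"
  by (auto simp: frame_def agree_off_def)

text \<open>In this and the following rules the caller chooses \<open>M\<close> and
  \<open>R\<close>, so that side conditions mention explicit sets of arrays in place of
  \<open>nmods\<close> and \<open>rmods\<close>.\<close>

lemma search_rule:
  assumes s0: "on_input s0'" and MR: "M \<subseteq> {2..}" "R \<subseteq> {3..}"
    and k: "k \<noteq> x" "k \<notin> nmods p" "x \<notin> nmods p"
    and M: "insert k (insert x (nmods p)) \<subseteq> M" and R: "rmods p \<subseteq> R"
    and N: "\<And>s. frame M R s0' s \<Longrightarrow> nval N s = l" and l: "l \<le> B"
    and p: "\<And>j s. j < l \<Longrightarrow> nmem s x 0 0 = j \<Longrightarrow> frame M R s0' s \<Longrightarrow>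
      computes B p s (\<lambda>s'. bval g s' \<longleftrightarrow> P j)"
  shows "computes B (search k x N p g) s0' (\<lambda>s. nmem s k 0 0 = of_bool (\<exists>j<l. P j))"
  using k l by (intro computes_search p N frameI[OF s0 _ M R MR]) auto

lemma tally_rule:
  assumes s0: "on_input s0'" and MR: "M \<subseteq> {2..}" "R \<subseteq> {3..}"
    and k: "k \<noteq> x" "k \<notin> nmods p" "x \<notin> nmods p"
    and M: "insert k (insert x (nmods p)) \<subseteq> M" and R: "rmods p \<subseteq> R"
    and N: "\<And>s. frame M R s0' s \<Longrightarrow> nval N s = l" and l: "l \<le> B"
    and p: "\<And>j s. j < l \<Longrightarrow> nmem s x 0 0 = j \<Longrightarrow> frame M R s0' s \<Longrightarrow>
      computes B p s (\<lambda>s'. bval g s' \<longleftrightarrow> P j)"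
  shows "computes B (tally k x N p g) s0' (\<lambda>s. nmem s k 0 0 = card {j. j < l \<and> P j})"
  using k l by (intro computes_tally p N frameI[OF s0 _ M R MR]) auto

lemma rsum_rule:
  assumes s0: "on_input s0'" and MR: "M \<subseteq> {2..}" "R \<subseteq> {3..}"
    and M: "{x} \<subseteq> M" and R: "{k} \<subseteq> R"
    and N: "\<And>s. frame M R s0' s \<Longrightarrow> nval N s = l" and l: "l \<le> B"
    and g: "\<And>j s. j < l \<Longrightarrow> nmem s x 0 0 = j \<Longrightarrow> frame M R s0' s \<Longrightarrow> bval g s \<longleftrightarrow> P j"
    and e: "\<And>j s. j < l \<Longrightarrow> nmem s x 0 0 = j \<Longrightarrow> frame M R s0' s \<Longrightarrow> rval e s = f j"
  shows "computes B (rsum k x N g e) s0' (\<lambda>s. rmem s k 0 0 = sum f {j. j < l \<and> P j})"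
  using l by (intro computes_rsum g e N frameI[OF s0 _ M R MR]) auto

lemma fill_rule:
  assumes s0: "on_input s0'" and MR: "M \<subseteq> {2..}" "R \<subseteq> {3..}"
    and k: "k \<noteq> x" "x \<notin> nmods p"
    and M: "insert x (nmods p) \<subseteq> M" and R: "rmods p \<subseteq> R"
    and N: "\<And>s. frame M R s0' s \<Longrightarrow> nval N s = l" and l: "l \<le> B"
    and p: "\<And>j s. j < l \<Longrightarrow> nmem s x 0 0 = j \<Longrightarrow> frame M R s0' s \<Longrightarrow> nmem s k j 0 = nmem s0' k j 0 \<Longrightarrow>
      computes B p s (\<lambda>s'. nmem s' k j 0 = h j \<and> (\<forall>i. i \<noteq> j \<longrightarrow> nmem s' k i 0 = nmem s k i 0))"
  shows "computes B (For x N p) s0' (\<lambda>s. \<forall>j<l. nmem s k j 0 = h j)"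
  using k l by (intro computes_fill p N frameI[OF s0 _ M R MR]) auto

lemma computes_frame:
  assumes "computes B p s Q" "on_input s" "nmods p \<subseteq> {2..}" "rmods p \<subseteq> {3..}"
  shows "computes B p s (\<lambda>s'. Q s' \<and> frame (nmods p) (rmods p) s s')"
  using computes_agree[OF assms(1)] by (rule computes_conseq) (auto intro!: frameI[OF assms(2) _ subset_refl subset_refl assms(3,4)])

lemma conseq_rule:
  assumes "computes B p s P" "on_input s" "nmods p \<subseteq> {2..}" "rmods p \<subseteq> {3..}"
    and "\<And>s'. P s' \<Longrightarrow> frame (nmods p) (rmods p) s s' \<Longrightarrow> Q s'"
  shows "computes B p s Q"
  using computes_frame[OF assms(1-4)] assms(5) by (rule computes_conseq) auto

lemma Seq_rule:
  assumes "computes B p s P" "on_input s" "nmods p \<subseteq> {2..}" "rmods p \<subseteq> {3..}"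
    and "\<And>s'. P s' \<Longrightarrow> frame (nmods p) (rmods p) s s' \<Longrightarrow> computes B q s' Q"
  shows "computes B (Seq p q) s Q"
  using assms(1) by (rule computes_Seq) (rule assms(5) frameI[OF assms(2) _ subset_refl subset_refl assms(3,4)] | assumption)+

lemma computes_mark_infeasible:
  assumes s: "on_input s"
  shows "computes B mark_infeasible s (\<lambda>s'. \<forall>v<n. nmem s' 5 v 0 =
    of_bool (\<exists>i<t. b (Suc i) < sum (w (Suc i)) {u. u < n \<and> nmem s 3 u 0 = nmem s 3 v 0}))"
  unfolding mark_infeasible_def
proof (rule fill_rule[OF s, where M = "{5, 10, 14, 15, 16}" and R = "{3}"])
  fix v s1
  assume v: "v < n" "nmem s1 14 0 0 = v" and s1: "frame {5, 10, 14, 15, 16} {3} s s1"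
  let ?rsum = "rsum 3 16 N_vertices (NEq (cell 3 (var 16)) (cell 3 (var 14)))
           (RCell 1 (NPlus (var 15) (NConst 1)) (var 16))"
  let ?g = "Neg (RLe (rvar 3) (RCell 2 (NPlus (var 15) (NConst 1)) (NConst 0)))"
  let ?S = "\<lambda>v. {u. u < n \<and> nmem s 3 u 0 = nmem s 3 v 0}"
  let ?search = "search 10 15 N_weights ?rsum ?g"
  have "computes B ?search s1
      (\<lambda>s'. nmem s' 10 0 0 = of_bool (\<exists>i<t. b (Suc i) < sum (w (Suc i)) (?S v)))"
  proof (rule search_rule[OF frame_on_input[OF s1], where M = "{10, 15, 16}" and R = "{3}"])
    fix i s2
    assume i: "i < t" "nmem s2 15 0 0 = i" and s2: "frame {10, 15, 16} {3} s1 s2"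
    have "computes B ?rsum s2 (\<lambda>s'. rmem s' 3 0 0 = sum (w (Suc i)) (?S v))"
    proof (rule rsum_rule[OF frame_on_input[OF s2], where M = "{16}" and R = "{3}"])
      fix u s3 assume u: "u < n" "nmem s3 16 0 0 = u" and s3: "frame {16} {3} s2 s3"
      have "nmem s3 3 = nmem s 3" "nmem s3 14 0 0 = v" "nmem s3 15 0 0 = i"
        using v(2) i(2) by (simp_all add: frame_nmem[OF s1] frame_nmem[OF s2] frame_nmem[OF s3])
      then show "bval (NEq (cell 3 (var 16)) (cell 3 (var 14))) s3 \<longleftrightarrow> nmem s 3 u 0 = nmem s 3 v 0"
        "rval (RCell 1 (NPlus (var 15) (NConst 1)) (var 16)) s3 = w (Suc i) u"
        using u i(1) on_input(7)[OF frame_on_input[OF s3], of i u] by auto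
    qed (auto simp: le_B on_input(1) frame_on_input)
    then show "computes B ?rsum s2 (\<lambda>s'. bval ?g s' \<longleftrightarrow> b (Suc i) < sum (w (Suc i)) (?S v))"
    proof (rule conseq_rule)
      fix s3 assume s3: "rmem s3 3 0 0 = sum (w (Suc i)) (?S v)" "frame (nmods ?rsum) (rmods ?rsum) s2 s3"
      have "nmem s3 15 0 0 = i" using i(2) by (simp add: frame_nmem[OF s3(2)])
      then show "bval ?g s3 \<longleftrightarrow> b (Suc i) < sum (w (Suc i)) (?S v)"
        using s3(1) on_input(8)[OF frame_on_input[OF s3(2)], of i] i(1) by (auto simp: not_le)
    qed (use s2 in \<open>auto simp: frame_on_input\<close>)
  qed (auto simp: le_B on_input(4) frame_on_input)
  then show "computes B (Seq ?search (store 5 (var 14) (var 10))) s1 (\<lambda>s'. nmem s' 5 v 0 =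
      of_bool (\<exists>i<t. b (Suc i) < sum (w (Suc i)) (?S v)) \<and> (\<forall>i. i \<noteq> v \<longrightarrow> nmem s' 5 i 0 = nmem s1 5 i 0))"
  proof (rule Seq_rule)
    fix s2 assume s2: "nmem s2 10 0 0 = of_bool (\<exists>i<t. b (Suc i) < sum (w (Suc i)) (?S v))"
      "frame (nmods ?search) (rmods ?search) s1 s2"
    have "nmem s2 14 0 0 = v" "nmem s2 5 = nmem s1 5" using v(2) by (simp_all add: frame_nmem[OF s2(2)])
    with s2(1) show "computes B (store 5 (var 14) (var 10)) s2 (\<lambda>s'. nmem s' 5 v 0 =
      of_bool (\<exists>i<t. b (Suc i) < sum (w (Suc i)) (?S v)) \<and> (\<forall>i. i \<noteq> v \<longrightarrow> nmem s' 5 i 0 = nmem s1 5 i 0))"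
      by (intro computes_store) (simp add: nmem_set_cell)
  qed (use s1 in \<open>auto simp: frame_on_input\<close>)
qed (auto simp: le_B on_input(1) frame_on_input)

section \<open>Label classes as vertices of the contracted hypergraph\<close>

text \<open>Only the fibres of \<open>f\<close> are represented, not its values, since those depend
  on choices that no program can reproduce. That all labels lie below \<open>k\<close> makes
  \<open>k\<close> fresh.\<close>

definition repr :: "state \<Rightarrow> nat \<Rightarrow> (nat \<Rightarrow> nat) \<Rightarrow> nat set \<Rightarrow> bool" where
  "repr s k f A \<longleftrightarrow> on_input s \<and> nmem s 8 0 0 = k \<and> (\<forall>v<n. nmem s 3 v 0 < k) \<and>
     (\<forall>u<n. \<forall>v<n. nmem s 3 u 0 = nmem s 3 v 0 \<longleftrightarrow> f u = f v) \<and>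
     A \<subseteq> {..<m} \<and> (\<forall>e<m. nmem s 4 e 0 = of_bool (e \<in> A))"

lemma repr:
  assumes "repr s k f A"
  shows "on_input s" "nmem s 8 0 0 = k" "v < n \<Longrightarrow> nmem s 3 v 0 < k"
    "u < n \<Longrightarrow> v < n \<Longrightarrow> nmem s 3 u 0 = nmem s 3 v 0 \<longleftrightarrow> f u = f v"
    "A \<subseteq> {..<m}" "e < m \<Longrightarrow> nmem s 4 e 0 = of_bool (e \<in> A)"
  using assms by (auto simp: repr_def)

lemma repr_frame:
  assumes "repr s k f A" "frame M R s s'" "3 \<notin> M" "4 \<notin> M" "8 \<notin> M"
  shows "repr s' k f A"
  using assms(1) assms(3-5) frame_on_input[OF assms(2)]
  unfolding repr_def by (simp add: frame_nmem[OF assms(2)])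

lemma computes_merge_marked:
  assumes s: "repr s k f A" and mark: "\<And>v. v < n \<Longrightarrow> nmem s 5 v 0 = of_bool (v \<in> M)"
    and M: "M \<subseteq> {..<n}" and sat: "\<And>u v. u \<in> M \<Longrightarrow> v < n \<Longrightarrow> f u = f v \<Longrightarrow> v \<in> M"
    and z: "M \<noteq> {} \<Longrightarrow> z \<in> f ` M"
  shows "computes B merge_marked s
    (\<lambda>s'. repr s' (Suc k) (\<lambda>v. if v \<in> M then z else f v) {e \<in> A. \<not> ends G e \<subseteq> M})"
  unfolding merge_marked_def
proof (rule Seq_rule)
  let ?A = "{e \<in> A. \<not> ends G e \<subseteq> M}"
  let ?search = "search 10 15 N_vertices Skip
         (Conj (NEq (NCell 1 (var 14) (var 15)) (NConst 1)) (NEq (cell 5 (var 15)) (NConst 0)))"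
  let ?del = "Cond (NEq (var 10) (NConst 0)) (store 4 (var 14) (NConst 0)) Skip"
  show "computes B (For 14 N_hedges (Seq ?search ?del)) s (\<lambda>s'. \<forall>e<m. nmem s' 4 e 0 = of_bool (e \<in> ?A))"
  proof (rule fill_rule[OF repr(1)[OF s], where M = "{4, 10, 14, 15}" and R = "{}"])
    fix e s1 assume e: "e < m" "nmem s1 14 0 0 = e" and s1: "frame {4, 10, 14, 15} {} s s1"
      and alive: "nmem s1 4 e 0 = nmem s 4 e 0"
    have "computes B ?search s1 (\<lambda>s'. nmem s' 10 0 0 = of_bool (\<exists>v<n. v \<in> ends G e \<and> v \<notin> M))"
    proof (rule search_rule[OF frame_on_input[OF s1], where M = "{10, 15}" and R = "{}"])
      fix v s2 assume v: "v < n" "nmem s2 15 0 0 = v" and s2: "frame {10, 15} {} s1 s2"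
      have "nmem s2 14 0 0 = e" "nmem s2 5 = nmem s 5"
        using e(2) by (simp_all add: frame_nmem[OF s1] frame_nmem[OF s2])
      then show "computes B Skip s2 (\<lambda>s'. bval (Conj (NEq (NCell 1 (var 14) (var 15)) (NConst 1))
          (NEq (cell 5 (var 15)) (NConst 0))) s' \<longleftrightarrow> v \<in> ends G e \<and> v \<notin> M)"
        using v mark[of v] e(1) on_input(5)[OF frame_on_input[OF s2], of e v]
        by (intro computes_Skip) simp
    qed (auto simp: le_B on_input(1) frame_on_input)
    then show "computes B (Seq ?search ?del) s1
       (\<lambda>s'. nmem s' 4 e 0 = of_bool (e \<in> ?A) \<and> (\<forall>i. i \<noteq> e \<longrightarrow> nmem s' 4 i 0 = nmem s1 4 i 0))"
    proof (rule Seq_rule)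
      fix s2 assume s2: "nmem s2 10 0 0 = of_bool (\<exists>v<n. v \<in> ends G e \<and> v \<notin> M)"
        "frame (nmods ?search) (rmods ?search) s1 s2"
      have "nmem s2 14 0 0 = e" "nmem s2 4 = nmem s1 4"
        using e(2) by (simp_all add: frame_nmem[OF s2(2)])
      moreover have "(\<exists>v<n. v \<in> ends G e \<and> v \<notin> M) \<longleftrightarrow> \<not> ends G e \<subseteq> M"
        using ends_sub[OF e(1)] by auto
      ultimately show "computes B ?del s2
          (\<lambda>s'. nmem s' 4 e 0 = of_bool (e \<in> ?A) \<and> (\<forall>i. i \<noteq> e \<longrightarrow> nmem s' 4 i 0 = nmem s1 4 i 0))"
        using s2(1) alive repr(6)[OF s e(1)]
        by (intro computes_Cond computes_store computes_Skip) (simp_all add: nmem_set_cell)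
    qed (use s1 in \<open>auto simp: frame_on_input\<close>)
  qed (auto simp: le_B on_input(2) frame_on_input)
  fix s1 assume alive: "\<forall>e<m. nmem s1 4 e 0 = of_bool (e \<in> ?A)"
    and s1: "frame (nmods (For 14 N_hedges (Seq ?search ?del))) (rmods (For 14 N_hedges (Seq ?search ?del))) s s1"
  let ?lab = "\<lambda>v. if v \<in> M then k else nmem s 3 v 0"
  let ?upd = "Cond (NEq (cell 5 (var 14)) (NConst 1)) (store 3 (var 14) (var 8)) Skip"
  show "computes B (Seq (For 14 N_vertices ?upd) (assign 8 (NPlus (var 8) (NConst 1)))) s1
     (\<lambda>s'. repr s' (Suc k) (\<lambda>v. if v \<in> M then z else f v) ?A)"
  proof (rule Seq_rule)
    show "computes B (For 14 N_vertices ?upd) s1 (\<lambda>s'. \<forall>v<n. nmem s' 3 v 0 = ?lab v)"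
    proof (rule fill_rule[OF frame_on_input[OF s1], where M = "{3, 14}" and R = "{}"])
      fix v s2 assume v: "v < n" "nmem s2 14 0 0 = v" and s2: "frame {3, 14} {} s1 s2"
        and lab: "nmem s2 3 v 0 = nmem s1 3 v 0"
      have "nmem s2 5 = nmem s 5" "nmem s2 8 0 0 = k" "nmem s1 3 v 0 = nmem s 3 v 0"
        using repr(2)[OF s] by (simp_all add: frame_nmem[OF s1] frame_nmem[OF s2])
      then show "computes B ?upd s2
          (\<lambda>s'. nmem s' 3 v 0 = ?lab v \<and> (\<forall>i. i \<noteq> v \<longrightarrow> nmem s' 3 i 0 = nmem s2 3 i 0))"
        using v lab mark[OF v(1)]
        by (intro computes_Cond computes_store computes_Skip) (simp_all add: nmem_set_cell)
    qed (auto simp: le_B on_input(1) frame_on_input)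
    fix s2 assume lab: "\<forall>v<n. nmem s2 3 v 0 = ?lab v"
      and s2: "frame (nmods (For 14 N_vertices ?upd)) (rmods (For 14 N_vertices ?upd)) s1 s2"
    have cnt: "nmem s2 8 0 0 = k" "nmem s2 4 = nmem s1 4"
      using repr(2)[OF s] by (simp_all add: frame_nmem[OF s1] frame_nmem[OF s2])
    let ?f = "\<lambda>v. if v \<in> M then z else f v"
    \<comment> \<open>\<open>k\<close> is fresh among the labels, and by saturation \<open>z\<close>
      is not the image of an unmarked vertex, so both relabellings merge the same vertices.\<close>
    have ker: "?lab u = ?lab v \<longleftrightarrow> ?f u = ?f v" if "u < n" "v < n" for u v
    proof -
      have neq: "k \<noteq> nmem s 3 x 0" "x \<notin> M \<Longrightarrow> M \<noteq> {} \<Longrightarrow> z \<noteq> f x" if "x < n" for x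
        using repr(3)[OF s that] z sat[of _ x] that by auto
      show ?thesis
        using neq[OF that(1)] neq[OF that(2)] repr(4)[OF s that] by auto
    qed
    show "computes B (assign 8 (NPlus (var 8) (NConst 1))) s2 (\<lambda>s'. repr s' (Suc k) ?f ?A)"
    proof (rule conseq_rule)
      show "computes B (assign 8 (NPlus (var 8) (NConst 1))) s2 (\<lambda>s'. nmem s' 8 0 0 = Suc k)"
        using cnt by (intro computes_assign) (simp add: nmem_set_cell)
      fix s3 assume s3: "nmem s3 8 0 0 = Suc k"
        "frame (nmods (assign 8 (NPlus (var 8) (NConst 1)))) (rmods (assign 8 (NPlus (var 8) (NConst 1)))) s2 s3"
      have lab3: "nmem s3 3 v 0 = ?lab v" if "v < n" for v
        using lab that by (simp add: frame_nmem[OF s3(2)])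
      have alive3: "nmem s3 4 = nmem s1 4"
        using cnt by (simp add: frame_nmem[OF s3(2)])
      show "repr s3 (Suc k) ?f ?A"
        unfolding repr_def alive3
        using s3(1) frame_on_input[OF s3(2)] alive repr(5)[OF s] repr(3)[OF s] lab3 ker
        by (auto simp: less_Suc_eq)
    qed (use s2 in \<open>auto simp: frame_on_input\<close>)
  qed (use s1 in \<open>auto simp: frame_on_input\<close>)
qed (use s in \<open>auto simp: repr\<close>)

lemma computes_count_labels:
  assumes s: "repr s k f A" and k: "k \<le> B"
  shows "computes B count_labels s (\<lambda>s'. nmem s' 11 0 0 = card (f ` {..<n}))"
proof -
  let ?P = "\<lambda>x. \<exists>v<n. nmem s 3 v 0 = x"
  have "computes B count_labels s (\<lambda>s'. nmem s' 11 0 0 = card {x. x < k \<and> ?P x})"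
    unfolding count_labels_def
  proof (rule tally_rule[OF repr(1)[OF s], where M = "{10, 11, 14, 15}" and R = "{}"])
    fix x s1 assume x: "x < k" "nmem s1 14 0 0 = x" and s1: "frame {10, 11, 14, 15} {} s s1"
    let ?search = "search 10 15 N_vertices Skip (NEq (cell 3 (var 15)) (var 14))"
    have "computes B ?search s1 (\<lambda>s'. nmem s' 10 0 0 = of_bool (?P x))"
    proof (rule search_rule[OF frame_on_input[OF s1], where M = "{10, 15}" and R = "{}"])
      fix v s2 assume v: "v < n" "nmem s2 15 0 0 = v" and s2: "frame {10, 15} {} s1 s2"
      show "computes B Skip s2 (\<lambda>s'. bval (NEq (cell 3 (var 15)) (var 14)) s' \<longleftrightarrow> nmem s 3 v 0 = x)"
        using v x(2) by (intro computes_Skip) (simp add: frame_nmem[OF s1] frame_nmem[OF s2])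
    qed (auto simp: le_B on_input(1) frame_on_input)
    then show "computes B ?search s1 (\<lambda>s'. bval (NEq (var 10) (NConst 1)) s' \<longleftrightarrow> ?P x)"
      by (rule computes_conseq) simp
  next
    fix s1 assume "frame {10, 11, 14, 15} {} s s1"
    then show "nval (var 8) s1 = k" using repr(2)[OF s] by (simp add: frame_nmem)
  qed (use k in auto)
  moreover have "card {x. x < k \<and> ?P x} = card (f ` {..<n})"
  proof -
    let ?l = "\<lambda>v. nmem s 3 v 0"
    have "{x. x < k \<and> ?P x} = ?l ` {..<n}"
      using repr(3)[OF s] by auto
    \<comment> \<open>Labels and values of \<open>f\<close> both number the fibres: a value is sent
      to the label of any vertex in its fibre, here the one picked by
      \<open>inv_into\<close>.\<close>
    moreover have "bij_betw (\<lambda>x. ?l (inv_into {..<n} f x)) (f ` {..<n}) (?l ` {..<n})"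
    proof (rule bij_betwI')
      fix x y assume "x \<in> f ` {..<n}" "y \<in> f ` {..<n}"
      then show "?l (inv_into {..<n} f x) = ?l (inv_into {..<n} f y) \<longleftrightarrow> x = y"
        using repr(4)[OF s, of "inv_into {..<n} f x" "inv_into {..<n} f y"]
        by (metis f_inv_into_f inv_into_into lessThan_iff)
    next
      fix x assume "x \<in> f ` {..<n}"
      then show "?l (inv_into {..<n} f x) \<in> ?l ` {..<n}"
        by (metis image_eqI inv_into_into)
    next
      fix y assume "y \<in> ?l ` {..<n}"
      then obtain v where v: "v < n" "y = ?l v" by auto
      then have "inv_into {..<n} f (f v) < n" "f (inv_into {..<n} f (f v)) = f v"
        by (metis imageI inv_into_into lessThan_iff, simp add: f_inv_into_f)
      then have "y = ?l (inv_into {..<n} f (f v))"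
        using repr(4)[OF s, of "inv_into {..<n} f (f v)" v] v by simp
      then show "\<exists>x\<in>f ` {..<n}. y = ?l (inv_into {..<n} f x)"
        using v(1) by blast
    qed
    ultimately show ?thesis
      by (simp add: bij_betw_same_card)
  qed
  ultimately show ?thesis by simp
qed

lemma computes_sum_costs:
  assumes s: "repr s k f A"
  shows "computes B sum_costs s (\<lambda>s'. rmem s' 3 0 0 = sum c A)"
proof -
  have "computes B sum_costs s (\<lambda>s'. rmem s' 3 0 0 = sum c {e. e < m \<and> e \<in> A})"
    unfolding sum_costs_def
  proof (rule rsum_rule[OF repr(1)[OF s], where M = "{14}" and R = "{3}"])
    fix e s1 assume e: "e < m" "nmem s1 14 0 0 = e" and s1: "frame {14} {3} s s1"
    show "bval (NEq (cell 4 (var 14)) (NConst 1)) s1 \<longleftrightarrow> e \<in> A"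
      using e repr(6)[OF s e(1)] by (simp add: frame_nmem[OF s1])
    show "rval (RCell 0 (var 14) (NConst 0)) s1 = c e"
      using e on_input(6)[OF frame_on_input[OF s1]] by simp
  qed (auto simp: le_B on_input(2) frame_on_input)
  moreover have "{e. e < m \<and> e \<in> A} = A" using repr(5)[OF s] by auto
  ultimately show ?thesis by simp
qed

lemma computes_mark_chosen:
  assumes s: "repr s k f A" and e: "e < m" "nmem s 13 0 0 = e"
  shows "computes B mark_chosen s
    (\<lambda>s'. \<forall>v<n. nmem s' 5 v 0 = of_bool (v \<in> {v. v < n \<and> f v \<in> f ` ends G e}))"
  unfolding mark_chosen_def
proof (rule fill_rule[OF repr(1)[OF s], where M = "{5, 10, 14, 15}" and R = "{}"])
  fix v s1 assume v: "v < n" "nmem s1 14 0 0 = v" and s1: "frame {5, 10, 14, 15} {} s s1"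
  let ?search = "search 10 15 N_vertices Skip
         (Conj (NEq (NCell 1 (var 13) (var 15)) (NConst 1)) (NEq (cell 3 (var 15)) (cell 3 (var 14))))"
  let ?v = "v \<in> {v. v < n \<and> f v \<in> f ` ends G e}"
  have "computes B ?search s1 (\<lambda>s'. nmem s' 10 0 0 = of_bool (\<exists>u<n. u \<in> ends G e \<and> f u = f v))"
  proof (rule search_rule[OF frame_on_input[OF s1], where M = "{10, 15}" and R = "{}"])
    fix u s2 assume u: "u < n" "nmem s2 15 0 0 = u" and s2: "frame {10, 15} {} s1 s2"
    have "nmem s2 14 0 0 = v" "nmem s2 13 0 0 = e" "nmem s2 3 = nmem s 3"
      using v(2) e(2) by (simp_all add: frame_nmem[OF s1] frame_nmem[OF s2])
    then show "computes B Skip s2 (\<lambda>s'. bval (Conj (NEq (NCell 1 (var 13) (var 15)) (NConst 1))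
        (NEq (cell 3 (var 15)) (cell 3 (var 14)))) s' \<longleftrightarrow> u \<in> ends G e \<and> f u = f v)"
      using u v(1) e(1) on_input(5)[OF frame_on_input[OF s2], of e u] repr(4)[OF s u(1) v(1)]
      by (intro computes_Skip) simp
  qed (auto simp: le_B on_input(1) frame_on_input)
  moreover have "(\<exists>u<n. u \<in> ends G e \<and> f u = f v) \<longleftrightarrow> ?v"
    using v(1) ends_sub[OF e(1)] by (auto simp: image_iff) metis+
  ultimately have "computes B ?search s1 (\<lambda>s'. nmem s' 10 0 0 = of_bool ?v)"
    by simp
  then show "computes B (Seq ?search (store 5 (var 14) (var 10))) s1
      (\<lambda>s'. nmem s' 5 v 0 = of_bool ?v \<and> (\<forall>i. i \<noteq> v \<longrightarrow> nmem s' 5 i 0 = nmem s1 5 i 0))"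
  proof (rule Seq_rule)
    fix s2 assume s2: "nmem s2 10 0 0 = of_bool ?v" "frame (nmods ?search) (rmods ?search) s1 s2"
    have "nmem s2 14 0 0 = v" "nmem s2 5 = nmem s1 5" using v(2) by (simp_all add: frame_nmem[OF s2(2)])
    with s2(1) show "computes B (store 5 (var 14) (var 10)) s2
        (\<lambda>s'. nmem s' 5 v 0 = of_bool ?v \<and> (\<forall>i. i \<noteq> v \<longrightarrow> nmem s' 5 i 0 = nmem s1 5 i 0))"
      by (intro computes_store) (simp add: nmem_set_cell)
  qed (use s1 in \<open>auto simp: frame_on_input\<close>)
qed (auto simp: le_B on_input(1) frame_on_input)

lemma computes_write_cut:
  assumes s: "repr s k f A" and S: "\<And>x. x < k \<Longrightarrow> nmem s 7 x 0 = of_bool (x \<in> S)"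
  shows "computes B write_cut s (\<lambda>s'. output_cut G s' =
    {e \<in> A. (\<exists>v\<in>ends G e. nmem s 3 v 0 \<in> S) \<and> (\<exists>v\<in>ends G e. nmem s 3 v 0 \<notin> S)})"
    (is "computes _ _ _ (\<lambda>s'. _ = ?C)")
proof -
  let ?scan = "\<lambda>a x. search a 15 N_vertices Skip
       (Conj (NEq (NCell 1 (var 14) (var 15)) (NConst 1)) (NEq (cell 7 (cell 3 (var 15))) (NConst x)))"
  let ?w = "Cond (Conj (NEq (cell 4 (var 14)) (NConst 1)) (Conj (NEq (var 10) (NConst 1)) (NEq (var 12) (NConst 1))))
       (store 2 (var 14) (NConst 1)) (store 2 (var 14) (NConst 0))"
  have scan: "computes B (?scan a x) s1 (\<lambda>s'. nmem s' a 0 0 =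
      of_bool (\<exists>v\<in>ends G e. of_bool (nmem s 3 v 0 \<in> S) = x))"
    if e: "e < m" "nmem s1 14 0 0 = e" and s1: "frame {2, 10, 12, 14, 15} {} s s1" and a: "a \<in> {10, 12}"
    for a x e s1
  proof -
    have "computes B (?scan a x) s1 (\<lambda>s'. nmem s' a 0 0 =
        of_bool (\<exists>v<n. v \<in> ends G e \<and> of_bool (nmem s 3 v 0 \<in> S) = x))"
    proof (rule search_rule[OF frame_on_input[OF s1], where M = "{10, 12, 15}" and R = "{}"])
      fix v s2 assume v: "v < n" "nmem s2 15 0 0 = v" and s2: "frame {10, 12, 15} {} s1 s2"
      have "nmem s2 14 0 0 = e" "nmem s2 3 = nmem s 3" "nmem s2 7 = nmem s 7"
        using e(2) by (simp_all add: frame_nmem[OF s1] frame_nmem[OF s2])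
      then show "computes B Skip s2 (\<lambda>s'. bval (Conj (NEq (NCell 1 (var 14) (var 15)) (NConst 1))
          (NEq (cell 7 (cell 3 (var 15))) (NConst x))) s' \<longleftrightarrow>
          v \<in> ends G e \<and> of_bool (nmem s 3 v 0 \<in> S) = x)"
        using v e(1) S[OF repr(3)[OF s v(1)]] on_input(5)[OF frame_on_input[OF s2], of e v]
        by (intro computes_Skip) simp
    qed (use a in \<open>auto simp: le_B on_input(1) frame_on_input\<close>)
    moreover have "(\<exists>v<n. v \<in> ends G e \<and> of_bool (nmem s 3 v 0 \<in> S) = x) \<longleftrightarrow>
        (\<exists>v\<in>ends G e. of_bool (nmem s 3 v 0 \<in> S) = x)"
      using ends_sub[OF e(1)] by auto
    ultimately show ?thesis by simp
  qed
  have "computes B write_cut s (\<lambda>s'. \<forall>e<m. nmem s' 2 e 0 = of_bool (e \<in> ?C))"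
    unfolding write_cut_def
  proof (rule fill_rule[OF repr(1)[OF s], where M = "{2, 10, 12, 14, 15}" and R = "{}"])
    fix e s1 assume e: "e < m" "nmem s1 14 0 0 = e" and s1: "frame {2, 10, 12, 14, 15} {} s s1"
    show "computes B (Seq (?scan 10 1) (Seq (?scan 12 0) ?w)) s1
        (\<lambda>s'. nmem s' 2 e 0 = of_bool (e \<in> ?C) \<and> (\<forall>i. i \<noteq> e \<longrightarrow> nmem s' 2 i 0 = nmem s1 2 i 0))"
    proof (rule Seq_rule[OF scan[OF e s1]])
      fix s2 assume s2: "nmem s2 10 0 0 = of_bool (\<exists>v\<in>ends G e. of_bool (nmem s 3 v 0 \<in> S) = 1)"
        "frame (nmods (?scan 10 1)) (rmods (?scan 10 1)) s1 s2"
      have e2: "nmem s2 14 0 0 = e" using e(2) by (simp add: frame_nmem[OF s2(2)])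
      have s2': "frame {2, 10, 12, 14, 15} {} s s2"
        using s1 s2(2) by (auto simp: frame_def agree_off_def)
      show "computes B (Seq (?scan 12 0) ?w) s2
          (\<lambda>s'. nmem s' 2 e 0 = of_bool (e \<in> ?C) \<and> (\<forall>i. i \<noteq> e \<longrightarrow> nmem s' 2 i 0 = nmem s1 2 i 0))"
      proof (rule Seq_rule[OF scan[OF e(1) e2 s2']])
        fix s3 assume s3: "nmem s3 12 0 0 = of_bool (\<exists>v\<in>ends G e. of_bool (nmem s 3 v 0 \<in> S) = 0)"
          "frame (nmods (?scan 12 0)) (rmods (?scan 12 0)) s2 s3"
        have "nmem s3 14 0 0 = e" "nmem s3 4 = nmem s 4" "nmem s3 10 0 0 = nmem s2 10 0 0"
          "nmem s3 2 = nmem s1 2"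
          using e(2) by (simp_all add: frame_nmem[OF s3(2)] frame_nmem[OF s2(2)] frame_nmem[OF s1])
        with s2(1) s3(1) repr(6)[OF s e(1)] show "computes B ?w s3
            (\<lambda>s'. nmem s' 2 e 0 = of_bool (e \<in> ?C) \<and> (\<forall>i. i \<noteq> e \<longrightarrow> nmem s' 2 i 0 = nmem s1 2 i 0))"
          by (intro computes_Cond computes_store) (auto simp: nmem_set_cell)
      qed (use s2' in \<open>auto simp: frame_on_input\<close>)
    qed (use s1 in \<open>auto simp: frame_on_input\<close>)
  qed (auto simp: le_B on_input(2) frame_on_input)
  then show ?thesis
  proof (rule computes_conseq)
    fix s' :: state assume "\<forall>e<m. nmem s' 2 e 0 = of_bool (e \<in> ?C)"
    then have "output_cut G s' = {e. e < m \<and> e \<in> ?C}"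
      unfolding output_cut_def G by auto
    also have "\<dots> = ?C"
      using repr(5)[OF s] by blast
    finally show "output_cut G s' = ?C" .
  qed
qed

lemma implements_frame:
  assumes "implements B p s \<mu> Q" "on_input s" "nmods p \<subseteq> {2..}" "rmods p \<subseteq> {3..}"
  shows "implements B p s \<mu> (\<lambda>s' a. Q s' a \<and> frame (nmods p) (rmods p) s s')"
  using implements_agree[OF assms(1)]
  by (rule implements_conseq) (auto intro!: frameI[OF assms(2) _ subset_refl subset_refl assms(3,4)])

lemma implements_Seq_rule:
  assumes "computes B p s P" "on_input s" "nmods p \<subseteq> {2..}" "rmods p \<subseteq> {3..}"
    and "\<And>s'. P s' \<Longrightarrow> frame (nmods p) (rmods p) s s' \<Longrightarrow> implements B q s' \<mu> Q"
  shows "implements B (Seq p q) s \<mu> Q"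
  using assms(1) by (rule implements_computes_Seq) (rule assms(5) frameI[OF assms(2) _ subset_refl subset_refl assms(3,4)] | assumption)+

lemma output_cut_set_cell: "a \<noteq> 2 \<Longrightarrow> output_cut G (set_cell a i v s) = output_cut G s"
  by (simp add: output_cut_def)

lemma implements_choose_side:
  assumes s: "repr s k f A" and k: "k \<le> B"
  shows "implements B choose_side s (pmf_of_set (Pow {..<k}))
    (\<lambda>s' S. \<forall>x<k. nmem s' 7 x 0 = of_bool (x \<in> S))"
proof -
  \<comment> \<open>The inclusion in \<open>{..<j}\<close> ensures that \<open>j\<close> is absent
    when the coin leaves \<open>S\<close> unchanged and 0 is stored.\<close>
  let ?I = "\<lambda>j (s :: state) S. S \<subseteq> {..<j} \<and> (\<forall>x<j. nmem s 7 x 0 = of_bool (x \<in> S))"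
  let ?p = "Coin (RDivide (RConst 1) (RConst 2)) (store 7 (var 14) (NConst 1)) (store 7 (var 14) (NConst 0))"
  have "implements B (For 14 (var 8) ?p) s (iterate subset_kernel 0 k {}) (?I k)"
  proof (rule implements_For)
    fix j s1 S assume j: "j < k" "nmem s1 14 0 0 = j" and S: "?I j s1 S"
    let ?Q = "\<lambda>s' S. ?I (Suc j) (set_cell 14 0 (Suc j) s') S"
    have "implements B ?p s1 (bind_pmf (bernoulli_pmf (rval (RDivide (RConst 1) (RConst 2)) s1))
        (\<lambda>h. return_pmf (if h then insert j S else S))) ?Q"
      using j S
      by (intro implements_Coin)
         (auto intro!: computes_store simp: implements_return nmem_set_cell less_Suc_eq subset_iff)
    then show "implements B ?p s1 (subset_kernel j S) ?Q"
      by (simp add: subset_kernel_def)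
  next
    fix s1 assume "agree_off (insert 14 (nmods ?p)) (rmods ?p) s s1"
    then show "nval (var 8) s1 = k"
      using repr(2)[OF s] by (simp add: agree_off_def)
  qed (use k in auto)
  then show ?thesis
    unfolding choose_side_def iterate_subset_kernel by (rule implements_conseq) simp
qed

text \<open>\<open>h\<close> sends a label in use to the vertex of \<open>H\<close> it stands for. A
  uniform set of issued labels, restricted to \<open>L\<close> and mapped by \<open>h\<close>, is a
  uniform set of vertices of \<open>H\<close>, and its cut \<open>C S\<close> can be read off the
  labels of original ends.\<close>

lemma implements_stop:
  assumes s: "repr s k f A" and q: "vertex_quotient G t w f A H w'" and k: "k \<le> B"
  shows "implements B (Seq choose_side (Seq write_cut (assign 9 (NConst 1)))) s
    (map_spmf (cut H) (spmf_of_set (Pow (verts H))))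
    (\<lambda>s' a. nmem s' 9 0 0 = 1 \<and> a = Some (output_cut G s'))"
proof -
  let ?l = "\<lambda>v. nmem s 3 v 0"
  define L where "L = ?l ` {..<n}"
  define h where "h = (\<lambda>x. f (inv_into {..<n} ?l x))"
  define C where "C = (\<lambda>S. {e \<in> A. (\<exists>v\<in>ends G e. ?l v \<in> S) \<and> (\<exists>v\<in>ends G e. ?l v \<notin> S)})"
  have L: "L \<subseteq> {..<k}" using repr(3)[OF s] by (auto simp: L_def)
  have h: "h (?l v) = f v" if v: "v < n" for v
  proof -
    have "inv_into {..<n} ?l (?l v) < n" "?l (inv_into {..<n} ?l (?l v)) = ?l v"
      using v inv_into_into[of "?l v" ?l "{..<n}"] f_inv_into_f[of "?l v" ?l "{..<n}"] by auto
    then show ?thesis using repr(4)[OF s _ v] by (simp add: h_def)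
  qed
  have inj: "inj_on h L"
    by (rule inj_onI) (use repr(4)[OF s] in \<open>auto simp: L_def h\<close>)
  have H: "verts H = f ` {..<n}" "hedges H = A" "\<And>e. e \<in> A \<Longrightarrow> ends H e = f ` ends G e"
    using q by (auto simp: vertex_quotient_def G)
  have hL: "h ` L = verts H" by (auto simp: L_def H h image_iff intro!: bexI)
  have mem: "f v \<in> h ` (S \<inter> L) \<longleftrightarrow> ?l v \<in> S" if v: "v < n" for v S
  proof
    assume "f v \<in> h ` (S \<inter> L)"
    then obtain u where "u < n" "?l u \<in> S" "f v = h (?l u)" by (auto simp: L_def)
    then show "?l v \<in> S" using repr(4)[OF s v] h by metis
  next
    assume "?l v \<in> S"
    then have "?l v \<in> S \<inter> L" using v by (simp add: L_def)
    then show "f v \<in> h ` (S \<inter> L)" using h[OF v] by (metis imageI)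
  qed
  have cut: "cut H (h ` (S \<inter> L)) = C S" for S
  proof -
    have "ends H e \<inter> h ` (S \<inter> L) \<noteq> {} \<longleftrightarrow> (\<exists>v\<in>ends G e. ?l v \<in> S)"
      "ends H e \<inter> (verts H - h ` (S \<inter> L)) \<noteq> {} \<longleftrightarrow> (\<exists>v\<in>ends G e. ?l v \<notin> S)" if "e \<in> A" for e
    proof -
      have e: "v < n" if "v \<in> ends G e" for v
        using that \<open>e \<in> A\<close> repr(5)[OF s] ends_sub[of e] by auto
      have "ends H e \<inter> h ` (S \<inter> L) \<noteq> {} \<longleftrightarrow> (\<exists>v\<in>ends G e. f v \<in> h ` (S \<inter> L))"
        unfolding H(3)[OF \<open>e \<in> A\<close>] by blast
      then show "ends H e \<inter> h ` (S \<inter> L) \<noteq> {} \<longleftrightarrow> (\<exists>v\<in>ends G e. ?l v \<in> S)"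
        using mem e by simp
      have "ends H e \<inter> (verts H - h ` (S \<inter> L)) \<noteq> {} \<longleftrightarrow> (\<exists>v\<in>ends G e. f v \<notin> h ` (S \<inter> L))"
        unfolding H(3)[OF \<open>e \<in> A\<close>] H(1) using e by blast
      then show "ends H e \<inter> (verts H - h ` (S \<inter> L)) \<noteq> {} \<longleftrightarrow> (\<exists>v\<in>ends G e. ?l v \<notin> S)"
        using mem e by simp
    qed
    then show ?thesis unfolding cut_def C_def H(2) by blast
  qed
  have "map_spmf (cut H) (spmf_of_set (Pow (verts H))) =
      map_pmf (\<lambda>S. Some (cut H S)) (pmf_of_set (Pow (verts H)))"
    unfolding spmf_of_pmf_pmf_of_set[symmetric, OF _ Pow_not_empty] H
    by (subst spmf_of_pmf_pmf_of_set[symmetric])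
       (auto simp: map_spmf_of_pmf spmf_of_pmf_def pmf.map_comp o_def)
  also have "pmf_of_set (Pow (verts H)) = map_pmf (\<lambda>S. h ` (S \<inter> L)) (pmf_of_set (Pow {..<k}))"
    using map_pmf_of_set_Pow[OF _ L inj] by (simp add: hL)
  finally have alg: "map_spmf (cut H) (spmf_of_set (Pow (verts H))) =
      bind_pmf (pmf_of_set (Pow {..<k})) (\<lambda>S. return_pmf (Some (C S)))"
    by (simp add: pmf.map_comp o_def cut map_pmf_def bind_return_pmf bind_assoc_pmf)
  show ?thesis
    unfolding alg
  proof (rule implements_Seq, rule implements_conseq)
    show "implements B choose_side s (pmf_of_set (Pow {..<k}))
       (\<lambda>s' S. (\<forall>x<k. nmem s' 7 x 0 = of_bool (x \<in> S)) \<and>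
         frame (nmods choose_side) (rmods choose_side) s s')"
      by (rule implements_frame[OF implements_choose_side[OF s k] repr(1)[OF s]]) auto
    fix s1 S assume s1: "(\<forall>x<k. nmem s1 7 x 0 = of_bool (x \<in> S)) \<and>
         frame (nmods choose_side) (rmods choose_side) s s1"
    then have r1: "repr s1 k f A" by (intro repr_frame[OF s]) auto
    have l: "nmem s1 3 = nmem s 3" using s1 by (auto simp: frame_nmem)
    have "computes B write_cut s1 (\<lambda>s'. output_cut G s' = C S)"
      using computes_write_cut[OF r1, of S, unfolded l] s1 unfolding C_def by blast
    then show "implements B (Seq write_cut (assign 9 (NConst 1))) s1 (return_pmf (Some (C S)))
        (\<lambda>s' a. nmem s' 9 0 0 = 1 \<and> a = Some (output_cut G s'))"
      unfolding implements_return
      by (rule computes_Seq, intro computes_assign)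
         (simp add: nmem_set_cell output_cut_set_cell)
  qed
qed

lemma implements_choose_hedge:
  assumes s: "repr s k f A" and sum: "rmem s 3 0 0 = sum c A" and A: "A \<noteq> {}" and H: "hedges H = A"
  shows "implements B choose_hedge s (random_hedge H c)
    (\<lambda>s' z. \<exists>e\<in>A. z = Some e \<and> nmem s' 13 0 0 = e)"
proof -
  let ?x = "RDivide (RCell 0 (var 14) (NConst 0)) (rvar 4)"
  let ?pick = "Seq (assign 12 (NConst 1)) (assign 13 (var 14))"
  let ?pass = "rassign 4 (RMinus (rvar 4) (RCell 0 (var 14) (NConst 0)))"
  let ?p = "Cond (Conj (NEq (cell 4 (var 14)) (NConst 1)) (NEq (var 12) (NConst 0))) (Coin ?x ?pick ?pass) Skip"
  let ?S = "\<lambda>j. sum c {e \<in> A. j \<le> e}"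
  \<comment> \<open>After a choice nothing is required of the remaining cost, as the flag in array
    12 makes the later passes idle.\<close>
  let ?I = "\<lambda>j (s :: state) z. case z of
      None \<Rightarrow> nmem s 12 0 0 = 0 \<and> rmem s 4 0 0 = ?S j
    | Some e \<Rightarrow> nmem s 12 0 0 = 1 \<and> nmem s 13 0 0 = e \<and> e \<in> A"
  have fin: "finite A" using repr(5)[OF s] by (rule finite_subset) simp
  have cA: "0 < c e" if "e \<in> A" for e using repr(5)[OF s] that cpos by auto
  have loop: "implements B (For 14 N_hedges ?p) s1 (random_hedge H c)
      (\<lambda>s' z. \<exists>e\<in>A. z = Some e \<and> nmem s' 13 0 0 = e)"
    if s1: "on_input s1" "nmem s1 4 = nmem s 4" "nmem s1 12 0 0 = 0" "rmem s1 4 0 0 = sum c A" for s1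
  proof -
    have "implements B (For 14 N_hedges ?p) s1 (iterate (choice_kernel c A) 0 m None) (?I m)"
    proof (rule implements_For)
      fix j s2 z assume j: "j < m" "nmem s2 14 0 0 = j" and I: "?I j s2 z"
        and "agree_off (insert 14 (nmods ?p)) (rmods ?p) s1 s2"
      then have s2: "frame {12, 13, 14} {4} s1 s2"
        by (intro frameI[OF s1(1)]) auto
      have alive: "nmem s2 4 j 0 = of_bool (j \<in> A)"
        using s1(2) repr(6)[OF s j(1)] by (simp add: frame_nmem[OF s2])
      have cj: "rmem s2 0 j 0 = c j"
        using on_input(6)[OF frame_on_input[OF s2] j(1)] .
      have step: "?S j = (if j \<in> A then c j else 0) + ?S (Suc j)"
      proof (cases "j \<in> A")
        case True
        then have "{e \<in> A. j \<le> e} = insert j {e \<in> A. Suc j \<le> e}" by auto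
        then show ?thesis using True fin by simp
      next
        case False
        then have "{e \<in> A. j \<le> e} = {e \<in> A. Suc j \<le> e}" by (auto simp: Suc_le_eq le_less)
        then show ?thesis using False by simp
      qed
      have S: "0 \<le> ?S (Suc j)" using cA by (intro sum_nonneg) (auto simp: less_imp_le)
      let ?Q = "\<lambda>s' z'. ?I (Suc j) (set_cell 14 0 (Suc j) s') z'"
      show "implements B ?p s2 (choice_kernel c A j z) ?Q"
      proof (rule implements_Cond)
        assume "bval (Conj (NEq (cell 4 (var 14)) (NConst 1)) (NEq (var 12) (NConst 0))) s2"
        then have z: "j \<in> A" "z = None" "rmem s2 4 0 0 = ?S j"
          using I j(2) alive by (auto split: option.splits)
        have x: "rval ?x s2 = c j / ?S j" using j(2) cj z(3) by simp
        have "implements B (Coin ?x ?pick ?pass) s2 (bind_pmf (bernoulli_pmf (rval ?x s2))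
            (\<lambda>h. return_pmf (if h then Some j else None))) ?Q"
        proof (rule implements_Coin)
          show "0 \<le> rval ?x s2" "rval ?x s2 \<le> 1"
            unfolding x using step z(1) S cA[of j] by (auto simp: divide_le_eq_1)
          show "implements B ?pick s2 (return_pmf (if True then Some j else None)) ?Q"
            unfolding implements_return
            by (rule computes_Seq[where P = "\<lambda>s. nmem s 12 0 0 = 1 \<and> nmem s 14 0 0 = j"])
               (auto intro!: computes_assign simp: nmem_set_cell j(2) z(1))
          show "implements B ?pass s2 (return_pmf (if False then Some j else None)) ?Q"
            unfolding implements_return using I z step cj j(2)
            by (auto intro!: computes_rassign)
        qed
        moreover have "choice_kernel c A j z = bind_pmf (bernoulli_pmf (rval ?x s2))
            (\<lambda>h. return_pmf (if h then Some j else None))"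
          unfolding x using z by (simp add: choice_kernel_def)
        ultimately show "implements B (Coin ?x ?pick ?pass) s2 (choice_kernel c A j z) ?Q"
          by (simp only:)
      next
        assume "\<not> bval (Conj (NEq (cell 4 (var 14)) (NConst 1)) (NEq (var 12) (NConst 0))) s2"
        then have "\<not> (z = None \<and> j \<in> A)"
          using I j(2) alive by auto
        then show "implements B Skip s2 (choice_kernel c A j z) ?Q"
          using I step by (auto simp: choice_kernel_def nmem_set_cell intro!: implements_Skip split: option.splits)
      qed
    next
      fix s2 assume "agree_off (insert 14 (nmods ?p)) (rmods ?p) s1 s2"
      then have "frame {12, 13, 14} {4} s1 s2"
        by (intro frameI[OF s1(1)]) auto
      then show "nval N_hedges s2 = m" by (simp add: on_input(2) frame_on_input)
    qed (use s1 le_B in \<open>auto simp: nmem_set_cell\<close>)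
    moreover have "iterate (choice_kernel c A) 0 m None = random_hedge H c"
      using repr(5)[OF s] A cA H by (intro iterate_choice_kernel) auto
    ultimately have "implements B (For 14 N_hedges ?p) s1 (random_hedge H c) (?I m)" by simp
    \<comment> \<open>No mass is lost, so the loop cannot end without a chosen hyperedge.\<close>
    moreover have "None \<notin> set_pmf (random_hedge H c)"
      using spmf_random_hedge(2)[of H c] fin A cA H by (simp add: lossless_iff_set_pmf_None)
    ultimately show ?thesis
      by (elim implements_conseq) (auto split: option.splits)
  qed
  show ?thesis
    unfolding choose_hedge_def
  proof (rule implements_Seq_rule[where P = "\<lambda>s'. nmem s' 12 0 0 = 0"])
    show "computes B (assign 12 (NConst 0)) s (\<lambda>s'. nmem s' 12 0 0 = 0)"
      by (rule computes_assign) (simp add: nmem_set_cell)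
    fix s1 assume s1: "nmem s1 12 0 0 = 0" "frame (nmods (assign 12 (NConst 0))) (rmods (assign 12 (NConst 0))) s s1"
    show "implements B (Seq (rassign 4 (rvar 3)) (For 14 N_hedges ?p)) s1 (random_hedge H c)
        (\<lambda>s' z. \<exists>e\<in>A. z = Some e \<and> nmem s' 13 0 0 = e)"
    proof (rule implements_Seq_rule[where P = "\<lambda>s'. rmem s' 4 0 0 = sum c A"])
      show "computes B (rassign 4 (rvar 3)) s1 (\<lambda>s'. rmem s' 4 0 0 = sum c A)"
        using sum by (intro computes_rassign) (simp add: frame_rmem[OF s1(2)])
      fix s2 assume s2: "rmem s2 4 0 0 = sum c A"
        "frame (nmods (rassign 4 (rvar 3))) (rmods (rassign 4 (rvar 3))) s1 s2"
      then show "implements B (For 14 N_hedges ?p) s2 (random_hedge H c)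
          (\<lambda>s' z. \<exists>e\<in>A. z = Some e \<and> nmem s' 13 0 0 = e)"
        using s1(1) by (intro loop) (simp_all add: frame_on_input[OF s2(2)] frame_nmem[OF s2(2)] frame_nmem[OF s1(2)])
    qed (use s1 in \<open>auto simp: frame_on_input\<close>)
  qed (use s in \<open>auto simp: repr\<close>)
qed

text \<open>The new map is hidden behind an existential; later steps know it only through
  \<open>repr\<close> and \<open>vertex_quotient\<close>.\<close>

lemma computes_contract_marked:
  assumes s: "repr s k f A" and q: "vertex_quotient G t w f A H w'"
    and mark: "\<And>v. v < n \<Longrightarrow> nmem s 5 v 0 = of_bool (v \<in> M)" and M: "M \<subseteq> {..<n}"
    and sat: "\<And>u v. u \<in> M \<Longrightarrow> v < n \<Longrightarrow> f u = f v \<Longrightarrow> v \<in> M"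
  shows "computes B merge_marked s (\<lambda>s'. \<exists>f'.
      repr s' (Suc k) f' {e \<in> A. \<not> ends G e \<subseteq> M} \<and>
      vertex_quotient G t w f' {e \<in> A. \<not> ends G e \<subseteq> M} (contract (f ` M) H) (contract_weights (f ` M) w'))"
proof (rule computes_conseq)
  show "computes B merge_marked s (\<lambda>s'. repr s' (Suc k) (\<lambda>v. if v \<in> M then merged (f ` M) else f v)
      {e \<in> A. \<not> ends G e \<subseteq> M})"
    by (rule computes_merge_marked[OF s mark M]) (auto intro: merged_in sat)
  have "vertex_quotient G t w (\<lambda>v. if v \<in> M then merged (f ` M) else f v) {e \<in> A. \<not> ends G e \<subseteq> M}
    (contract (f ` M) H) (contract_weights (f ` M) w')"
    using M sat by (intro vertex_quotient_contract[OF G(1) q]) (auto simp: G(2))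
  then show "\<exists>f'. repr s' (Suc k) f' {e \<in> A. \<not> ends G e \<subseteq> M} \<and>
      vertex_quotient G t w f' {e \<in> A. \<not> ends G e \<subseteq> M} (contract (f ` M) H) (contract_weights (f ` M) w')"
    if "repr s' (Suc k) (\<lambda>v. if v \<in> M then merged (f ` M) else f v) {e \<in> A. \<not> ends G e \<subseteq> M}" for s'
    using that by blast
qed

lemma computes_contract_infeasible:
  assumes s: "repr s k f A" and q: "vertex_quotient G t w f A H w'"
    and U: "U = infeasible_verts H t w' b"
  shows "computes B (Seq mark_infeasible merge_marked) s (\<lambda>s'. \<exists>f' A'. A' \<subseteq> A \<and>
      repr s' (Suc k) f' A' \<and> vertex_quotient G t w f' A' (contract U H) (contract_weights U w'))"
proof (rule Seq_rule[OF computes_mark_infeasible])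
  define M where "M = {v. v < n \<and> (\<exists>i\<in>{1..t}. b i < sum (w i) {u. u < n \<and> f u = f v})}"
  have U': "U = f ` M"
    using vertex_quotient_infeasible[OF q, of b] by (simp add: U M_def G(2))
  fix s1 assume mark: "\<forall>v<n. nmem s1 5 v 0 =
      of_bool (\<exists>i<t. b (Suc i) < sum (w (Suc i)) {u. u < n \<and> nmem s 3 u 0 = nmem s 3 v 0})"
    and fr: "frame (nmods mark_infeasible) (rmods mark_infeasible) s s1"
  have s1: "repr s1 k f A" by (rule repr_frame[OF s fr]) auto
  have idx: "(\<exists>i<t. P (Suc i)) \<longleftrightarrow> (\<exists>i\<in>{1..t}. P i)" for P
  proof
    assume "\<exists>i\<in>{1..t}. P i"
    then obtain i where "i \<in> {1..t}" "P i" by blast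
    then show "\<exists>i<t. P (Suc i)" by (intro exI[of _ "i - 1"]) auto
  qed auto
  have mark1: "nmem s1 5 v 0 = of_bool (v \<in> M)" if v: "v < n" for v
  proof -
    have "{u. u < n \<and> nmem s 3 u 0 = nmem s 3 v 0} = {u. u < n \<and> f u = f v}"
      using repr(4)[OF s _ v] by auto
    with mark v show ?thesis by (simp add: M_def idx[of "\<lambda>i. b i < sum (w i) {u. u < n \<and> f u = f v}"])
  qed
  have "computes B merge_marked s1 (\<lambda>s'. \<exists>f'.
      repr s' (Suc k) f' {e \<in> A. \<not> ends G e \<subseteq> M} \<and>
      vertex_quotient G t w f' {e \<in> A. \<not> ends G e \<subseteq> M} (contract U H) (contract_weights U w'))"
    unfolding U' by (rule computes_contract_marked[OF s1 q mark1]) (auto simp: M_def)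
  then show "computes B merge_marked s1 (\<lambda>s'. \<exists>f' A'. A' \<subseteq> A \<and>
      repr s' (Suc k) f' A' \<and> vertex_quotient G t w f' A' (contract U H) (contract_weights U w'))"
    by (rule computes_conseq) (elim exE conjE, rule exI, rule exI[of _ "{e \<in> A. \<not> ends G e \<subseteq> M}"], intro conjI, auto)
qed (use s in \<open>auto simp: repr\<close>)

lemma computes_contract_chosen:
  assumes s: "repr s k f A" and q: "vertex_quotient G t w f A H w'"
    and e: "e \<in> A" "nmem s 13 0 0 = e"
  shows "computes B (Seq mark_chosen merge_marked) s (\<lambda>s'. \<exists>f' A'. A' \<subset> A \<and>
      repr s' (Suc k) f' A' \<and>
      vertex_quotient G t w f' A' (contract (ends H e) H) (contract_weights (ends H e) w'))"
proof (rule Seq_rule)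
  have em: "e < m" using e(1) repr(5)[OF s] by auto
  show "computes B mark_chosen s
      (\<lambda>s'. \<forall>v<n. nmem s' 5 v 0 = of_bool (v \<in> {v. v < n \<and> f v \<in> f ` ends G e}))"
    by (rule computes_mark_chosen[OF s em e(2)])
  let ?M = "{v. v < n \<and> f v \<in> f ` ends G e}"
  have ends: "ends G e \<subseteq> ?M" using ends_sub[OF em] by auto
  then have U: "ends H e = f ` ?M"
    using q e(1) by (auto simp: vertex_quotient_def)
  fix s1 assume mark: "\<forall>v<n. nmem s1 5 v 0 = of_bool (v \<in> ?M)"
    and fr: "frame (nmods mark_chosen) (rmods mark_chosen) s s1"
  have s1: "repr s1 k f A" by (rule repr_frame[OF s fr]) auto
  have "computes B merge_marked s1 (\<lambda>s'. \<exists>f'.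
      repr s' (Suc k) f' {e \<in> A. \<not> ends G e \<subseteq> ?M} \<and>
      vertex_quotient G t w f' {e \<in> A. \<not> ends G e \<subseteq> ?M} (contract (ends H e) H) (contract_weights (ends H e) w'))"
    unfolding U using mark by (intro computes_contract_marked[OF s1 q]) auto
  \<comment> \<open>All ends of the chosen hyperedge are marked, so it is deleted. This strictness
    bounds the number of rounds.\<close>
  moreover have "{e \<in> A. \<not> ends G e \<subseteq> ?M} \<subset> A"
    using ends e(1) by blast
  ultimately show "computes B merge_marked s1 (\<lambda>s'. \<exists>f' A'. A' \<subset> A \<and>
      repr s' (Suc k) f' A' \<and>
      vertex_quotient G t w f' A' (contract (ends H e) H) (contract_weights (ends H e) w'))"
    by (elim computes_conseq) (elim exE conjE, rule exI, rule exI[of _ "{e \<in> A. \<not> ends G e \<subseteq> ?M}"], intro conjI)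
qed (use s in \<open>auto simp: repr\<close>)

section \<open>The main loop\<close>

text \<open>The premise \<open>branch\<close> acts as a continuation from the point where the round
  decides whether to stop. Thus one analysis of the common prefix serves both outcomes, although
  their ghost distributions differ.\<close>

lemma implements_round:
  assumes s: "repr s k f A" and q: "vertex_quotient G t w f A H w'" and k: "Suc k \<le> B"
    and U: "U = infeasible_verts H t w' b"
    and branch: "\<And>s' f' A'. A' \<subseteq> A \<Longrightarrow> repr s' (Suc k) f' A' \<Longrightarrow>
      vertex_quotient G t w f' A' (contract U H) (contract_weights U w') \<Longrightarrow>
      rmem s' 3 0 0 = sum c A' \<Longrightarrow> nmem s' 9 = nmem s 9 \<Longrightarrow>
      implements B (if card (verts (contract U H)) \<le> r + 1 \<or> A' = {}
        then Seq choose_side (Seq write_cut (assign 9 (NConst 1)))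
        else Seq choose_hedge (Seq mark_chosen merge_marked)) s' \<mu> Q"
  shows "implements B round s \<mu> Q"
  unfolding round_def
proof (rule implements_Seq_rule[OF computes_contract_infeasible[OF s q U]])
  let ?H = "contract U H" and ?w = "contract_weights U w'"
  let ?stop = "Seq choose_side (Seq write_cut (assign 9 (NConst 1)))"
  let ?go = "Seq choose_hedge (Seq mark_chosen merge_marked)"
  let ?g = "Conj (Neg (NLe (var 11) (NPlus N_rank (NConst 1)))) (Neg (RLe (rvar 3) (RConst 0)))"
  fix s1 assume "\<exists>f' A'. A' \<subseteq> A \<and> repr s1 (Suc k) f' A' \<and> vertex_quotient G t w f' A' ?H ?w"
  then obtain f1 A1 where s1: "A1 \<subseteq> A" "repr s1 (Suc k) f1 A1" "vertex_quotient G t w f1 A1 ?H ?w"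
    by blast
  assume fr1: "frame (nmods (Seq mark_infeasible merge_marked)) (rmods (Seq mark_infeasible merge_marked)) s s1"
  have verts: "verts ?H = f1 ` {..<n}"
    using s1(3) by (simp add: vertex_quotient_def G(2))
  show "implements B (Seq count_labels (Seq sum_costs (Cond ?g ?go ?stop))) s1 \<mu> Q"
  proof (rule implements_Seq_rule[OF computes_count_labels[OF s1(2) k]])
    fix s2 assume num: "nmem s2 11 0 0 = card (f1 ` {..<n})"
      and fr2: "frame (nmods count_labels) (rmods count_labels) s1 s2"
    have s2: "repr s2 (Suc k) f1 A1" by (rule repr_frame[OF s1(2) fr2]) auto
    show "implements B (Seq sum_costs (Cond ?g ?go ?stop)) s2 \<mu> Q"
    proof (rule implements_Seq_rule[OF computes_sum_costs[OF s2]])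
      fix s3 assume total: "rmem s3 3 0 0 = sum c A1"
        and fr3: "frame (nmods sum_costs) (rmods sum_costs) s2 s3"
      have s3: "repr s3 (Suc k) f1 A1" by (rule repr_frame[OF s2 fr3]) auto
      have fin: "finite A1" using repr(5)[OF s3] by (rule finite_subset) simp
      have cA: "0 < c e" if "e \<in> A1" for e using repr(5)[OF s3] that cpos by auto
      have "sum c A1 \<le> 0 \<longleftrightarrow> A1 = {}"
      proof
        assume "sum c A1 \<le> 0"
        then show "A1 = {}" using sum_pos[OF fin _ cA] by fastforce
      qed simp
      moreover have "nmem s3 11 0 0 = card (verts ?H)"
        using num by (simp add: verts frame_nmem[OF fr3])
      ultimately have g: "bval ?g s3 \<longleftrightarrow> \<not> (card (verts ?H) \<le> r + 1 \<or> A1 = {})"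
        using total on_input(3)[OF frame_on_input[OF fr3]] by simp
      have "nmem s3 9 = nmem s 9"
        by (simp add: frame_nmem[OF fr1] frame_nmem[OF fr2] frame_nmem[OF fr3])
      from branch[OF s1(1) s3 s1(3) total this] g
      show "implements B (Cond ?g ?go ?stop) s3 \<mu> Q"
        by (intro implements_Cond) (auto split: if_splits)
    qed (use fr2 in \<open>auto simp: frame_on_input\<close>)
  qed (use fr1 in \<open>auto simp: frame_on_input\<close>)
qed (use s in \<open>auto simp: repr\<close>)

text \<open>The induction follows the recursion of \<open>alg_N\<close>: a round that goes on
  removes a hyperedge and issues two labels, so \<open>k + 2 * card A\<close> does not grow and the
  labels stay within \<open>B\<close>.\<close>

lemma implements_loop:
  assumes "repr s k f A" "vertex_quotient G t w f A H w'" "nmem s 9 0 0 = 0"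
    and "k + 2 * card A \<le> n + 2 * m" "card A + 2 \<le> j"
  shows "implements_while B j (NEq (var 9) (NConst 0)) round s (alg_N H r t w' c b)
    (\<lambda>s' a. a = Some (output_cut G s'))"
  using assms
proof (induction "card A" arbitrary: s k f A H w' j rule: less_induct)
  case less
  note s = less.prems(1) and q = less.prems(2)
  let ?g = "NEq (var 9) (NConst 0)" and ?Q = "\<lambda>s' a. a = Some (output_cut G s')"
  obtain j' where j: "j = Suc j'" "card A + 1 \<le> j'"
    using less.prems(5) by (cases j) auto
  have g: "bval ?g s" using less.prems(3) by simp
  have k: "Suc k \<le> B" using less.prems(4) by (simp add: B input_size_def n m)
  define U where "U = infeasible_verts H t w' b"
  define H1 where "H1 = contract U H"
  define w1 where "w1 = contract_weights U w'"
  note round = implements_round[OF s q k U_def, folded H1_def w1_def]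
  have alg: "alg_N H r t w' c b =
     (if card (verts H1) \<le> r + 1 \<or> hedges H1 = {}
      then map_spmf (cut H1) (spmf_of_set (Pow (verts H1)))
      else bind_spmf (random_hedge H1 c)
             (\<lambda>e. alg_N (contract (ends H1 e) H1) r t (contract_weights (ends H1 e) w1) c b))"
    by (subst alg_N.simps) (simp add: U_def H1_def w1_def Let_def)
  show ?case
  proof (cases "card (verts H1) \<le> r + 1 \<or> hedges H1 = {}")
    case True
    let ?\<mu> = "map_spmf (cut H1) (spmf_of_set (Pow (verts H1)))"
    \<comment> \<open>The continuation is \<open>return_pmf\<close>: the stop flag is now 1, so the
      next test leaves the loop with the result unchanged.\<close>
    have "implements B round s ?\<mu> (\<lambda>s' a. implements_while B j' ?g round s' (return_pmf a) ?Q)"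
    proof (rule round)
      fix s1 f1 A1 assume s1: "repr s1 (Suc k) f1 A1" "vertex_quotient G t w f1 A1 H1 w1"
      have "hedges H1 = A1" using s1(2) by (simp add: vertex_quotient_def)
      moreover have "implements B (Seq choose_side (Seq write_cut (assign 9 (NConst 1)))) s1 ?\<mu>
          (\<lambda>s' a. implements_while B j' ?g round s' (return_pmf a) ?Q)"
        by (rule implements_conseq[OF implements_stop[OF s1 k]]) (rule implements_while_exit, auto)
      ultimately show "implements B (if card (verts H1) \<le> r + 1 \<or> A1 = {}
          then Seq choose_side (Seq write_cut (assign 9 (NConst 1)))
          else Seq choose_hedge (Seq mark_chosen merge_marked)) s1 ?\<mu>
          (\<lambda>s' a. implements_while B j' ?g round s' (return_pmf a) ?Q)"
        using True by simp
    qed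
    from implements_while_iterate[OF g this] True show ?thesis
      by (simp add: alg j(1) bind_return_pmf')
  next
    case False
    \<comment> \<open>The continuation hidden in \<open>bind_spmf\<close>, written as a kernel on
      the option type so that \<open>implements_while_iterate\<close> applies.\<close>
    define \<nu> where "\<nu> = (\<lambda>z. case z of None \<Rightarrow> return_pmf None
      | Some e \<Rightarrow> alg_N (contract (ends H1 e) H1) r t (contract_weights (ends H1 e) w1) c b)"
    let ?R = "\<lambda>s' z. implements_while B j' ?g round s' (\<nu> z) ?Q"
    have "implements B round s (random_hedge H1 c) ?R"
    proof (rule round)
      fix s1 f1 A1 assume A1: "A1 \<subseteq> A" and s1: "repr s1 (Suc k) f1 A1"
        and q1: "vertex_quotient G t w f1 A1 H1 w1"
        and total: "rmem s1 3 0 0 = sum c A1" and s9: "nmem s1 9 = nmem s 9"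
      have H1: "hedges H1 = A1" using q1 by (simp add: vertex_quotient_def)
      with False have ne: "A1 \<noteq> {}" by simp
      \<comment> \<open>Marking and merging are deterministic, so the ghost hyperedge is handed on
        by \<open>return_pmf z\<close> and disappears by the right unit law.\<close>
      have "implements B choose_hedge s1 (random_hedge H1 c)
          (\<lambda>s' z. implements B (Seq mark_chosen merge_marked) s' (return_pmf z) ?R)"
      proof (rule implements_conseq[OF implements_frame[OF implements_choose_hedge[OF s1 total ne H1] repr(1)[OF s1]]])
        fix s2 z assume "(\<exists>e\<in>A1. z = Some e \<and> nmem s2 13 0 0 = e) \<and>
          frame (nmods choose_hedge) (rmods choose_hedge) s1 s2"
        then obtain e where e: "e \<in> A1" "z = Some e" "nmem s2 13 0 0 = e"
          and fr2: "frame (nmods choose_hedge) (rmods choose_hedge) s1 s2" by blast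
        have s2: "repr s2 (Suc k) f1 A1" by (rule repr_frame[OF s1 fr2]) auto
        show "implements B (Seq mark_chosen merge_marked) s2 (return_pmf z) ?R"
          unfolding implements_return
        proof (rule conseq_rule[OF computes_contract_chosen[OF s2 q1 e(1,3)]])
          fix s3 assume "\<exists>f' A'. A' \<subset> A1 \<and> repr s3 (Suc (Suc k)) f' A' \<and>
            vertex_quotient G t w f' A' (contract (ends H1 e) H1) (contract_weights (ends H1 e) w1)"
          then obtain f2 A2 where s3: "A2 \<subset> A1" "repr s3 (Suc (Suc k)) f2 A2"
            "vertex_quotient G t w f2 A2 (contract (ends H1 e) H1) (contract_weights (ends H1 e) w1)"
            by blast
          assume fr3: "frame (nmods (Seq mark_chosen merge_marked)) (rmods (Seq mark_chosen merge_marked)) s2 s3"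
          have "finite A" using repr(5)[OF s] by (rule finite_subset) simp
          then have card: "card A2 < card A"
            using s3(1) A1 by (intro psubset_card_mono) auto
          have "nmem s3 9 0 0 = 0"
            using less.prems(3) s9 by (simp add: frame_nmem[OF fr3] frame_nmem[OF fr2])
          from less.hyps[OF card s3(2,3) this] card less.prems(4) j(2)
          show "?R s3 z" by (simp add: \<nu>_def e(2))
        qed (use fr2 in \<open>auto simp: frame_on_input\<close>)
      qed auto
      from implements_Seq[OF this] False
      show "implements B (if card (verts H1) \<le> r + 1 \<or> A1 = {}
          then Seq choose_side (Seq write_cut (assign 9 (NConst 1)))
          else Seq choose_hedge (Seq mark_chosen merge_marked)) s1 (random_hedge H1 c) ?R"
        by (simp add: H1 bind_return_pmf')
    qed
    from implements_while_iterate[OF g this] False show ?thesis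
      by (simp add: alg j(1) bind_spmf_def \<nu>_def)
  qed
qed

lemma implements_contraction_program:
  "implements B contraction_program s0 (alg_N G r t w c b) (\<lambda>s' a. a = Some (output_cut G s'))"
  unfolding contraction_program_def
proof (rule implements_Seq_rule)
  have on0: "on_input s0" by (simp add: on_input_def)
  then show "on_input s0" .
  show "computes B (For 14 N_vertices (store 3 (var 14) (var 14))) s0 (\<lambda>s'. \<forall>v<n. nmem s' 3 v 0 = v)"
    by (rule fill_rule[OF on0, where M = "{3, 14}" and R = "{}"])
       (auto simp: le_B on_input(1) frame_on_input nmem_set_cell intro!: computes_store)
  fix s1 assume lab: "\<forall>v<n. nmem s1 3 v 0 = v"
    and fr1: "frame (nmods (For 14 N_vertices (store 3 (var 14) (var 14))))
      (rmods (For 14 N_vertices (store 3 (var 14) (var 14)))) s0 s1"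
  show "implements B (Seq (For 14 N_hedges (store 4 (var 14) (NConst 1))) (Seq (assign 8 N_vertices)
      (While (NEq (var 9) (NConst 0)) round))) s1 (alg_N G r t w c b) (\<lambda>s' a. a = Some (output_cut G s'))"
  proof (rule implements_Seq_rule)
    show "computes B (For 14 N_hedges (store 4 (var 14) (NConst 1))) s1 (\<lambda>s'. \<forall>e<m. nmem s' 4 e 0 = 1)"
      by (rule fill_rule[OF frame_on_input[OF fr1], where M = "{4, 14}" and R = "{}"])
         (auto simp: le_B on_input(2) frame_on_input nmem_set_cell intro!: computes_store)
    fix s2 assume alive: "\<forall>e<m. nmem s2 4 e 0 = 1"
      and fr2: "frame (nmods (For 14 N_hedges (store 4 (var 14) (NConst 1))))
        (rmods (For 14 N_hedges (store 4 (var 14) (NConst 1)))) s1 s2"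
    show "implements B (Seq (assign 8 N_vertices) (While (NEq (var 9) (NConst 0)) round)) s2
        (alg_N G r t w c b) (\<lambda>s' a. a = Some (output_cut G s'))"
    proof (rule implements_Seq_rule)
      show "computes B (assign 8 N_vertices) s2 (\<lambda>s'. nmem s' 8 0 0 = n)"
        by (rule computes_assign) (simp add: nmem_set_cell on_input(1) frame_on_input[OF fr2])
      fix s3 assume cnt: "nmem s3 8 0 0 = n"
        and fr3: "frame (nmods (assign 8 N_vertices)) (rmods (assign 8 N_vertices)) s2 s3"
      have "repr s3 n id {..<m}"
        unfolding repr_def using cnt lab alive frame_on_input[OF fr3]
        by (simp add: frame_nmem[OF fr3] frame_nmem[OF fr2])
      moreover have "vertex_quotient G t w id {..<m} G w"
      proof -
        have "{u \<in> verts G. u = v} = {v}" if "v \<in> verts G" for v using that by auto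
        then show ?thesis by (simp add: vertex_quotient_def G(3))
      qed
      \<comment> \<open>The stop flag relies on the default value zero in the input state.\<close>
      moreover have "nmem s3 9 0 0 = 0"
        by (simp add: frame_nmem[OF fr3] frame_nmem[OF fr2] frame_nmem[OF fr1] s0 input_state_def)
      ultimately have "implements_while B B (NEq (var 9) (NConst 0)) round s3 (alg_N G r t w c b)
          (\<lambda>s' a. a = Some (output_cut G s'))"
        by (rule implements_loop) (auto simp: B input_size_def n m)
      then show "implements B (While (NEq (var 9) (NConst 0)) round) s3 (alg_N G r t w c b)
          (\<lambda>s' a. a = Some (output_cut G s'))"
        by (rule implements_While) simp
    qed (use fr2 in \<open>auto simp: frame_on_input\<close>)
  qed (use fr1 in \<open>auto simp: frame_on_input\<close>)
qed auto

end

section \<open>From couplings to output distributions\<close>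

text \<open>If the ghost result is a function of the final state, the coupling relation becomes
  equality after mapping the states, and coupled distributions related by equality coincide.\<close>

lemma implements_halts:
  assumes "implements B p s \<mu> (\<lambda>s' a. a = Some (h s'))" and T: "cost B p \<le> T"
  shows "halts_within T p s" "spmf_of_pmf (map_pmf (\<lambda>(q, s'). h s') (run T p s)) = \<mu>"
proof -
  have imp: "implements_in T p s \<mu> (\<lambda>s' a. a = Some (h s'))"
    using implements_in_mono[OF _ T] assms(1) by (simp add: implements_def)
  then show "halts_within T p s" by (simp add: implements_in_def)
  have "rel_pmf (\<lambda>s' a. Some (h s') = a) (map_pmf snd (run T p s)) \<mu>"
    using imp by (simp add: implements_in_def eq_commute)
  then have "rel_pmf (=) (map_pmf (\<lambda>s'. Some (h s')) (map_pmf snd (run T p s))) \<mu>"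
    by (simp add: pmf.rel_map)
  then show "spmf_of_pmf (map_pmf (\<lambda>(q, s'). h s') (run T p s)) = \<mu>"
    by (simp add: pmf.rel_eq spmf_of_pmf_def pmf.map_comp o_def case_prod_unfold)
qed

theorem alg_N_polynomial_time:
  "\<exists>(prog :: com) (p :: nat poly).
     \<forall>(G :: (nat, nat) hypergraph) (r :: nat) (t :: nat)
     (w :: nat \<Rightarrow> nat \<Rightarrow> real) (c :: nat \<Rightarrow> real) (b :: nat \<Rightarrow> real).
     valid_instance G r t w c b \<longrightarrow> labelled G \<longrightarrow>
     (let T = poly p (input_size G t); s = input_state G r t w c b in
       halts_within T prog s \<and>
       spmf_of_pmf (map_pmf (\<lambda>(q, s'). output_cut G s') (run T prog s)) = alg_N G r t w c b)"
proof -
  obtain P where P: "\<And>B. cost B contraction_program = poly P B"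
    using cost_poly by blast
  show ?thesis
  \<comment> \<open>\<open>[:2, 2:]\<close> is the polynomial \<open>2 x + 2\<close>, that is, the
    loop bound \<open>B\<close> as a function of the input size.\<close>
  proof (rule exI[of _ contraction_program], rule exI[of _ "pcompose P [:2, 2:]"], intro allI impI)
    fix G :: "(nat, nat) hypergraph" and r t w c b
    assume I: "valid_instance G r t w c b" "labelled G"
    let ?B = "2 * input_size G t + 2" and ?s = "input_state G r t w c b"
    interpret instance_bound G r t w c b ?B "card (verts G)" "card (hedges G)" ?s
      using I by unfold_locales auto
    have "cost ?B contraction_program = poly (pcompose P [:2, 2:]) (input_size G t)"
      by (simp add: P poly_pcompose mult_2 mult_2_right)
    with implements_halts[OF implements_contraction_program]
    show "let T = poly (pcompose P [:2, 2:]) (input_size G t); s = ?s in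
        halts_within T contraction_program s \<and>
        spmf_of_pmf (map_pmf (\<lambda>(q, s'). output_cut G s') (run T contraction_program s)) = alg_N G r t w c b"
      by (simp add: Let_def)
  qed
qed

theorem theorem8:
  shows "(\<forall>(G :: ('v, 'e) hypergraph) (n :: nat) (r :: nat) (t :: nat)
            (w :: nat \<Rightarrow> 'v \<Rightarrow> real) (c :: 'e \<Rightarrow> real) (b :: nat \<Rightarrow> real) (F :: 'e set).
            valid_instance G r t w c b \<longrightarrow> card (verts G) = n \<longrightarrow>
            node_budgeted_min_cut G t w c b F \<longrightarrow>
            spmf (alg_N G r t w c b) F \<ge> 1 / (2 ^ (r + 1) * real (n choose 2)))
       \<and> (\<exists>(prog :: com) (p :: nat poly).
            \<forall>(G :: (nat, nat) hypergraph) (r :: nat) (t :: nat)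
            (w :: nat \<Rightarrow> nat \<Rightarrow> real) (c :: nat \<Rightarrow> real) (b :: nat \<Rightarrow> real).
            valid_instance G r t w c b \<longrightarrow> labelled G \<longrightarrow>
            (let T = poly p (input_size G t); s = input_state G r t w c b in
              halts_within T prog s \<and>
              spmf_of_pmf (map_pmf (\<lambda>(q, s'). output_cut G s') (run T prog s)) = alg_N G r t w c b))"
proof (intro conjI allI impI)
  fix G :: "('v, 'e) hypergraph" and n r t w c b F
  assume "valid_instance G r t w c b" "card (verts G) = n" "node_budgeted_min_cut G t w c b F"
  then show "1 / (2 ^ (r + 1) * real (n choose 2)) \<le> spmf (alg_N G r t w c b) F"
    using alg_N_success_probability by blast
qed (rule alg_N_polynomial_time)

end
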